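(* For every fixed integer $r>1$, as $n\to\infty$, $$\sigma_{r,o}\mathrm{mex}(n)\ \sim\ \sigma_{r,e}\mathrm{mex}(n)\ \sim\ \frac18\left(6n^3r^2\right)^{-1/4}\exp\left(\pi\sqrt{\frac{2n}{3}}\right).$$
   Context: $\mathcal{P}(n)$ is the set of all partitions of $n$. For an integer $r\geq 1$ and a partition $\pi$, $r\text{-}\mathrm{mex}(\pi)$ (the least $r$-gap) is the least positive integer that does not occur at least $r$ times as a part of $\pi$. Define $$\sigma_{r,o}\mathrm{mex}(n):=\sum_{\substack{\pi\in\mathcal{P}(n)\\ 2\nmid r\text{-}\mathrm{mex}(\pi)}}r\text{-}\mathrm{mex}(\pi),\qquad \sigma_{r,e}\mathrm{mex}(n):=\sum_{\substack{\pi\in\mathcal{P}(n)\\ 2\mid r\text{-}\mathrm{mex}(\pi)}}r\text{-}\mathrm{mex}(\pi).$$ Here $a(n)\sim b(n)$ means $a(n)/b(n)\to 1$. *)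

theory Defs
  imports Complex_Main "HOL-Library.Multiset" "HOL-Library.Landau_Symbols"
begin

text \<open>A partition is represented by the multiset of its parts.\<close>

definition partitions :: "nat \<Rightarrow> nat multiset set" where
  "partitions n = {\<pi>. 0 \<notin># \<pi> \<and> sum_mset \<pi> = n}"

text \<open>For \<open>r \<ge> 1\<close> the least element below exists, since a finite multiset omits some
  positive integer; for \<open>r = 0\<close> the value is unspecified.\<close>

definition r_mex :: "nat \<Rightarrow> nat multiset \<Rightarrow> nat" where
  "r_mex r \<pi> = (LEAST m. m > 0 \<and> \<not> count \<pi> m \<ge> r)"

definition sigma_o_mex :: "nat \<Rightarrow> nat \<Rightarrow> nat" where
  "sigma_o_mex r n = (\<Sum>\<pi> \<in> {\<pi> \<in> partitions n. \<not> 2 dvd r_mex r \<pi>}. r_mex r \<pi>)"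

definition sigma_e_mex :: "nat \<Rightarrow> nat \<Rightarrow> nat" where
  "sigma_e_mex r n = (\<Sum>\<pi> \<in> {\<pi> \<in> partitions n. 2 dvd r_mex r \<pi>}. r_mex r \<pi>)"

text \<open>The index sets above are finite, so the sums are genuine sums.\<close>

lemma size_le_sum_mset: "0 \<notin># \<pi> \<Longrightarrow> size \<pi> \<le> sum_mset \<pi>" for \<pi> :: "nat multiset"
  by (induction \<pi>) auto

lemma finite_partitions: "finite (partitions n)"
proof (rule finite_subset)
  show "partitions n \<subseteq> mset ` {xs. set xs \<subseteq> {..n} \<and> length xs \<le> n}"
  proof
    fix \<pi> assume "\<pi> \<in> partitions n"
    hence \<pi>: "0 \<notin># \<pi>" "sum_mset \<pi> = n"
      by (auto simp: partitions_def)
    obtain xs where xs: "mset xs = \<pi>"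
      by (metis ex_mset)
    have "x \<le> n" if "x \<in># \<pi>" for x
      using \<pi>(2) sum_mset.remove[OF that] by simp
    moreover have "length xs \<le> n"
      using size_le_sum_mset[OF \<pi>(1)] \<pi>(2) xs by auto
    ultimately show "\<pi> \<in> mset ` {xs. set xs \<subseteq> {..n} \<and> length xs \<le> n}"
      using xs by (auto intro!: image_eqI[of _ _ xs])
  qed
  show "finite (mset ` {xs. set xs \<subseteq> {..n} \<and> length xs \<le> n})"
    by (intro finite_imageI finite_lists_length_le) auto
qed

lemma r_mex_exists:
  assumes "r \<ge> 1"
  shows "r_mex r \<pi> > 0 \<and> \<not> count \<pi> (r_mex r \<pi>) \<ge> r"
proof -
  obtain m where "m \<notin> insert 0 (set_mset \<pi>)"
    using ex_new_if_finite[OF infinite_UNIV_nat] by (metis finite_insert finite_set_mset)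
  hence "m > 0 \<and> \<not> count \<pi> m \<ge> r"
    using assms by (auto simp: not_in_iff)
  thus ?thesis
    unfolding r_mex_def by (rule LeastI)
qed

end

theory Submission
  imports Defs "HOL-Complex_Analysis.Complex_Analysis" "HOL-Probability.Probability" "HOL-Real_Asymp.Real_Asymp"
begin

text \<open>
  The number of partitions with \<open>r\<close>-mex larger than \<open>j\<close> is \<open>p(n - r j (j + 1) / 2)\<close>, so the sum of
  all \<open>r\<close>-mexes is a theta-like sum of partition numbers, which the Hardy--Ramanujan formula turns
  into a Gaussian integral. The odd and the even part differ by only \<open>O(p(n))\<close>, because \<open>p\<close> is convex.

  For the Hardy--Ramanujan formula write the generating function as
  \<open>exp (\<Sum> \<sigma>(n) / n * z\<^sup>n)\<close> with \<open>\<sigma>\<close> the divisor sum. On the circle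
  of radius \<open>e\<^sup>-\<^sup>t\<close> with \<open>t = \<pi> / \<surd>(6 n)\<close> its quotient by its value at the real point is the characteristic
  function of a compound Poisson law, so the coefficient integral converges to a Gaussian integral as
  in a local limit theorem. The value at the real point is \<open>e\<^sup>L\<close> where
  \<open>L(t) = \<pi>\<^sup>2 / (6 t) + ln t / 2 + c + o(1)\<close>; the existence and the value of \<open>c\<close> follow from
  \<open>t * L(t) \<rightarrow> \<pi>\<^sup>2 / 6\<close> and from the limit of \<open>2 L(t) - 4 L(2 t) + ln (1 - e\<^sup>-\<^sup>t)\<close>, a \<open>q\<close>-analogue
  of the logarithm of Wallis' product.
\<close>

subsection \<open>Counting partitions\<close>

text \<open>One integral over the angle suffices because \<open>log_coeff n \<ge> 1\<close> compares
  the integrand on the whole circle with that of a geometric series. The choice of \<open>t\<close>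
  solves the saddle point equation \<open>log_moment 1 t = n\<close> only to leading order, as
  \<open>n = pi^2 / (6 * t^2)\<close>. That is accurate enough: the relevant angles have size
  \<open>t powr (3/2)\<close>, up to a constant the inverse of the standard deviation, and on this
  scale the error in the mean tends to 0. By contrast \<open>L\<close> must be known up to
  \<open>o(1)\<close>, since \<open>e^L\<close> is a factor of the result. The doubling relation
  alone does not determine \<open>L\<close>: the function \<open>1 / t\<close> solves
  \<open>g t = 2 * g (2 * t)\<close>, and only the separate limit of \<open>t * L(t)\<close>
  excludes it. For the mex, the relevant \<open>j\<close> have size \<open>n powr (1/4)\<close>, so
  the total is of order \<open>n powr (1/4) * p(n)\<close>. A difference of order
  \<open>p(n)\<close> between the parities is negligible against this, and so is any polynomial
  error.\<close>

definition num_partitions :: "nat \<Rightarrow> nat" where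
  "num_partitions n = card (partitions n)"

definition divisor_sum :: "nat \<Rightarrow> nat" where
  "divisor_sum k = \<Sum>{d. d dvd k}"

text \<open>Removing \<open>R\<close> inverts adding it. The lemma is applied with \<open>R\<close>
  consisting of a single 1, of \<open>j\<close> copies of \<open>d\<close>, and of \<open>r\<close>
  copies of each of 1, ..., \<open>j\<close>.\<close>

lemma card_partitions_superset:
  assumes "0 \<notin># R"
  shows "card {\<pi> \<in> partitions n. R \<subseteq># \<pi>} =
           (if sum_mset R \<le> n then num_partitions (n - sum_mset R) else 0)"
proof (cases "sum_mset R \<le> n")
  case True
  have "bij_betw (\<lambda>\<pi>. \<pi> + R) (partitions (n - sum_mset R)) {\<pi> \<in> partitions n. R \<subseteq># \<pi>}"
  proof (rule bij_betw_byWitness[where f' = "\<lambda>\<pi>. \<pi> - R"])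
    show "(\<lambda>\<pi>. \<pi> - R) ` {\<pi> \<in> partitions n. R \<subseteq># \<pi>} \<subseteq> partitions (n - sum_mset R)"
      by (auto simp: partitions_def sum_mset_diff dest: in_diffD)
  qed (use assms True in \<open>auto simp: partitions_def\<close>)
  thus ?thesis
    using True by (simp add: num_partitions_def bij_betw_same_card)
next
  case False
  have "sum_mset R \<le> sum_mset \<pi>" if "R \<subseteq># \<pi>" for \<pi>
    using that by (metis le_add1 subset_mset.add_diff_inverse sum_mset.union)
  hence "{\<pi> \<in> partitions n. R \<subseteq># \<pi>} = {}"
    using False by (auto simp: partitions_def)
  thus ?thesis
    unfolding \<open>{\<pi> \<in> partitions n. R \<subseteq># \<pi>} = {}\<close> using False by simp
qed

lemma num_partitions_0: "num_partitions 0 = 1"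
proof -
  have "partitions 0 = {{#}}"
    by (auto simp: partitions_def) (metis multiset_nonemptyE)
  thus ?thesis by (simp add: num_partitions_def)
qed

lemma sum_mset_eq_sum_count:
  fixes \<pi> :: "nat multiset"
  assumes "set_mset \<pi> \<subseteq> A" "finite A"
  shows "sum_mset \<pi> = (\<Sum>d\<in>A. d * count \<pi> d)"
  using assms(1)
proof (induction \<pi>)
  case (add x \<pi>)
  have "(\<Sum>d\<in>A. d * count (add_mset x \<pi>) d) = (\<Sum>d\<in>A. d * count \<pi> d + (if d = x then d else 0))"
    by (intro sum.cong) auto
  also have "\<dots> = (\<Sum>d\<in>A. d * count \<pi> d) + x"
    using add.prems assms(2) by (simp add: sum.distrib)
  finally show ?case using add by simp
qed auto

lemma part_le: "\<pi> \<in> partitions n \<Longrightarrow> x \<in># \<pi> \<Longrightarrow> x \<le> n"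
  by (auto simp: partitions_def dest!: multi_member_split)

lemma count_part_le:
  assumes "\<pi> \<in> partitions n" "d \<ge> 1"
  shows "count \<pi> d \<le> n"
  using assms size_le_sum_mset[of \<pi>] count_le_size[of \<pi> d] by (auto simp: partitions_def)

text \<open>Double counting of the sum of all parts of all partitions of \<open>n\<close>: the
  \<open>j\<close>-th copy of the part \<open>d\<close> contributes \<open>d\<close> and is present
  in \<open>p(n - j * d)\<close> partitions. Grouping by \<open>k = j * d\<close> makes
  \<open>d\<close> run over the divisors of \<open>k\<close>.\<close>

lemma partition_recurrence:
  "n * num_partitions n = (\<Sum>k=1..n. divisor_sum k * num_partitions (n - k))"
proof -
  have "n * num_partitions n = (\<Sum>\<pi>\<in>partitions n. sum_mset \<pi>)"
    by (simp add: num_partitions_def partitions_def)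
  also have "\<dots> = (\<Sum>\<pi>\<in>partitions n. \<Sum>d=1..n. \<Sum>j=1..n. d * of_bool (replicate_mset j d \<subseteq># \<pi>))"
  proof (rule sum.cong[OF refl])
    fix \<pi> assume \<pi>: "\<pi> \<in> partitions n"
    have "set_mset \<pi> \<subseteq> {1..n}"
    proof
      fix x assume x: "x \<in># \<pi>"
      hence "x \<noteq> 0" using \<pi> by (metis (mono_tags, lifting) mem_Collect_eq partitions_def)
      thus "x \<in> {1..n}" using part_le[OF \<pi> x] by simp
    qed
    hence "sum_mset \<pi> = (\<Sum>d=1..n. d * count \<pi> d)"
      by (intro sum_mset_eq_sum_count) auto
    also have "\<dots> = (\<Sum>d=1..n. \<Sum>j=1..n. d * of_bool (replicate_mset j d \<subseteq># \<pi>))"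
    proof (rule sum.cong[OF refl])
      fix d assume d: "d \<in> {1..n}"
      have "count \<pi> d = card {j \<in> {1..n}. replicate_mset j d \<subseteq># \<pi>}"
      proof -
        have "{j \<in> {1..n}. replicate_mset j d \<subseteq># \<pi>} = {1..count \<pi> d}"
          using count_part_le[OF \<pi>, of d] d by (auto simp: count_le_replicate_mset_subset_eq[symmetric])
        thus ?thesis by simp
      qed
      also have "\<dots> = (\<Sum>j=1..n. of_bool (replicate_mset j d \<subseteq># \<pi>))"
        by (simp add: sum_of_bool_eq Int_def)
      finally show "d * count \<pi> d = (\<Sum>j=1..n. d * of_bool (replicate_mset j d \<subseteq># \<pi>))"
        by (simp add: sum_distrib_left)
    qed
    finally show "sum_mset \<pi> = (\<Sum>d=1..n. \<Sum>j=1..n. d * of_bool (replicate_mset j d \<subseteq># \<pi>))" .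
  qed
  also have "\<dots> = (\<Sum>d=1..n. \<Sum>j=1..n. d * (\<Sum>\<pi>\<in>partitions n. of_bool (replicate_mset j d \<subseteq># \<pi>)))"
    by (subst sum.swap) (simp only: sum.swap[of _ _ "partitions n"] sum_distrib_left)
  also have "\<dots> = (\<Sum>d=1..n. \<Sum>j=1..n. d * (if j * d \<le> n then num_partitions (n - j * d) else 0))"
  proof (intro sum.cong[OF refl])
    fix d j assume d: "d \<in> {1..n}"
    have "(\<Sum>\<pi>\<in>partitions n. of_bool (replicate_mset j d \<subseteq># \<pi>)) = card {\<pi> \<in> partitions n. replicate_mset j d \<subseteq># \<pi>}"
      using finite_partitions[of n] by (simp add: sum_of_bool_eq Int_def)
    also have "\<dots> = (if j * d \<le> n then num_partitions (n - j * d) else 0)"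
      using d by (subst card_partitions_superset) auto
    finally show "d * (\<Sum>\<pi>\<in>partitions n. of_bool (replicate_mset j d \<subseteq># \<pi>)) =
        d * (if j * d \<le> n then num_partitions (n - j * d) else 0)" by simp
  qed
  also have "\<dots> = (\<Sum>(d, j)\<in>{1..n} \<times> {1..n}. d * (if j * d \<le> n then num_partitions (n - j * d) else 0))"
    by (simp add: sum.cartesian_product)
  also have "\<dots> = (\<Sum>(d, j)\<in>{(d, j) \<in> {1..n} \<times> {1..n}. j * d \<le> n}. d * num_partitions (n - j * d))"
    by (rule sum.mono_neutral_cong_right) (auto simp del: neq0_conv split: if_splits)
  also have "\<dots> = (\<Sum>(k, d)\<in>(SIGMA k:{1..n}. {d. d dvd k}). d * num_partitions (n - k))"
    by (rule sum.reindex_bij_witness[where j = "\<lambda>(d, j). (j * d, d)" and i = "\<lambda>(k, d). (d, k div d)"])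
       (auto dest: dvd_imp_le intro: div_le_dividend le_trans simp: Suc_le_eq dvd_div_eq_0_iff intro!: Nat.gr0I)
  also have "\<dots> = (\<Sum>k=1..n. divisor_sum k * num_partitions (n - k))"
    by (subst sum.Sigma[symmetric]) (auto simp: divisor_sum_def sum_distrib_right)
  finally show ?thesis .
qed

section \<open>Convexity of the partition numbers\<close>

definition num_partitions_no_ones :: "nat \<Rightarrow> nat" where
  "num_partitions_no_ones n = card {\<pi> \<in> partitions n. 1 \<notin># \<pi>}"

text \<open>Splitting by whether 1 is a part identifies \<open>num_partitions_no_ones\<close> with
  the difference of consecutive partition numbers, so its monotonicity is the convexity of
  p.\<close>

lemma num_partitions_Suc:
  "num_partitions (Suc n) = num_partitions n + num_partitions_no_ones (Suc n)"
proof -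
  have "num_partitions (Suc n) = card ({\<pi> \<in> partitions (Suc n). {#1#} \<subseteq># \<pi>} \<union> {\<pi> \<in> partitions (Suc n). 1 \<notin># \<pi>})"
    unfolding num_partitions_def by (rule arg_cong[where f = card]) auto
  also have "\<dots> = card {\<pi> \<in> partitions (Suc n). {#1#} \<subseteq># \<pi>} + num_partitions_no_ones (Suc n)"
    unfolding num_partitions_no_ones_def using finite_partitions
    by (intro card_Un_disjoint) auto
  also have "card {\<pi> \<in> partitions (Suc n). {#1#} \<subseteq># \<pi>} = num_partitions n"
    by (subst card_partitions_superset) auto
  finally show ?thesis .
qed

lemma num_partitions_mono: "m \<le> n \<Longrightarrow> num_partitions m \<le> num_partitions n"
  by (rule lift_Suc_mono_le[of num_partitions]) (simp_all add: num_partitions_Suc)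

text \<open>Adding 1 to a largest part is injective, since the result shows which part was changed:
  its largest one. For \<open>n = 0\<close> there is no largest part, and the inequality fails (1
  against 0).\<close>

lemma num_partitions_no_ones_Suc:
  assumes "n \<ge> 1"
  shows "num_partitions_no_ones n \<le> num_partitions_no_ones (Suc n)"
  unfolding num_partitions_no_ones_def
proof (rule card_inj_on_le)
  define f :: "nat multiset \<Rightarrow> nat multiset" where
    "f = (\<lambda>\<pi>. add_mset (Suc (Max_mset \<pi>)) (\<pi> - {#Max_mset \<pi>#}))"
  have ne: "\<pi> \<noteq> {#}" if "\<pi> \<in> partitions n" for \<pi>
    using that assms by (auto simp: partitions_def)
  have max_f: "Max_mset (f \<pi>) = Suc (Max_mset \<pi>)" if "\<pi> \<in> partitions n" for \<pi>
    unfolding f_def using ne[OF that]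
    by (intro Max_eqI) (auto dest!: in_diffD intro: le_SucI)
  show "inj_on f {\<pi> \<in> partitions n. 1 \<notin># \<pi>}"
  proof (rule inj_onI)
    fix \<pi> \<rho> assume *: "\<pi> \<in> {\<pi> \<in> partitions n. 1 \<notin># \<pi>}" "\<rho> \<in> {\<pi> \<in> partitions n. 1 \<notin># \<pi>}" "f \<pi> = f \<rho>"
    hence M: "Max_mset \<pi> = Max_mset \<rho>"
      using max_f by (metis (no_types, lifting) mem_Collect_eq old.nat.inject)
    hence "\<pi> - {#Max_mset \<pi>#} = \<rho> - {#Max_mset \<rho>#}"
      using *(3) by (simp add: f_def)
    moreover have "Max_mset \<pi> \<in># \<pi>" "Max_mset \<rho> \<in># \<rho>"
      using *(1,2) ne by auto
    ultimately show "\<pi> = \<rho>"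
      using M by (metis insert_DiffM)
  qed
  show "f ` {\<pi> \<in> partitions n. 1 \<notin># \<pi>} \<subseteq> {\<pi> \<in> partitions (Suc n). 1 \<notin># \<pi>}"
  proof safe
    fix \<pi> assume \<pi>: "\<pi> \<in> partitions n" "1 \<notin># \<pi>"
    have mem: "Max_mset \<pi> \<in># \<pi>" using ne[OF \<pi>(1)] by auto
    have "sum_mset \<pi> = Max_mset \<pi> + sum_mset (\<pi> - {#Max_mset \<pi>#})"
      by (rule sum_mset.remove[OF mem])
    thus "f \<pi> \<in> partitions (Suc n)"
      using \<pi> by (auto simp: f_def partitions_def dest: in_diffD)
    have "Max_mset \<pi> \<noteq> 0" using mem \<pi>(1) by (metis (mono_tags, lifting) mem_Collect_eq partitions_def)
    moreover assume "1 \<in># f \<pi>"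
    ultimately show False using \<pi> by (auto simp: f_def dest: in_diffD)
  qed
  show "finite {\<pi> \<in> partitions (Suc n). 1 \<notin># \<pi>}"
    using finite_partitions by auto
qed

lemma num_partitions_1: "num_partitions 1 = 1"
proof -
  have "partitions 1 = {{#1#}}"
  proof (rule set_eqI)
    fix \<pi> :: "nat multiset"
    show "\<pi> \<in> partitions 1 \<longleftrightarrow> \<pi> \<in> {{#1#}}"
    proof
      assume \<pi>: "\<pi> \<in> partitions 1"
      then obtain x where x: "x \<in># \<pi>"
        unfolding partitions_def by (metis (mono_tags, lifting) mem_Collect_eq multiset_nonemptyE sum_mset.empty zero_neq_one)
      hence "x = 1"
        using part_le[OF \<pi> x] \<pi> by (auto simp: partitions_def le_Suc_eq)
      then obtain \<rho> where \<rho>: "\<pi> = add_mset 1 \<rho>"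
        using x by (metis multi_member_split)
      have "\<rho> = {#}"
        using \<pi> unfolding \<rho> partitions_def by auto (metis multiset_nonemptyE)
      thus "\<pi> \<in> {{#1#}}" using \<rho> by simp
    qed (auto simp: partitions_def)
  qed
  thus ?thesis by (simp add: num_partitions_def)
qed

lemma num_partitions_no_ones_2: "num_partitions_no_ones 2 \<ge> 1"
proof -
  have "{#2#} \<in> {\<pi> \<in> partitions 2. 1 \<notin># \<pi>}" by (auto simp: partitions_def)
  hence "{\<pi> \<in> partitions 2. 1 \<notin># \<pi>} \<noteq> {}" by blast
  thus ?thesis
    unfolding num_partitions_no_ones_def using finite_partitions[of 2]
    by (simp add: Suc_le_eq card_gt_0_iff)
qed

subsection \<open>The distribution of the mex\<close>

definition mex_tail :: "nat \<Rightarrow> nat \<Rightarrow> nat \<Rightarrow> nat" where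
  "mex_tail r n j = (if r * \<Sum>{1..j} \<le> n then num_partitions (n - r * \<Sum>{1..j}) else 0)"

lemma less_r_mex_iff:
  assumes "r \<ge> 1"
  shows "j < r_mex r \<pi> \<longleftrightarrow> (\<forall>i\<in>{1..j}. r \<le> count \<pi> i)"
proof
  assume j: "j < r_mex r \<pi>"
  show "\<forall>i\<in>{1..j}. r \<le> count \<pi> i"
  proof (intro ballI, rule ccontr)
    fix i assume "i \<in> {1..j}" "\<not> r \<le> count \<pi> i"
    moreover from this have "r_mex r \<pi> \<le> i"
      unfolding r_mex_def by (intro Least_le) auto
    ultimately show False using j by simp
  qed
next
  assume *: "\<forall>i\<in>{1..j}. r \<le> count \<pi> i"
  show "j < r_mex r \<pi>"
  proof (rule ccontr)
    assume "\<not> j < r_mex r \<pi>"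
    hence "r_mex r \<pi> \<in> {1..j}"
      using r_mex_exists[OF assms, of \<pi>] by simp
    thus False using * r_mex_exists[OF assms, of \<pi>] by blast
  qed
qed

lemma card_less_r_mex:
  assumes "r \<ge> 1"
  shows "card {\<pi> \<in> partitions n. j < r_mex r \<pi>} = mex_tail r n j"
proof -
  \<comment> \<open>The mex exceeds \<open>j\<close> exactly if the partition contains this
    multiset.\<close>
  define R where "R = (\<Sum>i\<in>{1..j}. replicate_mset r i)"
  have count_R: "count R i = (if i \<in> {1..j} then r else 0)" for i
    unfolding R_def count_sum by (auto simp: sum.delta)
  have "j < r_mex r \<pi> \<longleftrightarrow> R \<subseteq># \<pi>" for \<pi>
    unfolding less_r_mex_iff[OF assms] subseteq_mset_def count_R by auto
  moreover have "sum_mset R = r * \<Sum>{1..j}"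
    unfolding R_def by (induction j) (auto simp: algebra_simps)
  moreover have "0 \<notin># R"
    using count_R[of 0] by (simp add: not_in_iff)
  ultimately show ?thesis
    by (simp add: card_partitions_superset mex_tail_def)
qed

lemma mex_tail_eq_0:
  assumes "r \<ge> 1" "j > n"
  shows "mex_tail r n j = 0"
proof -
  have "j = \<Sum>{j}" by simp
  also have "\<dots> \<le> \<Sum>{1..j}" using assms by (intro sum_mono2) auto
  also have "\<dots> \<le> r * \<Sum>{1..j}" using assms by simp
  finally show ?thesis using assms by (simp add: mex_tail_def)
qed

lemma r_mex_le:
  assumes "r \<ge> 1" "\<pi> \<in> partitions n"
  shows "r_mex r \<pi> \<le> n + 1"
proof (rule ccontr)
  assume "\<not> r_mex r \<pi> \<le> n + 1"
  hence "\<pi> \<in> {\<pi> \<in> partitions n. n + 1 < r_mex r \<pi>}" using assms by auto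
  moreover have "card {\<pi> \<in> partitions n. n + 1 < r_mex r \<pi>} = 0"
    using card_less_r_mex[OF assms(1)] mex_tail_eq_0[OF assms(1)] by simp
  ultimately show False using finite_partitions[of n] by auto
qed

lemma card_r_mex_eq:
  assumes "r \<ge> 1"
  shows "real (card {\<pi> \<in> partitions n. r_mex r \<pi> = Suc m}) = real (mex_tail r n m) - real (mex_tail r n (Suc m))"
proof -
  have "mex_tail r n m = card ({\<pi> \<in> partitions n. r_mex r \<pi> = Suc m} \<union> {\<pi> \<in> partitions n. Suc m < r_mex r \<pi>})"
    unfolding card_less_r_mex[OF assms, symmetric] by (rule arg_cong[where f = card]) auto
  also have "\<dots> = card {\<pi> \<in> partitions n. r_mex r \<pi> = Suc m} + mex_tail r n (Suc m)"
    unfolding card_less_r_mex[OF assms, symmetric] using finite_partitions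
    by (intro card_Un_disjoint) auto
  finally show ?thesis by simp
qed

text \<open>One argument for both parities: \<open>g\<close> lists the admissible values of the mex
  minus one, \<open>2 * k\<close> for odd and \<open>2 * k + 1\<close> for even values. The bound
  \<open>r_mex_le\<close> makes \<open>n + 1\<close> values of \<open>k\<close> enough.\<close>

lemma sum_r_mex_filter:
  fixes g :: "nat \<Rightarrow> nat"
  assumes "r \<ge> 1" "inj_on g {..<N}"
    "\<And>\<pi>. \<pi> \<in> partitions n \<Longrightarrow> P (r_mex r \<pi>) \<longleftrightarrow> (\<exists>k<N. r_mex r \<pi> = Suc (g k))"
  shows "real (\<Sum>\<pi> \<in> {\<pi> \<in> partitions n. P (r_mex r \<pi>)}. r_mex r \<pi>) =
           (\<Sum>k<N. real (Suc (g k)) * (real (mex_tail r n (g k)) - real (mex_tail r n (Suc (g k)))))"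
proof -
  have "{\<pi> \<in> partitions n. P (r_mex r \<pi>)} = (\<Union>k<N. {\<pi> \<in> partitions n. r_mex r \<pi> = Suc (g k)})"
    using assms(3) by auto
  hence "(\<Sum>\<pi> \<in> {\<pi> \<in> partitions n. P (r_mex r \<pi>)}. r_mex r \<pi>) =
      (\<Sum>k<N. \<Sum>\<pi> \<in> {\<pi> \<in> partitions n. r_mex r \<pi> = Suc (g k)}. r_mex r \<pi>)"
    using finite_partitions[of n] assms(2)
    by (simp only:, intro sum.UNION_disjoint finite_lessThan) (auto simp: inj_on_def)
  also have "\<dots> = (\<Sum>k<N. Suc (g k) * card {\<pi> \<in> partitions n. r_mex r \<pi> = Suc (g k)})"
    by (intro sum.cong) auto
  finally show ?thesis
    by (simp only: of_nat_sum of_nat_mult card_r_mex_eq[OF assms(1)])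
qed

lemma sigma_o_mex_eq:
  assumes "r \<ge> 1"
  shows "real (sigma_o_mex r n) = (\<Sum>k<n+1. real (Suc (2*k)) * (real (mex_tail r n (2*k)) - real (mex_tail r n (Suc (2*k)))))"
  unfolding sigma_o_mex_def
proof (rule sum_r_mex_filter[OF assms])
  fix \<pi> assume \<pi>: "\<pi> \<in> partitions n"
  show "odd (r_mex r \<pi>) \<longleftrightarrow> (\<exists>k<n+1. r_mex r \<pi> = Suc (2 * k))"
    using r_mex_le[OF assms \<pi>] by (auto elim!: oddE)
qed (auto simp: inj_on_def)

lemma sigma_e_mex_eq:
  assumes "r \<ge> 1"
  shows "real (sigma_e_mex r n) = (\<Sum>k<n+1. real (Suc (Suc (2*k))) * (real (mex_tail r n (Suc (2*k))) - real (mex_tail r n (Suc (Suc (2*k))))))"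
  unfolding sigma_e_mex_def
proof (rule sum_r_mex_filter[OF assms])
  fix \<pi> assume \<pi>: "\<pi> \<in> partitions n"
  have "even (Suc (Suc (2 * k)))" for k by simp
  moreover have "\<exists>k<n+1. r_mex r \<pi> = Suc (Suc (2 * k))" if ev: "even (r_mex r \<pi>)"
  proof -
    obtain l where l: "r_mex r \<pi> = 2 * l" using ev by auto
    moreover have "r_mex r \<pi> > 0" using r_mex_exists[OF assms] by blast
    ultimately obtain k where "l = Suc k" by (cases l) auto
    thus ?thesis using l r_mex_le[OF assms \<pi>] by (intro exI[of _ k]) auto
  qed
  ultimately show "even (r_mex r \<pi>) \<longleftrightarrow> (\<exists>k<n+1. r_mex r \<pi> = Suc (Suc (2 * k)))"
    by metis
qed (auto simp: inj_on_def)

lemma sigma_mex_sum: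
  assumes "r \<ge> 1"
  shows "sigma_o_mex r n + sigma_e_mex r n = (\<Sum>j\<le>n. mex_tail r n j)"
proof -
  have "sigma_o_mex r n + sigma_e_mex r n = (\<Sum>\<pi>\<in>{\<pi> \<in> partitions n. odd (r_mex r \<pi>)} \<union> {\<pi> \<in> partitions n. even (r_mex r \<pi>)}. r_mex r \<pi>)"
    unfolding sigma_o_mex_def sigma_e_mex_def using finite_partitions[of n]
    by (intro sum.union_disjoint[symmetric]) auto
  also have "{\<pi> \<in> partitions n. odd (r_mex r \<pi>)} \<union> {\<pi> \<in> partitions n. even (r_mex r \<pi>)} = partitions n"
    by auto
  \<comment> \<open>Layer cake: the mex is the number of \<open>j\<close> below it, and these
    satisfy \<open>j \<le> n\<close> by \<open>r_mex_le\<close>.\<close>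
  also have "(\<Sum>\<pi>\<in>partitions n. r_mex r \<pi>) = (\<Sum>\<pi>\<in>partitions n. \<Sum>j\<le>n. of_bool (j < r_mex r \<pi>))"
  proof (rule sum.cong[OF refl])
    fix \<pi> assume "\<pi> \<in> partitions n"
    hence "{j. j \<le> n \<and> j < r_mex r \<pi>} = {..<r_mex r \<pi>}"
      using r_mex_le[OF assms] by fastforce
    thus "r_mex r \<pi> = (\<Sum>j\<le>n. of_bool (j < r_mex r \<pi>))"
      by (simp add: sum_of_bool_eq Int_def)
  qed
  also have "\<dots> = (\<Sum>j\<le>n. card {\<pi> \<in> partitions n. j < r_mex r \<pi>})"
    using finite_partitions[of n] by (subst sum.swap) (simp add: sum_of_bool_eq Int_def)
  finally show ?thesis
    by (simp add: card_less_r_mex[OF assms])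
qed

subsection \<open>Odd and even values of the mex balance\<close>

text \<open>As \<open>(m + 1)^2 / m \<le> m + 3\<close>, the assumption lets \<open>m * b m\<close>
  grow by at most \<open>3 * b m\<close> when \<open>m\<close> is replaced by \<open>m + 1\<close>.
  Comparing each even term with the odd one before it, and each odd term with the even one before
  it, bounds the difference from both sides. The term \<open>m = 1\<close> has no predecessor and
  costs \<open>b 1\<close>.\<close>

lemma parity_balance:
  fixes b :: "nat \<Rightarrow> real"
  assumes nonneg: "\<And>m. b m \<ge> 0"
    and step: "\<And>m. m \<ge> 1 \<Longrightarrow> real m * b (Suc m) \<le> real (Suc m) * b m"
  shows "\<bar>(\<Sum>k<N. real (Suc (2*k)) * b (Suc (2*k))) - (\<Sum>k<N. real (Suc (Suc (2*k))) * b (Suc (Suc (2*k))))\<bar>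
           \<le> b 1 + 3 * (\<Sum>m=1..2*N. b m)"
proof -
  have step': "real (Suc m) * b (Suc m) \<le> real m * b m + 3 * b m" if "m \<ge> 1" for m
  proof -
    have "real (Suc m) * b (Suc m) = real m * b (Suc m) * (real (Suc m) / real m)"
      using that by (simp add: field_simps)
    also have "\<dots> \<le> real (Suc m) * b m * (real (Suc m) / real m)"
      by (intro mult_right_mono step that) auto
    also have "\<dots> = (real m + 2 + 1 / real m) * b m"
      using that by (simp add: field_simps)
    also have "\<dots> \<le> (real m + 3) * b m"
      using that nonneg by (intro mult_right_mono) (auto simp: field_simps)
    finally show ?thesis by (simp add: algebra_simps)
  qed
  define O' E' where "O' = (\<lambda>N. \<Sum>k<N. real (Suc (2*k)) * b (Suc (2*k)))"
    and "E' = (\<lambda>N. \<Sum>k<N. real (Suc (Suc (2*k))) * b (Suc (Suc (2*k))))"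
  have "E' N - O' N \<le> 3 * (\<Sum>m=1..2*N. b m)"
  proof (induction N)
    case (Suc N)
    have "real (Suc (Suc (2*N))) * b (Suc (Suc (2*N))) \<le> real (Suc (2*N)) * b (Suc (2*N)) + 3 * b (Suc (2*N))"
      by (rule step') auto
    with Suc nonneg[of "Suc (Suc (2*N))"] show ?case
      by (simp add: E'_def O'_def)
  qed (simp add: E'_def O'_def)
  \<comment> \<open>The last even term is kept on the left, because in the induction step the next
    odd term is compared with it.\<close>
  moreover have "O' N - E' N + real (2*N) * b (2*N) \<le> b 1 + 3 * (\<Sum>m=1..<2*N. b m)"
  proof (induction N)
    case (Suc N)
    show ?case
    proof (cases "N = 0")
      case False
      hence "{1..<2 * Suc N} = insert (Suc (2*N)) (insert (2*N) {1..<2*N})" by auto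
      hence "(\<Sum>m=1..<2 * Suc N. b m) = b (Suc (2*N)) + b (2*N) + (\<Sum>m=1..<2*N. b m)" by simp
      moreover have "real (Suc (2*N)) * b (Suc (2*N)) \<le> real (2*N) * b (2*N) + 3 * b (2*N)"
        using False by (intro step') auto
      ultimately show ?thesis using Suc nonneg[of "Suc (2*N)"]
        by (simp add: E'_def O'_def)
      next
      case True
      thus ?thesis using nonneg[of 1] by (simp add: E'_def O'_def numeral_2_eq_2)
    qed
  qed (use nonneg[of 1] in \<open>simp add: E'_def O'_def\<close>)
  moreover have "(\<Sum>m=1..<2*N. b m) \<le> (\<Sum>m=1..2*N. b m)"
    by (intro sum_mono2 nonneg) auto
  moreover have "real (2*N) * b (2*N) \<ge> 0" "b 1 \<ge> 0" using nonneg by auto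
  ultimately show ?thesis unfolding O'_def E'_def by linarith
qed

text \<open>The two blocks of consecutive differences meet at \<open>s + r * m\<close>. Since the
  differences decrease, the later block is at most, and the earlier block at least, its length times
  the difference at the meeting point; the lengths are in the ratio of \<open>m + 1\<close> to
  \<open>m\<close>.\<close>

lemma decrement_ratio:
  fixes A :: "nat \<Rightarrow> real"
  assumes anti: "\<And>s. A (Suc s) - A (Suc (Suc s)) \<le> A s - A (Suc s)"
  shows "real m * (A (s + r * m) - A (s + r * m + r * Suc m)) \<le> real (Suc m) * (A s - A (s + r * m))"
proof -
  define Q where "Q = (\<lambda>s. A s - A (Suc s))"
  have Q: "antimono Q"
    using anti by (simp add: antimono_iff_le_Suc Q_def)
  have telescope: "A i - A (i + k) = (\<Sum>l<k. Q (i + l))" for i k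
    by (induction k) (auto simp: Q_def)
  have "A (s + r * m) - A (s + r * m + r * Suc m) \<le> (\<Sum>l<r * Suc m. Q (s + r * m))"
    unfolding telescope by (intro sum_mono antimonoD[OF Q]) auto
  hence 1: "A (s + r * m) - A (s + r * m + r * Suc m) \<le> real r * real (Suc m) * Q (s + r * m)"
    by (simp only: sum_constant card_lessThan of_nat_mult)
  have "(\<Sum>l<r * m. Q (s + r * m)) \<le> A s - A (s + r * m)"
    unfolding telescope by (intro sum_mono antimonoD[OF Q]) auto
  hence 2: "real r * real m * Q (s + r * m) \<le> A s - A (s + r * m)"
    by simp
  have "real m * (A (s + r * m) - A (s + r * m + r * Suc m)) \<le> real m * (real r * real (Suc m) * Q (s + r * m))"
    by (intro mult_left_mono 1) auto
  also have "\<dots> = real (Suc m) * (real r * real m * Q (s + r * m))" by simp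
  also have "\<dots> \<le> real (Suc m) * (A s - A (s + r * m))"
    by (intro mult_left_mono 2) auto
  finally show ?thesis .
qed

text \<open>Replacing \<open>num_partitions 0 = 1\<close> by \<open>0\<close> makes the sequence convex.\<close>

definition shifted_partitions :: "nat \<Rightarrow> nat \<Rightarrow> real" where
  "shifted_partitions n s = (if s < n then real (num_partitions (n - s)) else 0)"

lemma shifted_partitions_convex:
  "shifted_partitions n (Suc s) - shifted_partitions n (Suc (Suc s)) \<le> shifted_partitions n s - shifted_partitions n (Suc s)"
proof -
  have "(\<exists>k. n = s + k + 3) \<or> n = s + 2 \<or> n \<le> s + 1"
    by presburger
  then consider "\<exists>k. n = s + k + 3" | "n = s + 2" | "n \<le> s + 1"
    by blast
  thus ?thesis
  proof cases
    case 1
    then obtain k where k: "n = s + k + 3" by blast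
    hence n: "n - s = Suc (Suc (Suc k))" "n - Suc s = Suc (Suc k)" "n - Suc (Suc s) = Suc k"
      "s < n" "Suc s < n" "Suc (Suc s) < n" by auto
    thus ?thesis using num_partitions_no_ones_Suc[of "Suc (Suc k)"]
      unfolding shifted_partitions_def n by (simp add: num_partitions_Suc)
  next
    \<comment> \<open>Here the differences are \<open>p(2) - p(1) \<ge> 1\<close> and
      \<open>p(1) - 0 = 1\<close>. With the value \<open>p(0) = 1\<close> the sequence
      \<open>p(1), p(0), 0\<close> would have differences 0 and 1, which is where convexity would
      break.\<close>
    case 2
    hence "n - s = Suc 1" "n - Suc s = 1" by auto
    thus ?thesis using 2 num_partitions_no_ones_2 num_partitions_1
      by (simp add: shifted_partitions_def num_partitions_Suc numeral_2_eq_2)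
  qed (auto simp: shifted_partitions_def)
qed

lemma shifted_partitions_antimono: "s \<le> s' \<Longrightarrow> shifted_partitions n s' \<le> shifted_partitions n s"
  by (auto simp: shifted_partitions_def intro!: num_partitions_mono)

lemma sigma_mex_diff:
  assumes "r \<ge> 1"
  shows "\<bar>real (sigma_o_mex r n) - real (sigma_e_mex r n)\<bar> \<le> 4 * real (num_partitions n) + 4 * (real n + 1)\<^sup>2"
proof -
  define N t where "N = n + 1" and "t = (\<lambda>j. real (mex_tail r n j))"
  define A where "A = (\<lambda>j. shifted_partitions n (r * \<Sum>{1..j}))"
  define b where "b = (\<lambda>m. A (m - 1) - A m)"
  have A_mono: "A j \<le> A i" if "i \<le> j" for i j
    unfolding A_def using that by (intro shifted_partitions_antimono mult_left_mono sum_mono2) auto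
  have nonneg: "b m \<ge> 0" for m
    using A_mono[of "m - 1" m] by (simp add: b_def)
  \<comment> \<open>Passing from \<open>m - 1\<close> to \<open>m\<close> moves the argument of the
    convex sequence by \<open>r * m\<close>, the next passage by \<open>r * (m + 1)\<close>, as in
    \<open>decrement_ratio\<close>.\<close>
  have step: "real m * b (Suc m) \<le> real (Suc m) * b m" if "m \<ge> 1" for m
  proof -
    from that obtain l where m: "m = Suc l" by (cases m) auto
    have "r * \<Sum>{1..m} = r * \<Sum>{1..l} + r * m"
         "r * \<Sum>{1..Suc m} = r * \<Sum>{1..l} + r * m + r * Suc m"
      by (simp_all add: m algebra_simps)
    moreover have "m - 1 = l" "Suc m - 1 = m" using m by auto
    ultimately show ?thesis
      using decrement_ratio[of "shifted_partitions n" m "r * \<Sum>{1..l}" r, OF shifted_partitions_convex]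
      by (simp only: b_def A_def)
  qed
  have telescope: "(\<Sum>m=1..k. b m) = A 0 - A k" for k
    by (induction k) (auto simp: b_def)
  have "A 0 \<le> num_partitions n" "\<And>k. A k \<ge> 0"
    by (auto simp: A_def shifted_partitions_def)
  moreover have "b 1 \<le> A 0" using \<open>A 1 \<ge> 0\<close> by (simp add: b_def)
  ultimately have balance: "\<bar>(\<Sum>k<N. real (Suc (2*k)) * b (Suc (2*k))) - (\<Sum>k<N. real (Suc (Suc (2*k))) * b (Suc (Suc (2*k))))\<bar>
      \<le> 4 * real (num_partitions n)"
    using parity_balance[of b N, OF nonneg step] telescope[of "2*N"] \<open>A (2*N) \<ge> 0\<close> by linarith
  \<comment> \<open>The two differ only if \<open>r * \<Sum>{1..j} = n\<close>, where
    \<open>mex_tail\<close> counts the empty partition of the remainder 0.\<close>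
  have t: "A j \<le> t j" "t j \<le> A j + 1" for j
    using num_partitions_0 by (auto simp: t_def A_def mex_tail_def shifted_partitions_def)
  \<comment> \<open>There are \<open>n + 1\<close> terms, each of weight at most
    \<open>2 * (n + 1)\<close>, and replacing \<open>t\<close> by \<open>A\<close> changes each
    difference by at most 1.\<close>
  have approx: "\<bar>(\<Sum>k<N. real (Suc (g k)) * (real (mex_tail r n (g k)) - real (mex_tail r n (Suc (g k))))) - (\<Sum>k<N. real (Suc (g k)) * b (Suc (g k)))\<bar>
     \<le> 2 * (real n + 1)\<^sup>2" if g: "\<And>k. k < N \<Longrightarrow> real (Suc (g k)) \<le> 2 * (real n + 1)" for g
  proof -
    have "\<bar>(\<Sum>k<N. real (Suc (g k)) * (real (mex_tail r n (g k)) - real (mex_tail r n (Suc (g k))))) - (\<Sum>k<N. real (Suc (g k)) * b (Suc (g k)))\<bar>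
       = \<bar>\<Sum>k<N. real (Suc (g k)) * (t (g k) - t (Suc (g k)) - b (Suc (g k)))\<bar>"
      by (simp only: sum_subtractf[symmetric] right_diff_distrib t_def)
    also have "\<dots> \<le> (\<Sum>k<N. 2 * (real n + 1) * 1)"
    proof (rule order.trans[OF sum_abs sum_mono])
      fix k assume k: "k \<in> {..<N}"
      have "\<bar>t (g k) - t (Suc (g k)) - b (Suc (g k))\<bar> \<le> 1"
        using t[of "g k"] t[of "Suc (g k)"] by (simp add: b_def)
      thus "\<bar>real (Suc (g k)) * (t (g k) - t (Suc (g k)) - b (Suc (g k)))\<bar> \<le> 2 * (real n + 1) * 1"
        unfolding abs_mult using g[of k] k by (intro mult_mono) auto
    qed
    also have "\<dots> = 2 * (real n + 1)\<^sup>2"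
      by (simp add: N_def power2_eq_square algebra_simps)
    finally show ?thesis .
  qed
  have "\<bar>real (sigma_o_mex r n) - (\<Sum>k<N. real (Suc (2*k)) * b (Suc (2*k)))\<bar> \<le> 2 * (real n + 1)\<^sup>2"
    unfolding sigma_o_mex_eq[OF assms] N_def[symmetric]
    by (rule approx[of "\<lambda>k. 2 * k"]) (auto simp: N_def)
  moreover have "\<bar>real (sigma_e_mex r n) - (\<Sum>k<N. real (Suc (Suc (2*k))) * b (Suc (Suc (2*k))))\<bar> \<le> 2 * (real n + 1)\<^sup>2"
    unfolding sigma_e_mex_eq[OF assms] N_def[symmetric]
    by (rule approx[of "\<lambda>k. Suc (2 * k)"]) (auto simp: N_def)
  moreover have "(real n + 1)\<^sup>2 \<ge> 0" by simp
  ultimately show ?thesis using balance by linarith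
qed

subsection \<open>The generating function\<close>

definition log_coeff :: "nat \<Rightarrow> real" where
  "log_coeff n = real (divisor_sum n) / real n"

lemma log_coeff_0 [simp]: "log_coeff 0 = 0"
  by (simp add: log_coeff_def)

lemma log_coeff_nonneg: "log_coeff n \<ge> 0"
  by (simp add: log_coeff_def)

lemma log_coeff_ge_1: "n \<ge> 1 \<Longrightarrow> log_coeff n \<ge> 1"
proof -
  assume n: "n \<ge> 1"
  hence "\<Sum>{n} \<le> divisor_sum n"
    unfolding divisor_sum_def by (intro sum_mono2) auto
  thus ?thesis using n by (simp add: log_coeff_def field_simps)
qed

lemma log_coeff_le: "log_coeff n \<le> real n"
proof (cases "n = 0")
  case False
  have "divisor_sum n \<le> (\<Sum>d=1..n. n)"
    unfolding divisor_sum_def using False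
    by (intro order.trans[OF sum_mono2[of "{1..n}"] sum_mono]) (auto dest: dvd_imp_le intro!: Nat.gr0I)
  hence "real (divisor_sum n) \<le> real (n * n)"
    by (intro of_nat_mono) simp
  thus ?thesis using False by (simp add: log_coeff_def field_simps)
qed simp

lemma summable_poly_geometric:
  fixes x :: real
  assumes "\<bar>x\<bar> < 1"
  shows "summable (\<lambda>n. real n ^ j * x ^ n)"
proof (rule powser_inside[where x = "(1 + \<bar>x\<bar>) / 2" and f = "\<lambda>n. real n ^ j"])
  define y where "y = (1 + \<bar>x\<bar>) / 2"
  have y: "0 < y" "y < 1" using assms by (auto simp: y_def)
  have "(\<lambda>n. real n ^ j * y ^ n) \<in> O(\<lambda>n. (1 / real n ^ 2))"
    using y by real_asymp
  thus "summable (\<lambda>n. real n ^ j * ((1 + \<bar>x\<bar>) / 2) ^ n)"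
    unfolding y_def[symmetric]
    by (rule summable_comparison_test_bigo[rotated]) (use inverse_power_summable[of 2] in \<open>simp add: field_simps\<close>)
qed (use assms in auto)

lemma summable_log_coeff:
  fixes x :: real
  assumes "\<bar>x\<bar> < 1"
  shows "summable (\<lambda>n. log_coeff n * real n ^ j * \<bar>x\<bar> ^ n)"
proof (rule summable_comparison_test)
  show "\<exists>N. \<forall>n\<ge>N. norm (log_coeff n * real n ^ j * \<bar>x\<bar> ^ n) \<le> real n ^ Suc j * \<bar>x\<bar> ^ n"
    using log_coeff_nonneg log_coeff_le
    by (intro exI allI impI) (auto simp: abs_mult intro!: mult_right_mono)
qed (use assms in \<open>intro summable_poly_geometric; simp\<close>)

definition log_series :: "complex \<Rightarrow> complex" where
  "log_series z = (\<Sum>n. of_real (log_coeff n) * z ^ n)"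

lemma summable_log_series:
  assumes "norm z < 1"
  shows "summable (\<lambda>n. norm (of_real (log_coeff n) * z ^ n :: complex))"
  using summable_log_coeff[of "norm z" 0] assms log_coeff_nonneg
  by (simp add: norm_mult norm_power)

text \<open>Both sides of \<open>\<Sum> p(n) z\<^sup>n = exp (log_series z)\<close> satisfy \<open>f' = f * log_series'\<close>; comparing
  coefficients this is the recurrence for the partition numbers.\<close>

theorem num_partitions_generating_function:
  assumes "norm z < 1"
  shows "(\<lambda>n. of_nat (num_partitions n) * z ^ n) sums exp (log_series z)"
proof -
  define C :: "complex fps" where "C = Abs_fps (\<lambda>n. of_real (log_coeff n))"
  have radius: "fps_conv_radius C \<ge> 1"
    unfolding fps_conv_radius_def
  proof (rule conv_radius_geI_ex')
    fix r :: real assume "0 < r" "ereal r < 1"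
    thus "summable (\<lambda>n. fps_nth C n * of_real r ^ n)"
      using summable_norm_cancel[OF summable_log_series[of "of_real r"]] by (simp add: C_def)
  qed
  have eval: "eval_fps C = log_series"
    by (simp add: fun_eq_iff eval_fps_def C_def log_series_def)
  have "fps_conv_radius C > 0"
    by (rule less_le_trans[OF _ radius]) simp
  hence C: "log_series has_fps_expansion C"
    unfolding eval[symmetric] by (rule eval_fps_has_fps_expansion)
  define G where "G = fps_exp 1 oo C"
  have "(exp \<circ> log_series) has_fps_expansion G"
    unfolding G_def using has_fps_expansion_exp[of "1::complex"] C
    by (intro has_fps_expansion_compose) (simp_all add: C_def)
  moreover have "eball 0 1 \<subseteq> eball 0 (fps_conv_radius C)"
    by (rule eball_mono[OF radius])
  hence "(exp \<circ> log_series) holomorphic_on eball 0 1"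
    unfolding eval[symmetric] o_def
    by (auto intro!: holomorphic_intros)
  ultimately have sums: "(\<lambda>n. fps_nth G n * z ^ n) sums (exp \<circ> log_series) z"
    by (rule has_fps_expansion_imp_sums_complex) (use assms in auto)
  have "fps_deriv G = G * fps_deriv C"
    unfolding G_def by (subst fps_compose_deriv) (simp_all add: C_def)
  hence rec: "of_nat (Suc n) * fps_nth G (Suc n) = (\<Sum>i=0..n. fps_nth G i * of_nat (divisor_sum (Suc (n - i))))" for n
  proof -
    assume *: "fps_deriv G = G * fps_deriv C"
    have "of_nat (Suc n) * fps_nth G (Suc n) = fps_nth (G * fps_deriv C) n"
      unfolding *[symmetric] by simp
    also have "\<dots> = (\<Sum>i=0..n. fps_nth G i * of_nat (divisor_sum (Suc (n - i))))"
      unfolding fps_mult_nth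
      by (intro sum.cong refl) (simp add: C_def log_coeff_def del: of_nat_Suc)
    finally show ?thesis .
  qed
  have "fps_nth G n = of_nat (num_partitions n)" for n
  proof (induction n rule: less_induct)
    case (less n)
    show ?case
    proof (cases n)
      case 0
      thus ?thesis by (simp add: G_def num_partitions_0)
    next
      case (Suc m)
      have "of_nat (Suc m) * fps_nth G (Suc m) = (\<Sum>i=0..m. of_nat (num_partitions i * divisor_sum (Suc (m - i))))"
        unfolding rec by (intro sum.cong refl) (simp add: less Suc)
      also have "\<dots> = of_nat (\<Sum>i=0..m. num_partitions i * divisor_sum (Suc (m - i)))"
        by simp
      also have "(\<Sum>i=0..m. num_partitions i * divisor_sum (Suc (m - i))) =
                   (\<Sum>k=1..Suc m. divisor_sum k * num_partitions (Suc m - k))"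
        by (rule sum.reindex_bij_witness[where j = "\<lambda>i. Suc m - i" and i = "\<lambda>k. Suc m - k"])
           (auto simp: Suc_diff_le)
      also have "\<dots> = Suc m * num_partitions (Suc m)"
        by (rule partition_recurrence[symmetric])
      finally have "of_nat (Suc m) * fps_nth G (Suc m) = of_nat (Suc m) * of_nat (num_partitions (Suc m))"
        by (simp only: of_nat_mult)
      thus ?thesis
        unfolding Suc by (metis mult_cancel_left of_nat_neq_0)
    qed
  qed
  with sums show ?thesis by simp
qed

section \<open>Coefficients as integrals over the angle\<close>

lemma integral_exp_multiple:
  fixes m :: int
  shows "has_bochner_integral lborel (\<lambda>\<theta>. indicator {-pi..pi} \<theta> *\<^sub>R exp (\<i> * of_int m * of_real \<theta>))
           (if m = 0 then of_real (2 * pi) else 0)"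
proof (cases "m = 0")
  case True
  have "has_bochner_integral lborel (\<lambda>\<theta>. indicator {-pi..pi} \<theta> *\<^sub>R (1::complex)) (of_real pi - of_real (-pi))"
    by (rule has_bochner_integral_FTC_Icc)
       (auto intro!: derivative_eq_intros continuous_intros simp: has_vector_derivative_def scaleR_conv_of_real)
  thus ?thesis using True by simp
next
  case False
  define F where "F = (\<lambda>z. exp (\<i> * of_int m * z) / (\<i> * of_int m))"
  have "(F has_field_derivative exp (\<i> * of_int m * z)) (at z)" for z
    unfolding F_def using False by (auto intro!: derivative_eq_intros)
  hence "((\<lambda>\<theta>. F (of_real \<theta>)) has_vector_derivative exp (\<i> * of_int m * of_real \<theta>)) (at \<theta> within {-pi..pi})" for \<theta>
    by (rule has_vector_derivative_real_field)
  hence "has_bochner_integral lborel (\<lambda>\<theta>. indicator {-pi..pi} \<theta> *\<^sub>R exp (\<i> * of_int m * of_real \<theta>))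
          (F (of_real pi) - F (of_real (-pi)))"
    by (intro has_bochner_integral_FTC_Icc) (auto intro!: continuous_intros)
  moreover have "exp (\<i> * of_int m * of_real pi) = exp (\<i> * of_int m * of_real (-pi))"
    unfolding exp_eq by (intro exI[of _ m]) (simp add: algebra_simps)
  ultimately show ?thesis using False by (simp add: F_def)
qed

lemma fourier_coefficient:
  fixes a :: "nat \<Rightarrow> complex"
  assumes "summable (\<lambda>n. norm (a n))"
  shows "(\<integral>\<theta>. indicator {-pi..pi} \<theta> *\<^sub>R ((\<Sum>k. a k * exp (\<i> * of_real \<theta>) ^ k) * exp (- \<i> * of_nat n * of_real \<theta>)) \<partial>lborel)
           = of_real (2 * pi) * a n"
proof -
  define f where "f = (\<lambda>k \<theta>. a k * (indicator {-pi..pi} \<theta> *\<^sub>R exp (\<i> * of_int (int k - int n) * of_real \<theta>)))"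
  have int: "has_bochner_integral lborel (f k) (a k * (if k = n then of_real (2 * pi) else 0))" for k
    unfolding f_def using has_bochner_integral_mult_right[OF integral_exp_multiple[of "int k - int n"], of "a k"] by simp
  have norm_f: "norm (f k \<theta>) = norm (a k) * indicator {-pi..pi} \<theta>" for k \<theta>
    by (auto simp: f_def norm_mult indicator_def)
  have "(\<lambda>k. integral\<^sup>L lborel (f k)) sums (\<integral>\<theta>. (\<Sum>k. f k \<theta>) \<partial>lborel)"
  proof (rule sums_integral)
    show "integrable lborel (f k)" for k
      using int by (rule integrable.intros)
    show "AE \<theta> in lborel. summable (\<lambda>k. norm (f k \<theta>))"
      unfolding norm_f using assms by (auto intro!: summable_mult2)
    show "summable (\<lambda>k. \<integral>\<theta>. norm (f k \<theta>) \<partial>lborel)"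
      unfolding norm_f using assms by (auto intro!: summable_mult2)
  qed
  moreover have "(\<lambda>k. integral\<^sup>L lborel (f k)) = (\<lambda>k. if k = n then a n * of_real (2 * pi) else 0)"
    using has_bochner_integral_integral_eq[OF int] by auto
  ultimately have "(\<integral>\<theta>. (\<Sum>k. f k \<theta>) \<partial>lborel) = a n * of_real (2 * pi)"
    using sums_unique2[OF _ sums_single[of n "\<lambda>_. a n * of_real (2 * pi)"]] by simp
  moreover have "(\<Sum>k. f k \<theta>) = indicator {-pi..pi} \<theta> *\<^sub>R ((\<Sum>k. a k * exp (\<i> * of_real \<theta>) ^ k) * exp (- \<i> * of_nat n * of_real \<theta>))" for \<theta>
  proof -
    have "summable (\<lambda>k. a k * exp (\<i> * of_real \<theta>) ^ k)"
      by (rule summable_norm_cancel) (use assms in \<open>simp add: norm_mult norm_power\<close>)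
    hence "(\<Sum>k. a k * exp (\<i> * of_real \<theta>) ^ k * (indicator {-pi..pi} \<theta> *\<^sub>R exp (- \<i> * of_nat n * of_real \<theta>)))
       = (\<Sum>k. a k * exp (\<i> * of_real \<theta>) ^ k) * (indicator {-pi..pi} \<theta> *\<^sub>R exp (- \<i> * of_nat n * of_real \<theta>))"
      by (rule suminf_mult2[symmetric])
    moreover have "f k \<theta> = a k * exp (\<i> * of_real \<theta>) ^ k * (indicator {-pi..pi} \<theta> *\<^sub>R exp (- \<i> * of_nat n * of_real \<theta>))" for k
      by (simp add: f_def exp_of_nat_mult[symmetric] mult_exp_exp algebra_simps)
    ultimately show ?thesis by simp
  qed
  ultimately show ?thesis by (simp add: mult.commute)
qed

subsection \<open>Lambert series\<close>

lemma log_coeff_eq: "n \<ge> 1 \<Longrightarrow> log_coeff n = (\<Sum>m | m dvd n. 1 / real m)"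
proof -
  assume n: "n \<ge> 1"
  have "log_coeff n = (\<Sum>d | d dvd n. real d / real n)"
    by (simp add: log_coeff_def divisor_sum_def sum_divide_distrib)
  also have "\<dots> = (\<Sum>m | m dvd n. 1 / real m)"
    using n by (intro sum.reindex_bij_witness[where i = "\<lambda>m. n div m" and j = "\<lambda>m. n div m"])
               (auto simp: real_of_nat_div field_simps)
  finally show ?thesis .
qed

text \<open>\<open>log_coeff n\<close> is the sum of \<open>1 / m\<close> over the divisors
  \<open>m\<close> of \<open>n\<close>; sorting the pairs of the double series by their product
  collects exactly these weights.\<close>

lemma log_coeff_sums_of_has_sum:
  fixes h :: "nat \<Rightarrow> real"
  assumes "((\<lambda>(m, k). h (Suc m * Suc k) / real (Suc m)) has_sum S) (UNIV \<times> UNIV)"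
  shows "(\<lambda>n. log_coeff n * h n) sums S"
proof -
  have "((\<lambda>(m, k). h (Suc m * Suc k) / real (Suc m)) has_sum S) (UNIV \<times> UNIV) \<longleftrightarrow>
        ((\<lambda>(n, m). h n / real m) has_sum S) (SIGMA n:{1..}. {m. m dvd n})"
    by (rule has_sum_reindex_bij_witness[where j = "\<lambda>(m, k). (Suc m * Suc k, Suc m)" and
          i = "\<lambda>(n, m). (m - 1, n div m - 1)"])
       (auto simp del: mult_Suc mult_Suc_right simp: Suc_le_eq dvd_div_eq_0_iff dvd_pos_nat elim!: dvdE)
  with assms have "((\<lambda>(n, m). h n / real m) has_sum S) (SIGMA n:{1..}. {m. m dvd n})" by simp
  hence "((\<lambda>n. log_coeff n * h n) has_sum S) {1..}"
  proof (rule has_sum_SigmaD)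
    fix n :: nat assume n: "n \<in> {1..}"
    show "((\<lambda>m. (case (n, m) of (n, m) \<Rightarrow> h n / real m)) has_sum log_coeff n * h n) {m. m dvd n}"
      by (rule has_sum_finiteI) (use n in \<open>auto simp: log_coeff_eq sum_distrib_right\<close>)
  qed
  hence "((\<lambda>n. log_coeff n * h n) has_sum S) UNIV"
    by (rule has_sum_cong_neutral[THEN iffD1, rotated -1]) (auto simp: not_le)
  thus ?thesis by (rule has_sum_imp_sums)
qed

lemma has_sum_prod_of_sums:
  fixes f :: "nat \<times> nat \<Rightarrow> real"
  assumes "\<And>m k. f (m, k) \<ge> 0" "\<And>m. (\<lambda>k. f (m, k)) sums s m" "s sums S"
  shows "(f has_sum S) (UNIV \<times> UNIV)"
proof -
  have s: "s m \<ge> 0" for m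
    using sums_le[OF _ sums_zero assms(2)[of m]] assms(1) by simp
  have 1: "((\<lambda>k. f (m, k)) has_sum s m) UNIV" for m
    by (rule sums_nonneg_imp_has_sum[OF assms(2) assms(1)])
  have 2: "(s has_sum S) UNIV"
    by (rule sums_nonneg_imp_has_sum[OF assms(3) s])
  show ?thesis
    using 1 2 assms(1) by (intro has_sum_SigmaI summable_on_SigmaI[of UNIV f]) (auto simp: summable_on_def)
qed

text \<open>Nonnegative terms may be summed in either order. Summing over the multiples
  \<open>k\<close> first produces Lambert series; summing over \<open>m\<close> first, as in the
  primed variant, produces logarithms and thus Euler's product.\<close>

lemma log_coeff_sums:
  fixes h :: "nat \<Rightarrow> real"
  assumes "\<And>n. h n \<ge> 0" "\<And>m. (\<lambda>k. h (Suc m * Suc k) / real (Suc m)) sums s m" "s sums S"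
  shows "(\<lambda>n. log_coeff n * h n) sums S"
  by (rule log_coeff_sums_of_has_sum, rule has_sum_prod_of_sums) (use assms in auto)

lemma log_coeff_sums':
  fixes h :: "nat \<Rightarrow> real"
  assumes "\<And>n. h n \<ge> 0" "\<And>k. (\<lambda>m. h (Suc m * Suc k) / real (Suc m)) sums s k" "s sums S"
  shows "(\<lambda>n. log_coeff n * h n) sums S"
proof -
  have "((\<lambda>(k, m). h (Suc m * Suc k) / real (Suc m)) has_sum S) (UNIV \<times> UNIV)"
    by (rule has_sum_prod_of_sums) (use assms in auto)
  thus ?thesis
    by (intro log_coeff_sums_of_has_sum) (subst has_sum_swap, simp)
qed

section \<open>Closed forms and majorants for the moments\<close>

lemma square_geometric_sums:
  fixes y :: real
  assumes "\<bar>y\<bar> < 1"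
  shows "(\<lambda>k. real (Suc k) ^ 2 * y ^ Suc k) sums (y * (1 + y) / (1 - y) ^ 3)"
proof -
  obtain S where S: "(\<lambda>k. real (Suc k) ^ 2 * y ^ k) sums S"
  proof -
    have "summable (\<lambda>k. real k ^ 2 * y ^ k + 2 * (real k ^ 1 * y ^ k) + real k ^ 0 * y ^ k)"
      by (intro summable_add summable_mult summable_poly_geometric assms)
    also have "(\<lambda>k. real k ^ 2 * y ^ k + 2 * (real k ^ 1 * y ^ k) + real k ^ 0 * y ^ k) = (\<lambda>k. real (Suc k) ^ 2 * y ^ k)"
      by (simp add: fun_eq_iff power2_eq_square algebra_simps)
    finally show ?thesis using that by (auto simp: summable_def)
  qed
  have "(\<lambda>k. real k ^ 2 * y ^ k) sums (y * S)"
    by (rule sums_Suc_imp) (use sums_mult[OF S, of y] in \<open>simp_all add: algebra_simps\<close>)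
  \<comment> \<open>Multiplication by \<open>1 - y\<close> turns squares into odd numbers, whose
    generating function is known.\<close>
  hence "(\<lambda>k. real (Suc k) ^ 2 * y ^ k - real k ^ 2 * y ^ k) sums (S - y * S)"
    by (intro sums_diff S)
  moreover have "(\<lambda>k. 2 * (real (Suc k) * y ^ k) - y ^ k) sums (2 * (1 / (1 - y)\<^sup>2) - 1 / (1 - y))"
    using assms geometric_deriv_sums[of y] geometric_sums[of y] by (intro sums_diff sums_mult) auto
  moreover have "real (Suc k) ^ 2 * y ^ k - real k ^ 2 * y ^ k = 2 * (real (Suc k) * y ^ k) - y ^ k" for k
    by (simp add: power2_eq_square algebra_simps)
  ultimately have "S - y * S = 2 * (1 / (1 - y)\<^sup>2) - 1 / (1 - y)"
    by (simp add: sums_unique2)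
  moreover have d: "1 - y \<noteq> 0" using assms by auto
  moreover have "S * (1 - y) ^ 3 = (S - y * S) * (1 - y)\<^sup>2"
    by (simp add: power3_eq_cube power2_eq_square algebra_simps)
  moreover have "(2 * (1 / d\<^sup>2) - 1 / d) * d\<^sup>2 = 2 - d" if "d \<noteq> 0" for d :: real
    using that by (simp add: field_simps power2_eq_square)
  ultimately have "S * (1 - y) ^ 3 = 1 + y"
    by (metis diff_diff_eq2 add_diff_cancel_right' one_add_one add.commute add.assoc)
  hence "S = (1 + y) / (1 - y) ^ 3"
    using d by (simp add: eq_divide_eq)
  with sums_mult[OF S, of y] show ?thesis by (simp add: algebra_simps)
qed

text \<open>Up to the sign \<open>(-1)^j\<close>, this is the \<open>j\<close>-th derivative in
  \<open>t\<close> of the logarithm of the generating function at \<open>e^(-t)\<close>. For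
  \<open>j \<ge> 1\<close> it is the \<open>j\<close>-th cumulant of the compound Poisson law: mean,
  variance, and the third cumulant that controls the error.\<close>

definition log_moment :: "nat \<Rightarrow> real \<Rightarrow> real" where
  "log_moment j t = (\<Sum>n. log_coeff n * (real n ^ j * exp (- (real n * t))))"

lemma log_moment_sums:
  assumes "t > 0"
  shows "(\<lambda>n. log_coeff n * (real n ^ j * exp (- (real n * t)))) sums log_moment j t"
proof -
  have "exp (- (real n * t)) = exp (- t) ^ n" for n
    by (simp add: exp_of_nat_mult[symmetric])
  thus ?thesis
    using summable_log_coeff[of "exp (-t)" j] assms
    by (auto simp: log_moment_def mult.assoc intro: summable_sums)
qed

lemma exp_mult_Suc: "exp (- (real (Suc m * Suc k) * t)) = exp (- (real (Suc m) * t)) ^ Suc k"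
  unfolding exp_of_nat_mult[symmetric] by (simp only: of_nat_mult) (simp add: algebra_simps)

lemma exp_minus_less_1: "t > 0 \<Longrightarrow> exp (- (real (Suc m) * t)) < 1"
  by simp

lemma half_sinh: "1 - exp (- w) = 2 * exp (- (w / 2)) * sinh (w / 2)" for w :: real
  by (simp add: sinh_field_def algebra_simps mult_exp_exp)

lemma half_cosh: "1 + exp (- w) = 2 * exp (- (w / 2)) * cosh (w / 2)" for w :: real
  by (simp add: cosh_field_def algebra_simps mult_exp_exp)

text \<open>The hyperbolic form exposes the poles \<open>1 / w^2\<close> and \<open>2 / w^3\<close>
  at 0 with which the summands are compared.\<close>

lemma exp_quotient_sinh:
  fixes w :: real assumes "w > 0"
  shows "exp (- w) / (1 - exp (- w))\<^sup>2 = 1 / (4 * sinh (w / 2) ^ 2)"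
    and "exp (- w) * (1 + exp (- w)) / (1 - exp (- w)) ^ 3 = cosh (w / 2) / (4 * sinh (w / 2) ^ 3)"
proof -
  have e: "exp (- w) = exp (- (w / 2)) ^ 2"
    by (simp add: power2_eq_square mult_exp_exp)
  show "exp (- w) / (1 - exp (- w))\<^sup>2 = 1 / (4 * sinh (w / 2) ^ 2)"
    unfolding half_sinh by (simp add: e power_mult_distrib)
  show "exp (- w) * (1 + exp (- w)) / (1 - exp (- w)) ^ 3 = cosh (w / 2) / (4 * sinh (w / 2) ^ 3)"
    unfolding half_sinh half_cosh using assms
    by (simp add: e power_mult_distrib field_simps power2_eq_square power3_eq_cube)
qed

lemma summable_inverse_Suc_squares: "summable (\<lambda>m. 1 / real (Suc m) ^ 2)"
  using sums_summable[OF inverse_squares_sums] by (simp add: add.commute)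

lemma sinh_ge: "(x::real) \<ge> 0 \<Longrightarrow> x \<le> sinh x"
  using real_le_x_sinh[of x] by (simp add: sinh_field_def exp_minus)

lemma sinh_le_mult_cosh: "(x::real) \<ge> 0 \<Longrightarrow> sinh x \<le> x * cosh x"
proof -
  assume x: "x \<ge> 0"
  have "0 * cosh 0 - sinh 0 \<le> x * cosh x - sinh x"
    by (rule DERIV_nonneg_imp_nondecreasing[OF x])
       (auto intro!: exI derivative_eq_intros)
  thus ?thesis by simp
qed

text \<open>Uses \<open>cosh\<^sup>2 = 1 + sinh\<^sup>2\<close> in \<open>sinh x \<le> x * cosh x\<close>.\<close>

lemma inverse_square_diff_sinh_le:
  fixes w :: real assumes "w > 0"
  shows "0 \<le> 1 / w\<^sup>2 - 1 / (4 * sinh (w / 2) ^ 2)"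
    and "1 / w\<^sup>2 - 1 / (4 * sinh (w / 2) ^ 2) \<le> 1 / w\<^sup>2"
    and "1 / w\<^sup>2 - 1 / (4 * sinh (w / 2) ^ 2) \<le> 1"
proof -
  define s where "s = w / 2"
  have s: "s > 0" "w = 2 * s" "w / 2 = s" using assms by (auto simp: s_def)
  have sinh: "s \<le> sinh s" "sinh s > 0" using s sinh_ge[of s] by auto
  hence "s\<^sup>2 \<le> sinh s ^ 2" using s by (intro power_mono) auto
  thus "0 \<le> 1 / w\<^sup>2 - 1 / (4 * sinh (w / 2) ^ 2)"
    using s sinh by (simp add: s(2,3) power_mult_distrib field_simps)
  show "1 / w\<^sup>2 - 1 / (4 * sinh (w / 2) ^ 2) \<le> 1 / w\<^sup>2" by simp
  have "sinh s ^ 2 \<le> (s * cosh s) ^ 2"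
    using sinh_le_mult_cosh[of s] sinh s by (intro power_mono) auto
  also have "\<dots> = s\<^sup>2 + s\<^sup>2 * sinh s ^ 2"
    by (simp add: power_mult_distrib cosh_square_eq algebra_simps)
  moreover have "0 \<le> s\<^sup>2 * sinh s ^ 2" by simp
  ultimately have "sinh s ^ 2 - s\<^sup>2 \<le> 4 * (s\<^sup>2 * sinh s ^ 2)" by linarith
  thus "1 / w\<^sup>2 - 1 / (4 * sinh (w / 2) ^ 2) \<le> 1"
    using s sinh by (simp add: s(2,3) power_mult_distrib divide_simps)
qed

text \<open>With \<open>s = w / 2\<close> the claim is
  \<open>s^3 * cosh s \<le> 4 * sinh s ^ 3\<close>. It follows from
  \<open>cosh s \<le> 1 + sinh s\<close>, where \<open>s \<le> sinh s\<close> handles the summand 1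
  and \<open>s^2 / 2 \<le> sinh s\<close> handles the other one.\<close>

lemma cosh_sinh_cube_le:
  fixes w :: real assumes "w > 0"
  shows "w ^ 3 * (cosh (w / 2) / (4 * sinh (w / 2) ^ 3)) \<le> 8"
proof -
  define s where "s = w / 2"
  have s: "s > 0" "w = 2 * s" "w / 2 = s" using assms by (auto simp: s_def)
  have sinh: "s \<le> sinh s" "sinh s > 0" using s sinh_ge[of s] by auto
  have "cosh s - sinh s \<le> 1" using s by (simp add: cosh_minus_sinh)
  have sq: "s ^ 2 / 2 \<le> sinh s"
  proof -
    have "sinh 0 - 0\<^sup>2 / 2 \<le> sinh s - s\<^sup>2 / 2"
    proof (rule DERIV_nonneg_imp_nondecreasing[of 0 s "\<lambda>x. sinh x - x\<^sup>2 / 2"])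
      fix x :: real assume x: "0 \<le> x" "x \<le> s"
      have "x \<le> cosh x"
        using sinh_ge[OF x(1)] sinh_le_cosh_real[of x] by linarith
      thus "\<exists>y. ((\<lambda>x. sinh x - x\<^sup>2 / 2) has_real_derivative y) (at x) \<and> y \<ge> 0"
        by (intro exI[of _ "cosh x - x"]) (auto intro!: derivative_eq_intros)
    qed (use s in auto)
    thus ?thesis by simp
  qed
  have "s ^ 3 * cosh s \<le> s ^ 3 * (1 + sinh s)"
    using s \<open>cosh s - sinh s \<le> 1\<close> by (intro mult_left_mono) auto
  also have "\<dots> = s * s * s + s * (s ^ 2) * sinh s"
    by (simp add: power3_eq_cube power2_eq_square algebra_simps)
  also have "\<dots> \<le> sinh s * sinh s * sinh s + sinh s * (2 * sinh s) * sinh s"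
    using s sinh sq by (intro add_mono mult_mono) auto
  finally have "s ^ 3 * cosh s \<le> 3 * sinh s ^ 3"
    by (simp add: power3_eq_cube)
  moreover have "0 \<le> sinh s ^ 3" using sinh by simp
  ultimately have "s ^ 3 * cosh s \<le> 4 * sinh s ^ 3" by linarith
  thus ?thesis
    using s sinh \<open>s ^ 3 * cosh s \<le> 4 * sinh s ^ 3\<close> by (simp add: s(2,3) power_mult_distrib divide_simps) (simp only: mult.commute)
qed

text \<open>The Lambert form yields the leading term of \<open>L\<close> at 0; the second form, the
  logarithm of Euler's product, yields the constant.\<close>

lemma log_moment_0_sums:
  assumes "t > 0"
  shows "(\<lambda>m. 1 / (real (Suc m) * (exp (real (Suc m) * t) - 1))) sums log_moment 0 t"
    and "(\<lambda>k. - ln (1 - exp (- (real (Suc k) * t)))) sums log_moment 0 t"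
proof -
  have "summable (\<lambda>m. 1 / (real (Suc m) * (exp (real (Suc m) * t) - 1)))"
  proof (rule summable_comparison_test)
    show "\<exists>N. \<forall>m\<ge>N. norm (1 / (real (Suc m) * (exp (real (Suc m) * t) - 1))) \<le> 1 / t * (1 / real (Suc m) ^ 2)"
    proof (intro exI allI impI)
      fix m :: nat
      have "1 + real (Suc m) * t \<le> exp (real (Suc m) * t)" by (rule exp_ge_add_one_self)
      hence w: "exp (real (Suc m) * t) - 1 \<ge> real (Suc m) * t" "real (Suc m) * t > 0"
        using assms by (linarith, simp)
      have "norm (1 / (real (Suc m) * (exp (real (Suc m) * t) - 1))) = 1 / (real (Suc m) * (exp (real (Suc m) * t) - 1))"
        using w by (subst real_norm_def, intro abs_of_nonneg) auto
      also have "\<dots> \<le> 1 / (real (Suc m) * (real (Suc m) * t))"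
        using w assms by (intro divide_left_mono mult_left_mono mult_pos_pos) auto
      finally show "norm (1 / (real (Suc m) * (exp (real (Suc m) * t) - 1))) \<le> 1 / t * (1 / real (Suc m) ^ 2)"
        by (simp add: power2_eq_square mult_ac)
    qed
  qed (intro summable_mult summable_inverse_Suc_squares)
  hence "(\<lambda>n. log_coeff n * exp (- (real n * t))) sums (\<Sum>m. 1 / (real (Suc m) * (exp (real (Suc m) * t) - 1)))"
  proof (intro log_coeff_sums[where s = "\<lambda>m. 1 / (real (Suc m) * (exp (real (Suc m) * t) - 1))"])
    fix m :: nat
    define y where "y = exp (- (real (Suc m) * t))"
    have y: "0 < y" "y < 1" using exp_minus_less_1[OF assms] by (auto simp: y_def)
    have "(\<lambda>k. (y / real (Suc m)) * y ^ k) sums ((y / real (Suc m)) * (1 / (1 - y)))"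
      using y by (intro sums_mult geometric_sums) auto
    also have "(\<lambda>k. (y / real (Suc m)) * y ^ k) = (\<lambda>k. exp (- (real (Suc m * Suc k) * t)) / real (Suc m))"
      unfolding exp_mult_Suc y_def by simp
    also have "(y / real (Suc m)) * (1 / (1 - y)) = 1 / (real (Suc m) * (1 / y - 1))"
      using y by (simp add: divide_simps)
    also have "1 / y = exp (real (Suc m) * t)" by (simp add: y_def exp_minus inverse_eq_divide)
    finally show "(\<lambda>k. exp (- (real (Suc m * Suc k) * t)) / real (Suc m)) sums (1 / (real (Suc m) * (exp (real (Suc m) * t) - 1)))" .
  qed (auto intro: summable_sums)
  with \<open>summable _\<close> show "(\<lambda>m. 1 / (real (Suc m) * (exp (real (Suc m) * t) - 1))) sums log_moment 0 t"
    using log_moment_sums[OF assms, of 0] by (auto simp: sums_iff)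
next
  have "summable (\<lambda>k. - ln (1 - exp (- (real (Suc k) * t))))"
  proof (rule summable_comparison_test)
    show "\<exists>N. \<forall>k\<ge>N. norm (- ln (1 - exp (- (real (Suc k) * t)))) \<le> exp (- t) / (1 - exp (- t)) * exp (- t) ^ k"
    proof (intro exI allI impI)
      fix k :: nat
      define y where "y = exp (- (real (Suc k) * t))"
      have y: "0 < y" "y < 1" using exp_minus_less_1[OF assms] by (auto simp: y_def)
      have "y \<le> exp (- t)" using assms by (simp add: y_def)
      have nonneg: "- ln (1 - y) \<ge> 0" using y by simp
      have "- ln (1 - y) = ln (1 / (1 - y))" using y by (simp add: ln_div)
      also have "\<dots> \<le> 1 / (1 - y) - 1" using y by (intro ln_le_minus_one) auto
      also have "\<dots> = y / (1 - y)" using y by (simp add: field_simps)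
      also have "\<dots> \<le> y / (1 - exp (- t))"
        using y assms \<open>y \<le> exp (- t)\<close> by (intro divide_left_mono) auto
      also have "y / (1 - exp (- t)) = exp (- t) / (1 - exp (- t)) * exp (- t) ^ k"
        by (simp add: y_def exp_of_nat_mult[symmetric] mult_exp_exp algebra_simps)
      finally show "norm (- ln (1 - exp (- (real (Suc k) * t)))) \<le> exp (- t) / (1 - exp (- t)) * exp (- t) ^ k"
        unfolding y_def[symmetric] real_norm_def abs_of_nonneg[OF nonneg] .
    qed
  qed (intro summable_mult summable_geometric, use assms in auto)
  hence "(\<lambda>n. log_coeff n * exp (- (real n * t))) sums (\<Sum>k. - ln (1 - exp (- (real (Suc k) * t))))"
  proof (intro log_coeff_sums'[where s = "\<lambda>k. - ln (1 - exp (- (real (Suc k) * t)))"])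
    fix k :: nat
    define y where "y = exp (- (real (Suc k) * t))"
    have y: "0 < y" "y < 1" using exp_minus_less_1[OF assms] by (auto simp: y_def)
    have "(\<lambda>n. - (y ^ n) / real n) sums ln (1 - y)"
      using ln_series'[of "- y"] y by simp
    hence "(\<lambda>n. - (y ^ Suc n) / real (Suc n)) sums ln (1 - y)"
      by (subst sums_Suc_iff) simp
    hence "(\<lambda>n. - (- (y ^ Suc n) / real (Suc n))) sums (- ln (1 - y))"
      by (rule sums_minus)
    also have "(\<lambda>n. - (- (y ^ Suc n) / real (Suc n))) = (\<lambda>n. y ^ Suc n / real (Suc n))"
      by (simp add: fun_eq_iff)
    also have "\<dots> = (\<lambda>m. exp (- (real (Suc m * Suc k) * t)) / real (Suc m))"
      unfolding y_def exp_mult_Suc[symmetric] by (simp only: mult.commute)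
    finally show "(\<lambda>m. exp (- (real (Suc m * Suc k) * t)) / real (Suc m)) sums (- ln (1 - exp (- (real (Suc k) * t))))"
      unfolding y_def .
  qed (auto intro: summable_sums)
  with \<open>summable _\<close> show "(\<lambda>k. - ln (1 - exp (- (real (Suc k) * t)))) sums log_moment 0 t"
    using log_moment_sums[OF assms, of 0] by (auto simp: sums_iff)
qed

lemma log_moment_1_sums:
  assumes "t > 0"
  shows "(\<lambda>m. 1 / (4 * sinh (real (Suc m) * t / 2) ^ 2)) sums log_moment 1 t"
proof -
  have "summable (\<lambda>m. 1 / (4 * sinh (real (Suc m) * t / 2) ^ 2))"
  proof (rule summable_comparison_test)
    show "\<exists>N. \<forall>m\<ge>N. norm (1 / (4 * sinh (real (Suc m) * t / 2) ^ 2)) \<le> 1 / t\<^sup>2 * (1 / real (Suc m) ^ 2)"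
      using inverse_square_diff_sinh_le(1)[of "real (Suc m) * t" for m] assms
      by (intro exI allI impI) (simp add: power_mult_distrib mult.commute)
  qed (intro summable_mult summable_inverse_Suc_squares)
  hence "(\<lambda>n. log_coeff n * (real n * exp (- (real n * t)))) sums (\<Sum>m. 1 / (4 * sinh (real (Suc m) * t / 2) ^ 2))"
  proof (intro log_coeff_sums[where s = "\<lambda>m. 1 / (4 * sinh (real (Suc m) * t / 2) ^ 2)"])
    fix m :: nat
    define y where "y = exp (- (real (Suc m) * t))"
    have y: "0 < y" "y < 1" using exp_minus_less_1[OF assms] by (auto simp: y_def)
    have "(\<lambda>k. y * (of_nat (Suc k) * y ^ k)) sums (y * (1 / (1 - y)\<^sup>2))"
      using y by (intro sums_mult geometric_deriv_sums) auto
    also have "(\<lambda>k. y * (of_nat (Suc k) * y ^ k)) = (\<lambda>k. real (Suc m * Suc k) * exp (- (real (Suc m * Suc k) * t)) / real (Suc m))"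
      unfolding exp_mult_Suc y_def by (simp add: fun_eq_iff divide_simps del: of_nat_Suc mult_Suc mult_Suc_right)
    also have "y * (1 / (1 - y)\<^sup>2) = 1 / (4 * sinh (real (Suc m) * t / 2) ^ 2)"
      using exp_quotient_sinh(1)[of "real (Suc m) * t"] assms by (simp add: y_def)
    finally show "(\<lambda>k. real (Suc m * Suc k) * exp (- (real (Suc m * Suc k) * t)) / real (Suc m)) sums (1 / (4 * sinh (real (Suc m) * t / 2) ^ 2))" .
  qed (auto intro: summable_sums)
  with \<open>summable _\<close> show ?thesis
    using log_moment_sums[OF assms, of 1] by (auto simp: sums_iff)
qed

lemma log_moment_2_sums:
  assumes "t > 0"
  shows "(\<lambda>m. real (Suc m) * (cosh (real (Suc m) * t / 2) / (4 * sinh (real (Suc m) * t / 2) ^ 3))) sums log_moment 2 t"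
proof -
  let ?s = "\<lambda>m. real (Suc m) * (cosh (real (Suc m) * t / 2) / (4 * sinh (real (Suc m) * t / 2) ^ 3))"
  have "summable ?s"
  proof (rule summable_comparison_test)
    show "\<exists>N. \<forall>m\<ge>N. norm (?s m) \<le> 8 / t ^ 3 * (1 / real (Suc m) ^ 2)"
    proof (intro exI allI impI)
      fix m :: nat
      have w: "real (Suc m) * t > 0" using assms by simp
      have "?s m \<ge> 0" using assms by simp
      moreover have "cosh (real (Suc m) * t / 2) / (4 * sinh (real (Suc m) * t / 2) ^ 3) \<le> 8 / (real (Suc m) * t) ^ 3"
        using cosh_sinh_cube_le[OF w] w by (subst pos_le_divide_eq) (simp_all only: zero_less_power mult.commute)
      hence "?s m \<le> real (Suc m) * (8 / (real (Suc m) * t) ^ 3)"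
        by (intro mult_left_mono) auto
      moreover have "real (Suc m) * (8 / (real (Suc m) * t) ^ 3) = 8 / t ^ 3 * (1 / real (Suc m) ^ 2)"
        by (simp add: power_mult_distrib power3_eq_cube power2_eq_square divide_simps del: of_nat_Suc)
      ultimately show "norm (?s m) \<le> 8 / t ^ 3 * (1 / real (Suc m) ^ 2)"
        by (simp only: real_norm_def abs_of_nonneg)
    qed
  qed (intro summable_mult summable_inverse_Suc_squares)
  hence "(\<lambda>n. log_coeff n * (real n ^ 2 * exp (- (real n * t)))) sums (\<Sum>m. ?s m)"
  proof (intro log_coeff_sums[where s = ?s])
    fix m :: nat
    define y where "y = exp (- (real (Suc m) * t))"
    have y: "0 < y" "y < 1" using exp_minus_less_1[OF assms] by (auto simp: y_def)
    have "(\<lambda>k. real (Suc m) * (real (Suc k) ^ 2 * y ^ Suc k)) sums (real (Suc m) * (y * (1 + y) / (1 - y) ^ 3))"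
      using y by (intro sums_mult square_geometric_sums) auto
    also have "(\<lambda>k. real (Suc m) * (real (Suc k) ^ 2 * y ^ Suc k)) = (\<lambda>k. real (Suc m * Suc k) ^ 2 * exp (- (real (Suc m * Suc k) * t)) / real (Suc m))"
      unfolding exp_mult_Suc y_def by (simp add: fun_eq_iff divide_simps power2_eq_square del: of_nat_Suc mult_Suc mult_Suc_right)
    also have "y * (1 + y) / (1 - y) ^ 3 = cosh (real (Suc m) * t / 2) / (4 * sinh (real (Suc m) * t / 2) ^ 3)"
      using exp_quotient_sinh(2)[of "real (Suc m) * t"] assms by (simp add: y_def)
    finally show "(\<lambda>k. real (Suc m * Suc k) ^ 2 * exp (- (real (Suc m * Suc k) * t)) / real (Suc m)) sums ?s m" .
  qed (auto intro: summable_sums)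
  with \<open>summable _\<close> show ?thesis
    using log_moment_sums[OF assms, of 2] by (auto simp: sums_iff)
qed

subsection \<open>Behaviour of the moments at 0\<close>

lemma tannery_at_right_0:
  fixes a :: "nat \<Rightarrow> real \<Rightarrow> real"
  assumes "\<And>k. (a k \<longlongrightarrow> b k) (at_right 0)"
    and "\<And>k t. t > 0 \<Longrightarrow> \<bar>a k t\<bar> \<le> M k" and "summable M"
  shows "((\<lambda>t. \<Sum>k. a k t) \<longlongrightarrow> (\<Sum>k. b k)) (at_right 0)"
proof -
  have "eventually (\<lambda>(k, t). norm (a k t) \<le> M k) (at_top \<times>\<^sub>F at_right 0)"
    using eventually_prodI[OF eventually_True[of at_top] eventually_at_right_less[of "0::real"]]
    by eventually_elim (use assms(2) in auto)
  thus ?thesis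
    using tannerys_theorem[of a b "at_right 0" M, OF assms(1) _ assms(3)] by simp
qed

lemma suminf_inverse_Suc_squares: "(\<Sum>m. 1 / real (Suc m) ^ 2) = pi\<^sup>2 / 6"
  using sums_unique[OF inverse_squares_sums] by (simp add: add.commute)

lemma log_moment_0_limit: "((\<lambda>t. t * log_moment 0 t) \<longlongrightarrow> pi\<^sup>2 / 6) (at_right 0)"
proof -
  have "((\<lambda>t. \<Sum>m. t / (real (Suc m) * (exp (real (Suc m) * t) - 1))) \<longlongrightarrow> (\<Sum>m. 1 / real (Suc m) ^ 2)) (at_right 0)"
  proof (rule tannery_at_right_0[where M = "\<lambda>m. 1 / real (Suc m) ^ 2"])
    fix m :: nat
    define c where "c = real (Suc m)"
    have "c > 0" by (simp add: c_def)
    hence "((\<lambda>t. t / (c * (exp (c * t) - 1))) \<longlongrightarrow> 1 / c ^ 2) (at_right 0)"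
      by (real_asymp simp: power2_eq_square field_simps)
    thus "((\<lambda>t. t / (real (Suc m) * (exp (real (Suc m) * t) - 1))) \<longlongrightarrow> 1 / real (Suc m) ^ 2) (at_right 0)"
      by (simp add: c_def)
  next
    fix m :: nat and t :: real assume t: "t > 0"
    have "1 + real (Suc m) * t \<le> exp (real (Suc m) * t)" by (rule exp_ge_add_one_self)
    hence w: "exp (real (Suc m) * t) - 1 \<ge> real (Suc m) * t" "real (Suc m) * t > 0"
      using t by (linarith, simp)
    hence "t / (real (Suc m) * (exp (real (Suc m) * t) - 1)) \<le> t / (real (Suc m) * (real (Suc m) * t))"
      using t by (intro divide_left_mono mult_left_mono mult_pos_pos) auto
    also have "\<dots> = 1 / real (Suc m) ^ 2" using t by (simp add: power2_eq_square divide_simps)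
    finally show "\<bar>t / (real (Suc m) * (exp (real (Suc m) * t) - 1))\<bar> \<le> 1 / real (Suc m) ^ 2"
      using w t by (subst abs_of_nonneg) auto
  qed (rule summable_inverse_Suc_squares)
  moreover have "(\<Sum>m. t / (real (Suc m) * (exp (real (Suc m) * t) - 1))) = t * log_moment 0 t" if "t > 0" for t
    using sums_unique[OF sums_mult[OF log_moment_0_sums(1)[OF that], of t]] by simp
  hence "eventually (\<lambda>t. (\<Sum>m. t / (real (Suc m) * (exp (real (Suc m) * t) - 1))) = t * log_moment 0 t) (at_right 0)"
    by (auto simp: eventually_at_right_less intro: eventually_mono[OF eventually_at_right_less])
  ultimately show ?thesis
    unfolding suminf_inverse_Suc_squares by (rule Lim_transform_eventually)
qed

text \<open>The mean minus its leading term, measured on the scale \<open>t powr (3/2)\<close> of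
  the angle; this is what makes the linear phase of the integrand disappear.\<close>

lemma log_moment_1_limit:
  "((\<lambda>t. t powr (3/2) * (log_moment 1 t - pi\<^sup>2 / (6 * t\<^sup>2))) \<longlongrightarrow> 0) (at_right 0)"
proof -
  define D :: "real \<Rightarrow> real" where "D = (\<lambda>w. 1 / w\<^sup>2 - 1 / (4 * sinh (w / 2) ^ 2))"
  have D: "0 \<le> D w" "D w \<le> 1 / w\<^sup>2" "D w \<le> 1" if "w > 0" for w
    using inverse_square_diff_sinh_le[OF that] by (auto simp: D_def)
  \<comment> \<open>An interpolation between the bounds 1 and \<open>1 / w^2\<close>. The exponent
    \<open>3/2\<close> cancels the weight \<open>t powr (3/2)\<close> exactly, leaving a majorant
    independent of \<open>t\<close>, and is large enough for summability.\<close>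
  have D_powr: "D w \<le> w powr (-3/2)" if "w > 0" for w
  proof (cases "w \<ge> 1")
    case True
    have "D w \<le> w powr (-2)" using D(2)[OF that] that by (simp add: powr_minus powr_numeral inverse_eq_divide)
    also have "\<dots> \<le> w powr (-3/2)" using True by (intro powr_mono) auto
    finally show ?thesis .
  next
    case False
    hence "1 powr (-3/2) \<le> w powr (-3/2)" using that by (intro powr_mono2') auto
    thus ?thesis using D(3)[OF that] by simp
  qed
  have "((\<lambda>t. \<Sum>m. t powr (3/2) * D (real (Suc m) * t)) \<longlongrightarrow> (\<Sum>m. 0)) (at_right 0)"
  proof (rule tannery_at_right_0[where M = "\<lambda>m. real (Suc m) powr (-3/2)"])
    fix m :: nat
    show "((\<lambda>t. t powr (3/2) * D (real (Suc m) * t)) \<longlongrightarrow> 0) (at_right 0)"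
    proof (rule tendsto_sandwich[of "\<lambda>_. 0" _ _ "\<lambda>t. t powr (3/2)"])
      show "\<forall>\<^sub>F t in at_right 0. 0 \<le> t powr (3/2) * D (real (Suc m) * t)"
        using D(1) by (intro eventually_mono[OF eventually_at_right_less]) auto
      show "\<forall>\<^sub>F t in at_right 0. t powr (3/2) * D (real (Suc m) * t) \<le> t powr (3/2)"
        using D(3) by (intro eventually_mono[OF eventually_at_right_less]) (auto intro!: mult_left_le)
    qed (simp, real_asymp)
  next
    fix m :: nat and t :: real assume t: "t > 0"
    have "t powr (3/2) * D (real (Suc m) * t) \<le> t powr (3/2) * (real (Suc m) * t) powr (-3/2)"
      using t by (intro mult_left_mono D_powr) auto
    also have "\<dots> = real (Suc m) powr (-3/2)"
      using t by (subst powr_mult) (auto simp: mult.left_commute powr_add[symmetric])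
    finally show "\<bar>t powr (3/2) * D (real (Suc m) * t)\<bar> \<le> real (Suc m) powr (-3/2)"
      using D(1)[of "real (Suc m) * t"] t by (subst abs_of_nonneg) auto
  next
    have "summable (\<lambda>m. real m powr (-3/2))"
      by (subst summable_real_powr_iff) simp
    thus "summable (\<lambda>m. real (Suc m) powr (-3/2))"
      by (subst summable_Suc_iff)
  qed
  moreover have "(\<Sum>m. t powr (3/2) * D (real (Suc m) * t)) = - (t powr (3/2) * (log_moment 1 t - pi\<^sup>2 / (6 * t\<^sup>2)))" if t: "t > 0" for t
  proof -
    have "(\<lambda>m. 1 / t\<^sup>2 * (1 / real (Suc m) ^ 2) - 1 / (4 * sinh (real (Suc m) * t / 2) ^ 2)) sums (1 / t\<^sup>2 * (pi\<^sup>2 / 6) - log_moment 1 t)"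
      using summable_sums[OF summable_inverse_Suc_squares] unfolding suminf_inverse_Suc_squares
      by (intro sums_diff sums_mult log_moment_1_sums t)
    also have "(\<lambda>m. 1 / t\<^sup>2 * (1 / real (Suc m) ^ 2) - 1 / (4 * sinh (real (Suc m) * t / 2) ^ 2)) = (\<lambda>m. D (real (Suc m) * t))"
      by (simp add: D_def fun_eq_iff power_mult_distrib mult.commute)
    finally have "(\<lambda>m. t powr (3/2) * D (real (Suc m) * t)) sums (t powr (3/2) * (1 / t\<^sup>2 * (pi\<^sup>2 / 6) - log_moment 1 t))"
      by (rule sums_mult)
    thus ?thesis by (simp add: sums_iff algebra_simps)
  qed
  hence "eventually (\<lambda>t. (\<Sum>m. t powr (3/2) * D (real (Suc m) * t)) = - (t powr (3/2) * (log_moment 1 t - pi\<^sup>2 / (6 * t\<^sup>2)))) (at_right 0)"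
    by (intro eventually_mono[OF eventually_at_right_less])
  ultimately have "((\<lambda>t. - (t powr (3/2) * (log_moment 1 t - pi\<^sup>2 / (6 * t\<^sup>2)))) \<longlongrightarrow> (\<Sum>m::nat. 0)) (at_right 0)"
    by (rule Lim_transform_eventually)
  from tendsto_minus[OF this] show ?thesis by simp
qed

lemma log_moment_2_limit: "((\<lambda>t. t ^ 3 * log_moment 2 t) \<longlongrightarrow> pi\<^sup>2 / 3) (at_right 0)"
proof -
  define a where "a = (\<lambda>m t. t ^ 3 * (real (Suc m) * (cosh (real (Suc m) * t / 2) / (4 * sinh (real (Suc m) * t / 2) ^ 3))))"
  have "((\<lambda>t. \<Sum>m. a m t) \<longlongrightarrow> (\<Sum>m. 2 * (1 / real (Suc m) ^ 2))) (at_right 0)"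
  proof (rule tannery_at_right_0[where M = "\<lambda>m. 8 * (1 / real (Suc m) ^ 2)"])
    fix m :: nat
    define c where "c = real (Suc m)"
    have c: "c > 0" by (simp add: c_def)
    hence "((\<lambda>t. t ^ 3 * (c * (((exp (c * t / 2) + exp (-(c * t / 2)))/2) / (4 * ((exp (c * t / 2) - exp (-(c * t / 2)))/2) ^ 3)))) \<longlongrightarrow> 2 * (1 / c ^ 2)) (at_right 0)"
      by (real_asymp simp: power2_eq_square power3_eq_cube field_simps)
    thus "(a m \<longlongrightarrow> 2 * (1 / real (Suc m) ^ 2)) (at_right 0)"
      unfolding a_def sinh_field_def cosh_field_def c_def .
  next
    fix m :: nat and t :: real assume t: "t > 0"
    define w where "w = real (Suc m) * t"
    have w: "w > 0" using t by (simp add: w_def)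
    have "a m t = w ^ 3 * (cosh (w / 2) / (4 * sinh (w / 2) ^ 3)) * (1 / real (Suc m) ^ 2)"
      by (simp add: a_def w_def power_mult_distrib power2_eq_square power3_eq_cube divide_simps del: of_nat_Suc)
    also have "\<dots> \<le> 8 * (1 / real (Suc m) ^ 2)"
      by (intro mult_right_mono cosh_sinh_cube_le w) auto
    finally show "\<bar>a m t\<bar> \<le> 8 * (1 / real (Suc m) ^ 2)"
      using t by (subst abs_of_nonneg) (auto simp: a_def)
  qed (intro summable_mult summable_inverse_Suc_squares)
  moreover have "(\<Sum>m. a m t) = t ^ 3 * log_moment 2 t" if "t > 0" for t
    unfolding a_def using sums_unique[OF sums_mult[OF log_moment_2_sums[OF that], of "t^3"]] by simp
  hence "eventually (\<lambda>t. (\<Sum>m. a m t) = t ^ 3 * log_moment 2 t) (at_right 0)"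
    by (intro eventually_mono[OF eventually_at_right_less])
  moreover have "(\<Sum>m. 2 * (1 / real (Suc m) ^ 2)) = pi\<^sup>2 / 3"
    by (simp only: suminf_mult[OF summable_inverse_Suc_squares] suminf_inverse_Suc_squares)
  ultimately show ?thesis
    using Lim_transform_eventually by metis
qed

text \<open>\<open>s\<^sup>2 * exp (- s / 2) \<le> 8\<close> trades two powers of \<open>n\<close> for half of the exponential decay.\<close>

lemma log_moment_3_le:
  assumes "t > 0"
  shows "log_moment 3 t \<le> 8 / t\<^sup>2 * log_moment 1 (t / 2)"
proof -
  have "log_coeff n * (real n ^ 3 * exp (- (real n * t))) \<le> 8 / t\<^sup>2 * (log_coeff n * (real n ^ 1 * exp (- (real n * (t / 2)))))" for n
  proof -
    define s where "s = real n * t"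
    have s: "s \<ge> 0" using assms by (simp add: s_def)
    have "s\<^sup>2 / 8 \<le> exp (s / 2)"
      using exp_lower_Taylor_quadratic[of "s / 2"] s by (simp add: power2_eq_square)
    hence "s\<^sup>2 * exp (- (s / 2)) \<le> 8"
      by (simp add: exp_minus field_simps)
    hence "real n ^ 2 * exp (- (real n * (t / 2))) \<le> 8 / t\<^sup>2"
      using assms by (simp add: s_def field_simps)
    hence "(log_coeff n * (real n ^ 1 * exp (- (real n * (t / 2))))) * (real n ^ 2 * exp (- (real n * (t / 2)))) \<le>
           (log_coeff n * (real n ^ 1 * exp (- (real n * (t / 2))))) * (8 / t\<^sup>2)"
      by (intro mult_left_mono mult_nonneg_nonneg log_coeff_nonneg) auto
    moreover have "exp (- (real n * t)) = exp (- (real n * (t / 2))) * exp (- (real n * (t / 2)))"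
      by (simp add: mult_exp_exp)
    ultimately show ?thesis by (simp add: power2_eq_square power3_eq_cube mult_ac)
  qed
  moreover have "(\<lambda>n. 8 / t\<^sup>2 * (log_coeff n * (real n ^ 1 * exp (- (real n * (t / 2)))))) sums (8 / t\<^sup>2 * log_moment 1 (t / 2))"
    using assms by (intro sums_mult log_moment_sums) auto
  ultimately show ?thesis
    by (rule sums_le[OF _ log_moment_sums[OF assms, of 3]])
qed

lemma log_moment_nonneg: "t > 0 \<Longrightarrow> log_moment j t \<ge> 0"
  unfolding log_moment_def
  by (intro suminf_nonneg sums_summable[OF log_moment_sums]) (auto simp: log_coeff_nonneg)

text \<open>\<open>9/2 = 3 * (3/2)\<close> is the order of the cube of the angle.
  \<open>log_moment_3_le\<close> and the first moment give a bound of order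
  \<open>t powr (-4)\<close>, which leaves half a power of \<open>t\<close> to spare.\<close>

lemma log_moment_3_limit: "((\<lambda>t. t powr (9/2) * log_moment 3 t) \<longlongrightarrow> 0) (at_right 0)"
proof (rule tendsto_sandwich[of "\<lambda>_. 0"])
  let ?g = "\<lambda>t. t powr (3/2) * (log_moment 1 t - pi\<^sup>2 / (6 * t\<^sup>2))"
  let ?u = "\<lambda>t. 8 * t powr (5/2) * ((t / 2) powr (-3/2) * ?g (t / 2) + pi\<^sup>2 / (6 * (t / 2)\<^sup>2))"
  show "eventually (\<lambda>t. 0 \<le> t powr (9/2) * log_moment 3 t) (at_right 0)"
    by (intro eventually_mono[OF eventually_at_right_less]) (auto simp: log_moment_nonneg)
  show "eventually (\<lambda>t. t powr (9/2) * log_moment 3 t \<le> ?u t) (at_right 0)"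
  proof (intro eventually_mono[OF eventually_at_right_less])
    fix t :: real assume t: "0 < t"
    have eq: "t powr (9/2) = t powr (5/2) * t\<^sup>2"
      using t by (simp add: powr_add[symmetric] flip: powr_numeral)
    have "t powr (9/2) * log_moment 3 t \<le> t powr (9/2) * (8 / t\<^sup>2 * log_moment 1 (t / 2))"
      by (intro mult_left_mono log_moment_3_le t) auto
    also have "t powr (9/2) * (8 / t\<^sup>2 * log_moment 1 (t / 2)) = 8 * t powr (5/2) * log_moment 1 (t / 2)"
      unfolding eq using t by simp
    finally have "t powr (9/2) * log_moment 3 t \<le> 8 * t powr (5/2) * log_moment 1 (t / 2)" .
    moreover have "log_moment 1 (t / 2) = (t / 2) powr (-3/2) * ?g (t / 2) + pi\<^sup>2 / (6 * (t / 2)\<^sup>2)"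
    proof -
      have "(t / 2) powr (-3/2) * (t / 2) powr (3/2) = 1"
        using t by (simp add: powr_add[symmetric])
      thus ?thesis by (simp only: mult.assoc[symmetric]) simp
    qed
    ultimately show "t powr (9/2) * log_moment 3 t \<le> ?u t" by simp
  qed
  have "filterlim (\<lambda>t::real. t / 2) (at_right 0) (at_right 0)" by real_asymp
  hence g: "((\<lambda>t. ?g (t / 2)) \<longlongrightarrow> 0) (at_right 0)"
    by (rule filterlim_compose[OF log_moment_1_limit])
  have "((\<lambda>t. (8 * t powr (5/2) * (t / 2) powr (-3/2)) * ?g (t / 2) + 8 * t powr (5/2) * (pi\<^sup>2 / (6 * (t / 2)\<^sup>2))) \<longlongrightarrow> 0 * 0 + 0) (at_right (0::real))"
    by (intro tendsto_intros g) real_asymp+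
  thus "(?u \<longlongrightarrow> 0) (at_right 0)"
    by (simp add: algebra_simps)
qed simp

subsection \<open>The constant in the logarithm of the generating function\<close>

lemma sinh_mult_diff: "sinh (a + b) * sinh (a - b) = sinh a ^ 2 - sinh b ^ 2" for a b :: real
  using cosh_square_eq[of a] cosh_square_eq[of b]
  by (simp add: sinh_add sinh_diff algebra_simps flip: power2_eq_square power_mult_distrib) (simp add: algebra_simps)

text \<open>By the addition formula and \<open>cosh x \<ge> 1\<close>. It bounds
  \<open>sinh x / sinh (k * x)\<close> uniformly in \<open>x\<close>, hence the Wallis terms
  uniformly in \<open>t\<close>.\<close>

lemma sinh_mult_ge:
  fixes x :: real assumes "x \<ge> 0"
  shows "real k * sinh x \<le> sinh (real k * x)"
proof (induction k)
  case (Suc k)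
  have "real (Suc k) * sinh x = real k * sinh x * 1 + 1 * sinh x" by (simp add: algebra_simps)
  also have "\<dots> \<le> sinh (real k * x) * cosh x + cosh (real k * x) * sinh x"
    using Suc assms by (intro add_mono mult_mono) (auto simp: cosh_real_ge_1)
  also have "\<dots> = sinh (real k * x + x)" by (rule sinh_add[symmetric])
  also have "real k * x + x = real (Suc k) * x" by (simp add: algebra_simps)
  finally show ?case .
qed auto

text \<open>By \<open>sinh_mult_diff\<close> the argument of \<open>ln\<close> is the square of
  \<open>sinh\<close> at \<open>(2 * k + 2) * (t / 2)\<close> divided by the product of its values
  at the two neighbours; for \<open>t\<close> to 0 it becomes a factor of Wallis' product. The form
  \<open>1 + ...\<close> allows the bound \<open>ln (1 + x) \<le> x\<close>.\<close>

definition wallis_term :: "nat \<Rightarrow> real \<Rightarrow> real" where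
  "wallis_term k t = ln (1 + sinh (t / 2) ^ 2 / (sinh (real (2 * k + 1) * (t / 2)) * sinh (real (2 * k + 3) * (t / 2))))"

text \<open>A \<open>q\<close>-analogue of the logarithm of Wallis' product.\<close>

lemma wallis_term_sums:
  assumes "t > 0"
  shows "(\<lambda>k. wallis_term k t) sums (2 * log_moment 0 t - 4 * log_moment 0 (2 * t) + ln (1 - exp (- t)))"
proof -
  define a where "a = (\<lambda>k. - ln (1 - exp (- (real k * t))))"
  have all: "(\<lambda>k. a (Suc k)) sums log_moment 0 t"
    unfolding a_def by (rule log_moment_0_sums(2)[OF assms])
  have even: "(\<lambda>k. a (2 * k + 2)) sums log_moment 0 (2 * t)"
    using log_moment_0_sums(2)[of "2 * t"] assms by (simp add: a_def algebra_simps)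
  have "(\<lambda>k. \<Sum>i\<in>{k * 2..<k * 2 + 2}. a (Suc i)) sums log_moment 0 t"
    by (rule sums_group[OF all]) simp
  also have "(\<lambda>k. \<Sum>i\<in>{k * 2..<k * 2 + 2}. a (Suc i)) = (\<lambda>k. a (2 * k + 1) + a (2 * k + 2))"
    by (simp add: fun_eq_iff mult.commute)
  finally have "(\<lambda>k. a (2 * k + 1) + a (2 * k + 2) - a (2 * k + 2)) sums (log_moment 0 t - log_moment 0 (2 * t))"
    by (rule sums_diff[OF _ even])
  hence odd: "(\<lambda>k. a (2 * k + 1)) sums (log_moment 0 t - log_moment 0 (2 * t))"
    by simp
  hence "(\<lambda>k. a (2 * Suc k + 1)) sums (log_moment 0 t - log_moment 0 (2 * t) - a 1)"
    by (subst sums_Suc_iff) simp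
  hence odd': "(\<lambda>k. a (2 * k + 3)) sums (log_moment 0 t - log_moment 0 (2 * t) - a 1)"
    by (simp add: algebra_simps numeral_3_eq_3)
  \<comment> \<open>A second difference: in \<open>a j = j * (t / 2) - ln 2 - ln (s j)\<close> the
    constant and linear parts cancel and only the \<open>sinh\<close> factors survive.\<close>
  have "(\<lambda>k. a (2 * k + 1) + a (2 * k + 3) - 2 * a (2 * k + 2)) sums
          ((log_moment 0 t - log_moment 0 (2 * t)) + (log_moment 0 t - log_moment 0 (2 * t) - a 1) - 2 * log_moment 0 (2 * t))"
    by (intro sums_diff sums_add sums_mult odd odd' even)
  moreover have "a (2 * k + 1) + a (2 * k + 3) - 2 * a (2 * k + 2) = wallis_term k t" for k
  proof -
    define s where "s = (\<lambda>j. sinh (real j * (t / 2)))"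
    have s_pos: "s j > 0" if "j > 0" for j using that assms by (simp add: s_def)
    have a: "a j = real j * (t / 2) - ln 2 - ln (s j)" if "j > 0" for j
    proof -
      have "1 - exp (- (real j * t)) = 2 * exp (- (real j * (t / 2))) * s j"
        using half_sinh[of "real j * t"] by (simp add: s_def)
      hence "ln (1 - exp (- (real j * t))) = ln (2 * exp (- (real j * (t / 2)))) + ln (s j)"
        using s_pos[OF that] by (simp only:) (intro ln_mult_pos, auto)
      also have "ln (2 * exp (- (real j * (t / 2)))) = ln 2 - real j * (t / 2)"
        by (subst ln_mult_pos) auto
      finally show ?thesis by (simp add: a_def)
    qed
    have "s (2 * k + 2) ^ 2 = s (2 * k + 1) * s (2 * k + 3) + sinh (t / 2) ^ 2"
      using sinh_mult_diff[of "real (2 * k + 2) * (t / 2)" "t / 2"]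
      by (simp add: s_def algebra_simps add_divide_distrib)
    hence "1 + sinh (t / 2) ^ 2 / (s (2 * k + 1) * s (2 * k + 3)) = s (2 * k + 2) ^ 2 / (s (2 * k + 1) * s (2 * k + 3))"
      using s_pos[of "2 * k + 1"] s_pos[of "2 * k + 3"] by (simp add: field_simps)
    hence "wallis_term k t = ln (s (2 * k + 2) ^ 2 / (s (2 * k + 1) * s (2 * k + 3)))"
      by (simp only: wallis_term_def s_def)
    also have "\<dots> = 2 * ln (s (2 * k + 2)) - (ln (s (2 * k + 1)) + ln (s (2 * k + 3)))"
      using s_pos[of "2 * k + 1"] s_pos[of "2 * k + 2"] s_pos[of "2 * k + 3"]
      by (simp add: ln_div ln_mult_pos ln_realpow)
    finally show ?thesis
      by (simp add: a algebra_simps add_divide_distrib)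
  qed
  moreover have "log_moment 0 t - log_moment 0 (2 * t) + (log_moment 0 t - log_moment 0 (2 * t) - a 1) - 2 * log_moment 0 (2 * t)
      = 2 * log_moment 0 t - 4 * log_moment 0 (2 * t) + ln (1 - exp (- t))"
    by (simp add: a_def)
  ultimately show ?thesis by (simp only:)
qed

lemma wallis_term_limit:
  "((\<lambda>t. 2 * log_moment 0 t - 4 * log_moment 0 (2 * t) + ln (1 - exp (- t))) \<longlongrightarrow> ln (pi / 2)) (at_right 0)"
proof -
  define b where "b = (\<lambda>k. ln (1 + 1 / (real (2 * k + 1) * real (2 * k + 3))))"
  have sinh_quotient: "((\<lambda>t. sinh (t / 2) / sinh (c * (t / 2))) \<longlongrightarrow> 1 / c) (at_right 0)" if "c > 0" for c :: real
    unfolding sinh_field_def using that by real_asymp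
  have "((\<lambda>t. \<Sum>k. wallis_term k t) \<longlongrightarrow> (\<Sum>k. b k)) (at_right 0)"
  proof (rule tannery_at_right_0[where M = "\<lambda>k. 1 / real (Suc k) ^ 2"])
    fix k :: nat
    have "((\<lambda>t. ln (1 + (sinh (t / 2) / sinh (real (2 * k + 1) * (t / 2))) * (sinh (t / 2) / sinh (real (2 * k + 3) * (t / 2)))))
       \<longlongrightarrow> ln (1 + (1 / real (2 * k + 1)) * (1 / real (2 * k + 3)))) (at_right 0)"
      by (intro tendsto_intros sinh_quotient) (auto simp: add_pos_nonneg less_imp_neq[symmetric])
    thus "(wallis_term k \<longlongrightarrow> b k) (at_right 0)"
      by (simp add: wallis_term_def[abs_def] b_def power2_eq_square)
  next
    fix k :: nat and t :: real assume t: "t > 0"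
    define u where "u = sinh (t / 2)"
    define v where "v = sinh (real (2 * k + 1) * (t / 2)) * sinh (real (2 * k + 3) * (t / 2))"
    have u: "u > 0" using t by (simp add: u_def)
    have "(real (2 * k + 1) * u) * (real (2 * k + 3) * u) \<le> v"
      unfolding v_def u_def using t by (intro mult_mono sinh_mult_ge) auto
    moreover have "(real (Suc k) * u) * (real (Suc k) * u) \<le> (real (2 * k + 1) * u) * (real (2 * k + 3) * u)"
      using u by (intro mult_mono) auto
    ultimately have v: "real (Suc k) ^ 2 * u ^ 2 \<le> v"
      by (simp add: power2_eq_square mult_ac)
    have pos: "0 < real (Suc k) ^ 2 * u ^ 2" using u by simp
    have nonneg: "u ^ 2 / v \<ge> 0" using pos v by simp
    have "u ^ 2 / v \<le> u ^ 2 / (real (Suc k) ^ 2 * u ^ 2)"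
      using pos v by (intro divide_left_mono mult_pos_pos) auto
    also have "\<dots> = 1 / real (Suc k) ^ 2" using u by simp
    finally have "ln (1 + u ^ 2 / v) \<le> 1 / real (Suc k) ^ 2"
      using ln_add_one_self_le_self[OF nonneg] by linarith
    moreover have "ln (1 + u ^ 2 / v) \<ge> 0" using nonneg by simp
    ultimately show "\<bar>wallis_term k t\<bar> \<le> 1 / real (Suc k) ^ 2"
      by (simp add: wallis_term_def u_def v_def)
  qed (rule summable_inverse_Suc_squares)
  moreover have "(\<Sum>k. wallis_term k t) = 2 * log_moment 0 t - 4 * log_moment 0 (2 * t) + ln (1 - exp (- t))" if "t > 0" for t
    using sums_unique[OF wallis_term_sums[OF that]] by simp
  hence "eventually (\<lambda>t. (\<Sum>k. wallis_term k t) = 2 * log_moment 0 t - 4 * log_moment 0 (2 * t) + ln (1 - exp (- t))) (at_right 0)"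
    by (intro eventually_mono[OF eventually_at_right_less])
  ultimately have lim: "((\<lambda>t. 2 * log_moment 0 t - 4 * log_moment 0 (2 * t) + ln (1 - exp (- t))) \<longlongrightarrow> (\<Sum>k. b k)) (at_right 0)"
    by (rule Lim_transform_eventually)
  have "(\<lambda>n. ln (\<Prod>k=1..n. (4 * real k ^ 2) / (4 * real k ^ 2 - 1))) \<longlonglongrightarrow> ln (pi / 2)"
    by (intro tendsto_ln wallis) auto
  also have "(\<lambda>n. ln (\<Prod>k=1..n. (4 * real k ^ 2) / (4 * real k ^ 2 - 1))) = (\<lambda>n. \<Sum>k<n. b k)"
  proof
    fix n
    have shift: "prod f {1..n} = (\<Prod>k<n. f (Suc k))" for f :: "nat \<Rightarrow> real"
      by (simp add: prod.atLeast1_atMost_eq)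
    have "(\<Prod>k=1..n. (4 * real k ^ 2) / (4 * real k ^ 2 - 1)) = (\<Prod>k<n. 1 + 1 / (real (2 * k + 1) * real (2 * k + 3)))"
      unfolding shift
    proof (rule prod.cong[OF refl])
      fix k
      have "4 * real (Suc k) ^ 2 - 1 = real (2 * k + 1) * real (2 * k + 3)"
        by (simp add: power2_eq_square algebra_simps)
      moreover from this have "4 * real (Suc k) ^ 2 = real (2 * k + 1) * real (2 * k + 3) + 1" by linarith
      moreover have "real (2 * k + 1) * real (2 * k + 3) > 0" by (intro mult_pos_pos) auto
      ultimately show "4 * real (Suc k) ^ 2 / (4 * real (Suc k) ^ 2 - 1) = 1 + 1 / (real (2 * k + 1) * real (2 * k + 3))"
        by (simp only: add_divide_distrib) simp
    qed
    also have "ln \<dots> = (\<Sum>k<n. b k)"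
    proof -
      have "1 + 1 / (real (2 * i + 1) * real (2 * i + 3)) \<noteq> 0" for i
        by (rule less_imp_neq[THEN not_sym], intro add_pos_nonneg) auto
      thus ?thesis unfolding b_def by (intro ln_prod) auto
    qed
    finally show "ln (\<Prod>k=1..n. (4 * real k ^ 2) / (4 * real k ^ 2 - 1)) = (\<Sum>k<n. b k)" .
  qed
  finally have "b sums ln (pi / 2)" by (simp add: sums_def)
  with lim show ?thesis by (simp add: sums_iff)
qed

text \<open>Iterate \<open>g (2 * s) = (g s + o(1)) / 2\<close> from \<open>s / 2 ^ n\<close> up to \<open>s\<close>: the starting value
  gets divided by \<open>2 ^ n\<close>, which the second assumption absorbs.\<close>

lemma tendsto_0_of_doubling:
  fixes g :: "real \<Rightarrow> real"
  assumes doubling: "((\<lambda>t. g t - 2 * g (2 * t)) \<longlongrightarrow> 0) (at_right 0)"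
    and small: "((\<lambda>t. t * g t) \<longlongrightarrow> 0) (at_right 0)"
  shows "(g \<longlongrightarrow> 0) (at_right 0)"
proof (rule tendstoI)
  fix \<epsilon> :: real assume \<epsilon>: "\<epsilon> > 0"
  have "eventually (\<lambda>t. \<bar>g t - 2 * g (2 * t)\<bar> < \<epsilon> / 2) (at_right 0)"
    using tendstoD[OF doubling, of "\<epsilon> / 2"] \<epsilon> by (simp add: dist_real_def)
  then obtain \<delta> where \<delta>: "\<delta> > 0" "\<And>t. 0 < t \<Longrightarrow> t < \<delta> \<Longrightarrow> \<bar>g t - 2 * g (2 * t)\<bar> < \<epsilon> / 2"
    unfolding eventually_at_right_field by auto
  have "\<bar>g s\<bar> \<le> \<epsilon> / 2" if s: "0 < s" "s < \<delta>" for s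
  proof -
    \<comment> \<open>Each halving of the argument costs \<open>\<epsilon> / 4\<close>, again
      divided by the power of 2 reached so far; the geometric sum of these costs is
      \<open>\<epsilon> / 2 * (1 - 1 / 2 ^ n)\<close>.\<close>
    have "\<bar>g s\<bar> \<le> \<bar>g (s / 2 ^ n)\<bar> / 2 ^ n + \<epsilon> / 2 * (1 - 1 / 2 ^ n)" for n
    proof (induction n)
      case (Suc n)
      define s' where "s' = s / 2 ^ Suc n"
      have s': "0 < s'" "2 * s' = s / 2 ^ n" using s by (auto simp: s'_def)
      have "s' \<le> s / 1" unfolding s'_def using s one_le_power[of "2::real" "Suc n"]
        by (intro divide_left_mono) auto
      hence "\<bar>g s' - 2 * g (2 * s')\<bar> < \<epsilon> / 2" using \<delta>(2)[of s'] s s' by auto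
      hence "\<bar>g (s / 2 ^ n)\<bar> \<le> \<bar>g s'\<bar> / 2 + \<epsilon> / 4" unfolding s'(2)[symmetric] by linarith
      hence "\<bar>g (s / 2 ^ n)\<bar> / 2 ^ n \<le> (\<bar>g s'\<bar> / 2 + \<epsilon> / 4) / 2 ^ n"
        by (intro divide_right_mono) auto
      moreover have "(\<bar>g s'\<bar> / 2 + \<epsilon> / 4) / 2 ^ n + \<epsilon> / 2 * (1 - 1 / 2 ^ n) = \<bar>g s'\<bar> / 2 ^ Suc n + \<epsilon> / 2 * (1 - 1 / 2 ^ Suc n)"
        by (simp add: field_simps)
      ultimately show ?case using Suc unfolding s'_def[symmetric] by linarith
    qed simp
    moreover have "(\<lambda>n. \<bar>g (s / 2 ^ n)\<bar> / 2 ^ n + \<epsilon> / 2 * (1 - 1 / 2 ^ n)) \<longlonglongrightarrow> 0 + \<epsilon> / 2 * (1 - 0)"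
    proof (intro tendsto_intros)
      have "filterlim (\<lambda>n. s / 2 ^ n) (at_right 0) sequentially" using s by real_asymp
      hence "(\<lambda>n. (s / 2 ^ n) * g (s / 2 ^ n)) \<longlonglongrightarrow> 0"
        by (rule filterlim_compose[OF small])
      hence "(\<lambda>n. \<bar>(s / 2 ^ n) * g (s / 2 ^ n)\<bar> / s) \<longlonglongrightarrow> \<bar>0\<bar> / s"
        by (intro tendsto_intros) (use s in auto)
      thus "(\<lambda>n. \<bar>g (s / 2 ^ n)\<bar> / 2 ^ n) \<longlonglongrightarrow> 0"
        using s by (simp add: abs_mult)
      show "(\<lambda>n. 1 / 2 ^ n :: real) \<longlonglongrightarrow> 0" by real_asymp
    qed
    ultimately show ?thesis
      by (intro LIMSEQ_le_const[where a = "\<bar>g s\<bar>"]) auto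
  qed
  hence "\<bar>g s\<bar> < \<epsilon>" if "0 < s" "s < \<delta>" for s
    using that \<epsilon> by force
  thus "eventually (\<lambda>t. dist (g t) 0 < \<epsilon>) (at_right 0)"
    unfolding eventually_at_right_field using \<delta>(1) by (auto simp: dist_real_def)
qed

text \<open>In \<open>g t - 2 * g (2 * t)\<close> the terms in \<open>1 / t\<close> cancel, and the
  remaining \<open>ln t / 2\<close> is matched by \<open>ln (1 - exp (- t)) / 2\<close> from the
  Wallis limit. The constant \<open>ln (2 * pi) / 2\<close> is the one that makes the limit of this
  combination 0.\<close>

theorem log_moment_0_asymp:
  "((\<lambda>t. log_moment 0 t - pi\<^sup>2 / (6 * t) - ln t / 2) \<longlongrightarrow> - (ln (2 * pi) / 2)) (at_right 0)"
proof -
  define g where "g = (\<lambda>t. log_moment 0 t - pi\<^sup>2 / (6 * t) - ln t / 2 + ln (2 * pi) / 2)"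
  have "(g \<longlongrightarrow> 0) (at_right 0)"
  proof (rule tendsto_0_of_doubling)
    have "((\<lambda>t. ((2 * log_moment 0 t - 4 * log_moment 0 (2 * t) + ln (1 - exp (- t))) - ln ((1 - exp (- t)) / t) + 2 * ln 2 - ln (2 * pi)) / 2)
            \<longlongrightarrow> (ln (pi / 2) - 0 + 2 * ln 2 - ln (2 * pi)) / 2) (at_right 0)"
      by (intro tendsto_intros wallis_term_limit) (real_asymp | simp)+
    also have "(ln (pi / 2) - 0 + 2 * ln 2 - ln (2 * pi)) / 2 = 0"
      by (simp add: ln_div ln_mult_pos)
    finally show "((\<lambda>t. g t - 2 * g (2 * t)) \<longlongrightarrow> 0) (at_right 0)"
    proof (rule Lim_transform_eventually)
      show "\<forall>\<^sub>F t in at_right 0. ((2 * log_moment 0 t - 4 * log_moment 0 (2 * t) + ln (1 - exp (- t))) - ln ((1 - exp (- t)) / t) + 2 * ln 2 - ln (2 * pi)) / 2 = g t - 2 * g (2 * t)"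
        by (intro eventually_mono[OF eventually_at_right_less])
           (simp add: g_def ln_div ln_mult_pos field_simps)
    qed
    have "((\<lambda>t. t * log_moment 0 t - pi\<^sup>2 / 6 + (t * (ln (2 * pi) / 2 - ln t / 2))) \<longlongrightarrow> pi\<^sup>2 / 6 - pi\<^sup>2 / 6 + 0) (at_right 0)"
      by (intro tendsto_add tendsto_diff log_moment_0_limit tendsto_const) real_asymp
    thus "((\<lambda>t. t * g t) \<longlongrightarrow> 0) (at_right 0)"
    proof (subst (asm) diff_self, subst (asm) add_0_left, elim Lim_transform_eventually)
      show "\<forall>\<^sub>F t in at_right 0. t * log_moment 0 t - pi\<^sup>2 / 6 + (t * (ln (2 * pi) / 2 - ln t / 2)) = t * g t"
        by (intro eventually_mono[OF eventually_at_right_less]) (simp add: g_def field_simps)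
    qed
  qed
  hence "((\<lambda>t. g t - ln (2 * pi) / 2) \<longlongrightarrow> 0 - ln (2 * pi) / 2) (at_right 0)"
    by (intro tendsto_diff tendsto_const)
  thus ?thesis by (simp add: g_def)
qed

subsection \<open>The saddle point integral\<close>

text \<open>The logarithm of the characteristic function of the sum of \<open>n * X n\<close> with
  independent Poisson variables \<open>X n\<close> of mean
  \<open>log_coeff n * exp (- n * t)\<close>.\<close>

definition char_exponent :: "real \<Rightarrow> real \<Rightarrow> complex" where
  "char_exponent t \<theta> = (\<Sum>n. of_real (log_coeff n * exp (- (real n * t))) * (iexp (real n * \<theta>) - 1))"

lemma summable_char_exponent_weight:
  "t > 0 \<Longrightarrow> summable (\<lambda>n. log_coeff n * exp (- (real n * t)))"
  using sums_summable[OF log_moment_sums[of t 0]] by simp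

lemma char_exponent_sums:
  assumes "t > 0"
  shows "(\<lambda>n. of_real (log_coeff n * exp (- (real n * t))) * (iexp (real n * \<theta>) - 1)) sums char_exponent t \<theta>"
  unfolding char_exponent_def
proof (rule summable_sums, rule summable_norm_cancel, rule summable_comparison_test)
  show "\<exists>N. \<forall>n\<ge>N. norm (norm (of_real (log_coeff n * exp (- (real n * t))) * (iexp (real n * \<theta>) - 1))) \<le>
          log_coeff n * exp (- (real n * t)) * 2"
  proof (intro exI allI impI)
    fix n :: nat
    have "norm (iexp (real n * \<theta>) - 1) \<le> norm (iexp (real n * \<theta>)) + norm (1::complex)"
      by (rule norm_triangle_ineq4)
    hence "norm (iexp (real n * \<theta>) - 1) \<le> 2" by simp
    thus "norm (norm (of_real (log_coeff n * exp (- (real n * t))) * (iexp (real n * \<theta>) - 1))) \<le>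
          log_coeff n * exp (- (real n * t)) * 2"
      using log_coeff_nonneg[of n] by (simp add: norm_mult mult_left_mono)
  qed
qed (intro summable_mult2 summable_char_exponent_weight assms)

lemma log_series_polar:
  assumes "t > 0"
  shows "log_series (of_real (exp (- t)) * iexp \<theta>) = of_real (log_moment 0 t) + char_exponent t \<theta>"
proof -
  have "(\<lambda>n. of_real (log_coeff n * (real n ^ 0 * exp (- (real n * t)))) + of_real (log_coeff n * exp (- (real n * t))) * (iexp (real n * \<theta>) - 1))
          sums (of_real (log_moment 0 t) + char_exponent t \<theta>)"
    by (intro sums_add sums_of_real log_moment_sums char_exponent_sums assms)
  also have "(\<lambda>n. of_real (log_coeff n * (real n ^ 0 * exp (- (real n * t)))) + of_real (log_coeff n * exp (- (real n * t))) * (iexp (real n * \<theta>) - 1))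
      = (\<lambda>n. of_real (log_coeff n) * (of_real (exp (- t)) * iexp \<theta>) ^ n)"
  proof
    fix n
    have "of_real (exp (- t)) ^ n = (of_real (exp (- (real n * t))) :: complex)"
      by (simp add: exp_of_nat_mult[symmetric] flip: of_real_power)
    moreover have "iexp \<theta> ^ n = iexp (real n * \<theta>)"
      by (simp add: exp_of_nat_mult[symmetric] mult_ac)
    ultimately show "of_real (log_coeff n * (real n ^ 0 * exp (- (real n * t)))) + of_real (log_coeff n * exp (- (real n * t))) * (iexp (real n * \<theta>) - 1)
      = of_real (log_coeff n) * (of_real (exp (- t)) * iexp \<theta>) ^ n"
      by (simp only: power_mult_distrib of_real_mult power_0 of_real_1) (simp add: algebra_simps)
  qed
  finally show ?thesis by (simp add: log_series_def sums_iff)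
qed

lemma num_partitions_integral:
  assumes t: "t > 0"
  shows "of_real (2 * pi * real (num_partitions n) * exp (- (real n * t)) * exp (- log_moment 0 t)) =
     (\<integral>\<theta>. indicator {-pi..pi} \<theta> *\<^sub>R exp (char_exponent t \<theta> - \<i> * of_real (real n * \<theta>)) \<partial>lborel)"
proof -
  define a :: "nat \<Rightarrow> complex" where "a = (\<lambda>k. of_nat (num_partitions k) * of_real (exp (- t)) ^ k)"
  have "summable (\<lambda>k. of_nat (num_partitions k) * of_real (exp (- t)) ^ k :: complex)"
    using num_partitions_generating_function[of "of_real (exp (- t))"] t by (auto simp: sums_iff)
  also have "(\<lambda>k. of_nat (num_partitions k) * of_real (exp (- t)) ^ k :: complex) =
      (\<lambda>k. of_real (real (num_partitions k) * exp (- t) ^ k))" by simp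
  finally have "summable (\<lambda>k. real (num_partitions k) * exp (- t) ^ k)"
    by (subst (asm) summable_complex_of_real)
  hence "summable (\<lambda>k. norm (a k))"
    by (simp add: a_def norm_mult norm_power)
  hence "(\<integral>\<theta>. indicator {-pi..pi} \<theta> *\<^sub>R ((\<Sum>k. a k * iexp \<theta> ^ k) * exp (- \<i> * of_nat n * of_real \<theta>)) \<partial>lborel)
           = of_real (2 * pi) * a n"
    by (rule fourier_coefficient)
  moreover have "(\<Sum>k. a k * iexp \<theta> ^ k) * exp (- \<i> * of_nat n * of_real \<theta>) =
      of_real (exp (log_moment 0 t)) * exp (char_exponent t \<theta> - \<i> * of_real (real n * \<theta>))" for \<theta>
  proof -
    have "(\<lambda>k. of_nat (num_partitions k) * (of_real (exp (- t)) * iexp \<theta>) ^ k) sums exp (log_series (of_real (exp (- t)) * iexp \<theta>))"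
      by (rule num_partitions_generating_function) (use t in \<open>simp add: norm_mult\<close>)
    hence "(\<Sum>k. a k * iexp \<theta> ^ k) = exp (of_real (log_moment 0 t) + char_exponent t \<theta>)"
      by (simp add: a_def sums_iff log_series_polar[OF t] power_mult_distrib mult.assoc)
    thus ?thesis
      by (simp add: exp_of_real mult_exp_exp[symmetric] exp_diff exp_minus field_simps exp_add)
  qed
  ultimately have "(\<integral>\<theta>. of_real (exp (log_moment 0 t)) * (indicator {-pi..pi} \<theta> *\<^sub>R exp (char_exponent t \<theta> - \<i> * of_real (real n * \<theta>))) \<partial>lborel)
           = of_real (2 * pi) * a n"
    by (simp add: mult_ac)
  hence "of_real (exp (log_moment 0 t)) * (\<integral>\<theta>. indicator {-pi..pi} \<theta> *\<^sub>R exp (char_exponent t \<theta> - \<i> * of_real (real n * \<theta>)) \<partial>lborel)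
           = of_real (2 * pi) * a n" (is "_ * ?I = _")
    by (subst (asm) integral_mult_right_zero)
  moreover have "exp (- t) ^ n = exp (- (real n * t))" by (simp add: exp_of_nat_mult[symmetric])
  hence "a n = of_real (real (num_partitions n) * exp (- (real n * t)))"
    by (simp add: a_def flip: of_real_power)
  ultimately have "of_real (exp (log_moment 0 t)) * ?I = of_real (2 * pi * (real (num_partitions n) * exp (- (real n * t))))"
    by simp
  moreover have "?I = of_real (exp (- log_moment 0 t)) * (of_real (exp (log_moment 0 t)) * ?I)"
    by (simp add: exp_minus field_simps)
  ultimately show ?thesis by (simp add: mult_ac)
qed

text \<open>The variance \<open>log_moment 2 t\<close> is asymptotic to
  \<open>pi^2 / (3 * t^3)\<close>, so angles of size \<open>t powr (3/2)\<close> are those for which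
  the integrand has a Gaussian limit.\<close>

lemma num_partitions_scaled_integral:
  assumes t: "t > 0"
  shows "of_real (2 * pi * real (num_partitions n) * exp (- (real n * t)) * exp (- log_moment 0 t) / t powr (3/2)) =
     (\<integral>u. indicator {-pi..pi} (t powr (3/2) * u) *\<^sub>R
        exp (char_exponent t (t powr (3/2) * u) - \<i> * of_real (real n * (t powr (3/2) * u))) \<partial>lborel)"
proof -
  have c: "t powr (3/2) > 0" using t by simp
  show ?thesis
    using num_partitions_integral[OF t, of n]
      lborel_integral_real_affine[of "t powr (3/2)" "\<lambda>\<theta>. indicator {-pi..pi} \<theta> *\<^sub>R exp (char_exponent t \<theta> - \<i> * of_real (real n * \<theta>))" 0] c
    by (simp add: scaleR_conv_of_real field_simps)
qed

subsection \<open>Bounding the integrand\<close>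

text \<open>Taylor's formula with remainder of order four and
  \<open>\<theta>^2 \<le> pi^2 \<le> 10\<close>; the constant is
  \<open>1/2 - 10/24 = 1/12\<close>.\<close>

lemma one_minus_cos_ge:
  assumes "\<bar>\<theta>\<bar> \<le> pi"
  shows "\<theta>\<^sup>2 / 12 \<le> 1 - cos \<theta>"
proof -
  have "pi * pi \<le> 3.15 * 3.15" using pi_approx by (intro mult_mono) auto
  moreover have "\<theta>\<^sup>2 \<le> pi\<^sup>2" using assms by (metis abs_le_square_iff abs_of_pos pi_gt_zero)
  ultimately have "\<theta>\<^sup>2 \<le> 10" by (simp add: power2_eq_square)
  have "Re (iexp \<theta> - (\<Sum>k\<le>3. (\<i> * of_real \<theta>) ^ k / fact k)) \<le> norm (iexp \<theta> - (\<Sum>k\<le>3. (\<i> * of_real \<theta>) ^ k / fact k))"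
    by (rule complex_Re_le_cmod)
  also have "\<dots> \<le> \<bar>\<theta>\<bar> ^ Suc 3 / fact (Suc 3)" by (rule iexp_approx1)
  also have "\<bar>\<theta>\<bar> ^ Suc 3 / fact (Suc 3) = \<theta>\<^sup>2 * \<theta>\<^sup>2 / 24"
    by (simp add: fact_numeral power4_eq_xxxx power2_eq_square eval_nat_numeral)
  also have "Re (iexp \<theta> - (\<Sum>k\<le>3. (\<i> * of_real \<theta>) ^ k / fact k)) = cos \<theta> - 1 + \<theta>\<^sup>2 / 2"
    by (simp add: eval_nat_numeral Re_exp power2_eq_square)
  finally have "\<theta>\<^sup>2 / 2 - \<theta>\<^sup>2 * \<theta>\<^sup>2 / 24 \<le> 1 - cos \<theta>" by linarith
  moreover have "\<theta>\<^sup>2 * \<theta>\<^sup>2 \<le> 10 * \<theta>\<^sup>2" using \<open>\<theta>\<^sup>2 \<le> 10\<close> by (intro mult_right_mono) auto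
  ultimately show ?thesis by linarith
qed

text \<open>Since \<open>log_coeff n \<ge> 1\<close>, the real part is dominated by a geometric series, which can be summed.\<close>

lemma Re_char_exponent_le:
  fixes t \<theta> :: real
  assumes t: "t > 0"
  defines "x \<equiv> exp (- t)" and "v \<equiv> 1 - cos \<theta>"
  shows "Re (char_exponent t \<theta>) \<le> - (x * (1 + x) * v / ((1 - x) * ((1 - x)\<^sup>2 + 2 * x * v)))"
proof -
  have x: "0 < x" "x < 1" using t by (auto simp: x_def)
  have v: "v \<ge> 0" by (simp add: v_def)
  define y where "y = of_real x * iexp \<theta>"
  have norm_y: "norm y = x" using x by (simp add: y_def norm_mult)
  have geo: "(\<lambda>n. Re (y ^ n) - x ^ n) sums (Re (1 / (1 - y)) - 1 / (1 - x))"
    using x norm_y by (intro sums_diff sums_Re geometric_sums) auto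
  have le: "Re (of_real (log_coeff n * exp (- (real n * t))) * (iexp (real n * \<theta>) - 1)) \<le> Re (y ^ n) - x ^ n" for n
  proof -
    have e: "exp (- (real n * t)) = x ^ n" by (simp add: x_def exp_of_nat_mult[symmetric])
    have "y ^ n = of_real (x ^ n) * iexp (real n * \<theta>)"
      by (simp add: y_def power_mult_distrib exp_of_nat_mult[symmetric] mult_ac)
    hence "Re (y ^ n) - x ^ n = x ^ n * (cos (real n * \<theta>) - 1)"
      by (simp add: Re_exp algebra_simps)
    moreover have "Re (of_real (log_coeff n * exp (- (real n * t))) * (iexp (real n * \<theta>) - 1)) = log_coeff n * (x ^ n * (cos (real n * \<theta>) - 1))"
      unfolding e by (simp add: Re_exp algebra_simps)
    moreover have "log_coeff n * (x ^ n * (1 - cos (real n * \<theta>))) \<ge> 1 * (x ^ n * (1 - cos (real n * \<theta>)))"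
    \<comment> \<open>\<open>log_coeff 0 = 0\<close> is below 1, but at \<open>n = 0\<close> the
      factor \<open>1 - cos 0\<close> vanishes.\<close>
    proof (cases "n = 0")
      case False
      thus ?thesis using x by (intro mult_right_mono log_coeff_ge_1) auto
    qed simp
    ultimately show ?thesis by (simp add: algebra_simps)
  qed
  have "Re (char_exponent t \<theta>) \<le> Re (1 / (1 - y)) - 1 / (1 - x)"
    by (rule sums_le[OF le sums_Re[OF char_exponent_sums[OF t]] geo])
  also have "Re (1 / (1 - y)) = (1 - x * cos \<theta>) / ((1 - x)\<^sup>2 + 2 * x * v)"
  proof -
    have "Re (1 / (1 - y)) = Re (1 - y) / (cmod (1 - y))\<^sup>2" by (simp add: Re_divide cmod_power2)
    also have "Re (1 - y) = 1 - x * cos \<theta>" by (simp add: y_def Re_exp)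
    also have "(cmod (1 - y))\<^sup>2 = (1 - x * cos \<theta>)\<^sup>2 + (x * sin \<theta>)\<^sup>2"
      by (simp add: cmod_power2 y_def Re_exp Im_exp)
    also have "\<dots> = (1 - x)\<^sup>2 + 2 * x * v"
      by (simp add: v_def power_mult_distrib sin_squared_eq) (simp add: power2_eq_square algebra_simps)
    finally show ?thesis .
  qed
  also have "(1 - x * cos \<theta>) / ((1 - x)\<^sup>2 + 2 * x * v) - 1 / (1 - x) = - (x * (1 + x) * v / ((1 - x) * ((1 - x)\<^sup>2 + 2 * x * v)))"
  proof -
    have D: "(1 - x)\<^sup>2 + 2 * x * v > 0" using x v by (intro add_pos_nonneg) auto
    have "(1 - x * cos \<theta>) * (1 - x) - ((1 - x)\<^sup>2 + 2 * x * v) = - (x * (1 + x) * v)"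
      by (simp add: v_def power2_eq_square algebra_simps)
    thus ?thesis using D x by (simp add: diff_frac_eq mult.commute)
  qed
  finally show ?thesis .
qed

text \<open>For small \<open>u\<close> the bound of the previous lemma is Gaussian in \<open>u\<close>; for the remaining \<open>u\<close> it is
  \<open>exp (- 1 / (4 * t))\<close>, which beats \<open>1 / u\<^sup>2 \<ge> t ^ 3 / pi\<^sup>2\<close>. The constant is \<open>1728 = 27 * 4 ^ 3\<close>.\<close>

lemma norm_exp_char_exponent_le:
  fixes t u :: real
  assumes t: "t > 0" "t \<le> ln 2" and u: "\<bar>t powr (3/2) * u\<bar> \<le> pi"
  shows "exp (Re (char_exponent t (t powr (3/2) * u))) \<le> (1 + 1728 * pi\<^sup>2) / (1 + u\<^sup>2)"
proof -
  define \<theta> where "\<theta> = t powr (3/2) * u"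
  define x where "x = exp (- t)"
  define v where "v = 1 - cos \<theta>"
  define B where "B = x * (1 + x) * v / ((1 - x) * ((1 - x)\<^sup>2 + 2 * x * v))"
  have "exp (- ln 2) \<le> x" unfolding x_def using t by simp
  moreover have "exp (- ln 2) = 1 / (2::real)" by (simp add: exp_minus)
  ultimately have x: "1 / 2 \<le> x" "x < 1" using t by (simp_all add: x_def)
  have x_t: "1 - x \<le> t" using exp_ge_add_one_self[of "- t"] by (simp add: x_def)
  have sq: "(t powr (3/2))\<^sup>2 = t ^ 3"
    using t by (simp add: powr_power powr_numeral)
  have theta_sq: "\<theta>\<^sup>2 = t ^ 3 * u\<^sup>2" by (simp add: \<theta>_def power_mult_distrib sq)
  have v: "v \<ge> t ^ 3 * u\<^sup>2 / 12" "v \<ge> 0"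
    using one_minus_cos_ge[of \<theta>] u theta_sq by (auto simp: v_def \<theta>_def)
  have "pi * pi \<ge> 3 * 3" using pi_approx by (intro mult_mono) auto
  hence pi: "pi\<^sup>2 \<ge> 9" by (simp add: power2_eq_square)
  have "exp (- B) * (1 + u\<^sup>2) \<le> 1 + 1728 * pi\<^sup>2"
  \<comment> \<open>The question is which summand dominates in \<open>(1 - x)^2 + 2 * x * v\<close>.
    If it is the first, \<open>B \<ge> u^2 / 48\<close>, with a factor 12 from
    \<open>one_minus_cos_ge\<close>; otherwise \<open>B \<ge> 1 / (4 * t)\<close>.\<close>
  proof (cases "2 * x * v \<le> (1 - x)\<^sup>2")
    case True
    have "(1 - x) * ((1 - x)\<^sup>2 + 2 * x * v) \<le> (1 - x) * (2 * (1 - x)\<^sup>2)"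
      using True x by (intro mult_left_mono) auto
    also have "\<dots> = 2 * (1 - x) ^ 3" by (simp add: power3_eq_cube power2_eq_square)
    also have "\<dots> \<le> 2 * t ^ 3" using x x_t by (intro mult_left_mono power_mono) auto
    finally have den: "(1 - x) * ((1 - x)\<^sup>2 + 2 * x * v) \<le> 2 * t ^ 3" .
    have den_pos: "(1 - x) * ((1 - x)\<^sup>2 + 2 * x * v) > 0"
      using x v by (intro mult_pos_pos add_pos_nonneg) auto
    have "1 / 2 * 1 * v \<le> x * (1 + x) * v" using x v by (intro mult_right_mono mult_mono) auto
    hence "(1 / 2 * 1 * v) / (2 * t ^ 3) \<le> B"
      unfolding B_def using den den_pos v by (intro frac_le) auto
    moreover have "u\<^sup>2 / 48 \<le> (1 / 2 * 1 * v) / (2 * t ^ 3)"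
      using v(1) t by (simp add: field_simps)
    ultimately have "u\<^sup>2 / 48 \<le> B" by linarith
    hence "1 + u\<^sup>2 / 48 \<le> exp B" using exp_ge_add_one_self[of B] by linarith
    hence "1 + u\<^sup>2 \<le> 48 * exp B" by (simp add: field_simps)
    hence "exp (- B) * (1 + u\<^sup>2) \<le> 48" by (simp add: exp_minus field_simps)
    thus ?thesis using pi by linarith
  next
    case False
    have xv: "x * v > 0" using False v(2) x by (cases "v = 0") auto
    have "2 * x * v = 2 * (x * v)" by simp
    hence "(1 - x)\<^sup>2 + 2 * x * v \<le> 4 * (x * v)" using False by linarith
    hence "(1 - x) * ((1 - x)\<^sup>2 + 2 * x * v) \<le> t * (4 * (x * v))"
      using x x_t t xv v by (intro mult_mono) auto
    moreover have "(1 - x) * ((1 - x)\<^sup>2 + 2 * x * v) > 0"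
      using x v by (intro mult_pos_pos add_pos_nonneg) auto
    moreover have "x * v \<le> x * (1 + x) * v"
    proof -
      have "x * v * 1 \<le> x * v * (1 + x)" using x xv by (intro mult_left_mono) auto
      thus ?thesis by (simp add: mult_ac)
    qed
    ultimately have "x * v / (t * (4 * (x * v))) \<le> B"
      unfolding B_def using xv by (intro frac_le) auto
    moreover have "x \<noteq> 0" "v \<noteq> 0" using xv by auto
    hence "x * v / (t * (4 * (x * v))) = 1 / (4 * t)" by simp
    ultimately have B: "1 / (4 * t) \<le> B" by simp
    define s where "s = 1 / (4 * t)"
    have s: "s > 0" using t by (simp add: s_def)
    have "s ^ 3 / 27 = (s / 3) ^ 3" by (simp add: power_divide)
    also have "\<dots> \<le> exp (s / 3) ^ 3"
    proof (rule power_mono)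
      have "1 + s / 3 \<le> exp (s / 3)" by (rule exp_ge_add_one_self)
      thus "s / 3 \<le> exp (s / 3)" by linarith
    qed (use s in simp)
    also have "\<dots> = exp s" by (simp add: exp_of_nat_mult[symmetric])
    also have "exp s \<le> exp B" using B by (simp add: s_def)
    finally have "1 \<le> 1728 * t ^ 3 * exp B"
      using t by (simp add: s_def field_simps)
    moreover have "t ^ 3 * u\<^sup>2 \<le> pi\<^sup>2"
      using u theta_sq[symmetric] by (simp add: \<theta>_def[symmetric] abs_le_square_iff[symmetric])
    ultimately have "u\<^sup>2 \<le> 1728 * pi\<^sup>2 * exp B"
    proof -
      assume *: "1 \<le> 1728 * t ^ 3 * exp B" "t ^ 3 * u\<^sup>2 \<le> pi\<^sup>2"
      have "u\<^sup>2 * 1 \<le> u\<^sup>2 * (1728 * t ^ 3 * exp B)" by (intro mult_left_mono *) auto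
      also have "\<dots> = (t ^ 3 * u\<^sup>2) * (1728 * exp B)" by simp
      also have "\<dots> \<le> pi\<^sup>2 * (1728 * exp B)" by (intro mult_right_mono *) auto
      finally show ?thesis by (simp add: mult_ac)
    qed
    moreover have "B \<ge> 0" using B s unfolding s_def by linarith
    hence "1 \<le> exp B" using exp_ge_add_one_self[of B] by linarith
    ultimately have "1 + u\<^sup>2 \<le> (1 + 1728 * pi\<^sup>2) * exp B" unfolding distrib_right by linarith
    thus ?thesis by (simp add: exp_minus field_simps)
  qed
  moreover have "Re (char_exponent t \<theta>) \<le> - B"
    unfolding B_def x_def v_def by (rule Re_char_exponent_le[OF t(1)])
  hence "exp (Re (char_exponent t \<theta>)) * (1 + u\<^sup>2) \<le> exp (- B) * (1 + u\<^sup>2)"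
    by (intro mult_right_mono) auto
  ultimately have "exp (Re (char_exponent t \<theta>)) * (1 + u\<^sup>2) \<le> 1 + 1728 * pi\<^sup>2" by (rule order.trans[rotated])
  moreover have "1 + u\<^sup>2 > 0" by (intro add_pos_nonneg) auto
  ultimately show ?thesis
    unfolding \<theta>_def[symmetric] by (subst pos_le_divide_eq)
qed

text \<open>Taylor expansion in each summand: linear and quadratic parts add up to the first two
  moments, the remainders \<open>|n * \<theta>|^3 / 6\<close> to the third.\<close>

lemma char_exponent_approx:
  assumes "t > 0"
  shows "norm (char_exponent t \<theta> - (\<i> * of_real (\<theta> * log_moment 1 t) - of_real (\<theta>\<^sup>2 * log_moment 2 t / 2)))
           \<le> \<bar>\<theta>\<bar> ^ 3 / 6 * log_moment 3 t"
proof -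
  define w where "w = (\<lambda>n. log_coeff n * exp (- (real n * t)))"
  define d where "d = (\<lambda>n. of_real (w n) * (iexp (real n * \<theta>) - 1 - (\<i> * of_real (real n * \<theta>) - of_real ((real n * \<theta>)\<^sup>2 / 2))) :: complex)"
  have "(\<lambda>n. of_real (w n) * (iexp (real n * \<theta>) - 1) -
          (\<i> * of_real \<theta> * of_real (log_coeff n * (real n ^ 1 * exp (- (real n * t)))) -
           of_real (\<theta>\<^sup>2 / 2) * of_real (log_coeff n * (real n ^ 2 * exp (- (real n * t))))))
     sums (char_exponent t \<theta> - (\<i> * of_real \<theta> * of_real (log_moment 1 t) - of_real (\<theta>\<^sup>2 / 2) * of_real (log_moment 2 t)))"
    unfolding w_def by (intro sums_diff sums_mult char_exponent_sums sums_of_real log_moment_sums assms)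
  also have "(\<lambda>n. of_real (w n) * (iexp (real n * \<theta>) - 1) -
          (\<i> * of_real \<theta> * of_real (log_coeff n * (real n ^ 1 * exp (- (real n * t)))) -
           of_real (\<theta>\<^sup>2 / 2) * of_real (log_coeff n * (real n ^ 2 * exp (- (real n * t)))))) = d"
    by (simp add: fun_eq_iff d_def w_def power2_eq_square algebra_simps)
  finally have d: "d sums (char_exponent t \<theta> - (\<i> * of_real (\<theta> * log_moment 1 t) - of_real (\<theta>\<^sup>2 * log_moment 2 t / 2)))"
    by (simp add: mult.assoc)
  have norm_d: "norm (d n) \<le> \<bar>\<theta>\<bar> ^ 3 / 6 * (log_coeff n * (real n ^ 3 * exp (- (real n * t))))" for n
  proof -
    have fact3: "\<bar>real n * \<theta>\<bar> ^ Suc 2 / fact (Suc 2) = real n ^ 3 * \<bar>\<theta>\<bar> ^ 3 / 6"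
      by (simp add: abs_mult power_mult_distrib fact_numeral flip: numeral_3_eq_3 Suc_1)
    have expand: "(\<Sum>k\<le>2. (\<i> * z) ^ k / fact k) = 1 + (\<i> * z - z\<^sup>2 / 2)" for z :: complex
      by (simp add: eval_nat_numeral algebra_simps)
    have "norm (iexp (real n * \<theta>) - (\<Sum>k\<le>2. (\<i> * of_real (real n * \<theta>)) ^ k / fact k)) \<le> \<bar>real n * \<theta>\<bar> ^ Suc 2 / fact (Suc 2)"
      by (rule iexp_approx1)
    also have "(\<Sum>k\<le>2. (\<i> * of_real (real n * \<theta>)) ^ k / fact k) = 1 + (\<i> * of_real (real n * \<theta>) - of_real ((real n * \<theta>)\<^sup>2 / 2) :: complex)"
      using expand[of "of_real (real n * \<theta>)"] by simp
    finally have "norm (iexp (real n * \<theta>) - 1 - (\<i> * of_real (real n * \<theta>) - of_real ((real n * \<theta>)\<^sup>2 / 2))) \<le> real n ^ 3 * \<bar>\<theta>\<bar> ^ 3 / 6"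
      by (simp only: diff_diff_eq fact3)
    hence "w n * norm (iexp (real n * \<theta>) - 1 - (\<i> * of_real (real n * \<theta>) - of_real ((real n * \<theta>)\<^sup>2 / 2))) \<le> w n * (real n ^ 3 * \<bar>\<theta>\<bar> ^ 3 / 6)"
      by (intro mult_left_mono) (auto simp: w_def log_coeff_nonneg)
    moreover have "w n \<ge> 0" by (simp add: w_def log_coeff_nonneg)
    hence "norm (d n) = w n * norm (iexp (real n * \<theta>) - 1 - (\<i> * of_real (real n * \<theta>) - of_real ((real n * \<theta>)\<^sup>2 / 2)))"
      unfolding d_def norm_mult norm_of_real by simp
    moreover have "w n * (real n ^ 3 * \<bar>\<theta>\<bar> ^ 3 / 6) = \<bar>\<theta>\<bar> ^ 3 / 6 * (log_coeff n * (real n ^ 3 * exp (- (real n * t))))"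
      by (simp add: w_def)
    ultimately show ?thesis by (simp only:)
  qed
  have s3: "(\<lambda>n. \<bar>\<theta>\<bar> ^ 3 / 6 * (log_coeff n * (real n ^ 3 * exp (- (real n * t))))) sums (\<bar>\<theta>\<bar> ^ 3 / 6 * log_moment 3 t)"
    by (intro sums_mult log_moment_sums assms)
  have "norm (suminf d) \<le> (\<Sum>n. \<bar>\<theta>\<bar> ^ 3 / 6 * (log_coeff n * (real n ^ 3 * exp (- (real n * t)))))"
    by (rule norm_suminf_le[OF norm_d sums_summable[OF s3]])
  thus ?thesis using d s3 by (simp add: sums_iff)
qed

subsection \<open>The Hardy--Ramanujan asymptotic formula\<close>

lemma gaussian_half_line:
  assumes "a > 0"
  shows "has_bochner_integral lborel (\<lambda>x. indicator {0..} x *\<^sub>R exp (- (a * x\<^sup>2))) (sqrt (pi / a) / 2)"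
proof -
  have "has_bochner_integral lborel (\<lambda>x. indicator {0..} (0 + sqrt a * x) *\<^sub>R exp (- (0 + sqrt a * x)\<^sup>2)) ((sqrt pi / 2) /\<^sub>R \<bar>sqrt a\<bar>)"
    using gaussian_moment_0 assms by (subst (asm) lborel_has_bochner_integral_real_affine_iff[of "sqrt a" _ _ 0]) auto
  moreover have "indicator {0..} (0 + sqrt a * x) *\<^sub>R exp (- (0 + sqrt a * x)\<^sup>2) = indicator {0..} x *\<^sub>R exp (- (a * x\<^sup>2))" for x
    using assms by (auto simp: indicator_def power_mult_distrib zero_le_mult_iff)
  moreover have "(sqrt pi / 2) /\<^sub>R \<bar>sqrt a\<bar> = sqrt (pi / a) / 2"
    using assms by (simp add: real_sqrt_divide divide_simps)
  ultimately show ?thesis by simp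
qed

lemma has_bochner_integral_arctan_half_line:
  "has_bochner_integral lborel (\<lambda>x. indicator {0..} x *\<^sub>R (1 / (1 + x\<^sup>2))) (pi / 2)"
proof (rule has_bochner_integral_nn_integral)
  have "(\<integral>\<^sup>+ x. ennreal (1 / (1 + x\<^sup>2)) * indicator {0..} x \<partial>lborel) = ennreal (pi / 2 - arctan 0)"
    by (rule nn_integral_FTC_atLeast)
       (auto intro!: derivative_eq_intros tendsto_arctan_at_top simp: inverse_eq_divide add_nonneg_eq_0_iff)
  also have "(\<integral>\<^sup>+ x. ennreal (1 / (1 + x\<^sup>2)) * indicator {0..} x \<partial>lborel) = (\<integral>\<^sup>+ x. ennreal (indicator {0..} x *\<^sub>R (1 / (1 + x\<^sup>2))) \<partial>lborel)"
    by (intro nn_integral_cong) (auto simp: indicator_def)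
  finally show "(\<integral>\<^sup>+ x. ennreal (indicator {0..} x *\<^sub>R (1 / (1 + x\<^sup>2))) \<partial>lborel) = ennreal (pi / 2)" by simp
qed auto

lemma integrable_cauchy_density: "integrable lborel (\<lambda>x::real. 1 / (1 + x\<^sup>2))"
  using has_bochner_integral_even_function[OF has_bochner_integral_arctan_half_line]
  by (auto intro: integrable.intros)

lemma borel_measurable_char_exponent [measurable]: "char_exponent t \<in> borel_measurable borel"
  unfolding char_exponent_def[abs_def] by measurable

theorem num_partitions_limit:
  "(\<lambda>n. real (num_partitions n) * real n * exp (- (pi * sqrt (2 * real n / 3)))) \<longlonglongrightarrow> 1 / (4 * sqrt 3)"
proof -
  define t where "t = (\<lambda>n. pi / sqrt (6 * real n))"
  define G where "G = (\<lambda>n u. indicator {-pi..pi} (t n powr (3/2) * u) *\<^sub>R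
        exp (char_exponent (t n) (t n powr (3/2) * u) - \<i> * of_real (real n * (t n powr (3/2) * u))))"
  have t_lim: "filterlim t (at_right 0) sequentially" unfolding t_def by real_asymp
  have "eventually (\<lambda>n. 0 < t n \<and> t n \<le> ln 2 \<and> n > 0) sequentially"
    using t_lim unfolding t_def by (intro eventually_conj) real_asymp+
  then obtain N where N: "\<And>n. n \<ge> N \<Longrightarrow> 0 < t n \<and> t n \<le> ln 2 \<and> n > 0"
    unfolding eventually_sequentially by blast
  have n_eq: "real n = pi\<^sup>2 / (6 * (t n)\<^sup>2)" if "n > 0" for n
    using that by (simp add: t_def power_divide real_sqrt_pow2)

  have pointwise: "(\<lambda>n. G n u) \<longlonglongrightarrow> of_real (exp (- (pi\<^sup>2 / 6 * u\<^sup>2)))" for u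
  proof -
    define \<theta> where "\<theta> = (\<lambda>n. t n powr (3/2) * u)"
    have theta_lim: "\<theta> \<longlonglongrightarrow> 0 * u"
      unfolding \<theta>_def by (intro tendsto_mult_right) (unfold t_def, real_asymp)
    have "eventually (\<lambda>n. \<bar>\<theta> n\<bar> < pi) sequentially"
      using tendstoD[OF theta_lim, of pi] by (simp add: dist_real_def)
    hence ind: "eventually (\<lambda>n. indicator {-pi..pi} (\<theta> n) = (1::real)) sequentially"
      by eventually_elim (auto simp: indicator_def abs_less_iff)
    have E: "(\<lambda>n. char_exponent (t n) (\<theta> n) - (\<i> * of_real (\<theta> n * log_moment 1 (t n)) - of_real ((\<theta> n)\<^sup>2 * log_moment 2 (t n) / 2))) \<longlonglongrightarrow> 0"
    proof (rule Lim_null_comparison)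
      show "eventually (\<lambda>n. norm (char_exponent (t n) (\<theta> n) - (\<i> * of_real (\<theta> n * log_moment 1 (t n)) - of_real ((\<theta> n)\<^sup>2 * log_moment 2 (t n) / 2)))
          \<le> \<bar>u\<bar> ^ 3 / 6 * (t n powr (9/2) * log_moment 3 (t n))) sequentially"
        using eventually_ge_at_top[of N]
      proof eventually_elim
        case (elim n)
        have t: "t n > 0" using N elim by blast
        have "\<bar>\<theta> n\<bar> ^ 3 = \<bar>u\<bar> ^ 3 * t n powr (9/2)"
          using t by (simp add: \<theta>_def abs_mult power_mult_distrib powr_power)
        thus ?case using char_exponent_approx[OF t, of "\<theta> n"] by (simp add: mult_ac)
      qed
      have "(\<lambda>n. \<bar>u\<bar> ^ 3 / 6 * (t n powr (9/2) * log_moment 3 (t n))) \<longlonglongrightarrow> \<bar>u\<bar> ^ 3 / 6 * 0"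
        by (intro tendsto_mult tendsto_const filterlim_compose[OF log_moment_3_limit t_lim])
      thus "(\<lambda>n. \<bar>u\<bar> ^ 3 / 6 * (t n powr (9/2) * log_moment 3 (t n))) \<longlonglongrightarrow> 0" by simp
    qed
    \<comment> \<open>The linear phase that is left after subtracting \<open>n * \<theta> n\<close>,
      because \<open>n\<close> is exactly the leading term \<open>pi^2 / (6 * (t n)^2)\<close> of
      the mean.\<close>
    have M1: "(\<lambda>n. \<i> * of_real (u * (t n powr (3/2) * (log_moment 1 (t n) - pi\<^sup>2 / (6 * (t n)\<^sup>2))))) \<longlonglongrightarrow> \<i> * of_real (u * 0)"
      by (intro tendsto_mult tendsto_const tendsto_of_real filterlim_compose[OF log_moment_1_limit t_lim])
    have M2: "(\<lambda>n. of_real (u\<^sup>2 / 2 * (t n ^ 3 * log_moment 2 (t n)))) \<longlonglongrightarrow> (of_real (u\<^sup>2 / 2 * (pi\<^sup>2 / 3)) :: complex)"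
      by (intro tendsto_mult tendsto_const tendsto_of_real filterlim_compose[OF log_moment_2_limit t_lim])
    have "(\<lambda>n. exp (char_exponent (t n) (\<theta> n) - (\<i> * of_real (\<theta> n * log_moment 1 (t n)) - of_real ((\<theta> n)\<^sup>2 * log_moment 2 (t n) / 2))
        + \<i> * of_real (u * (t n powr (3/2) * (log_moment 1 (t n) - pi\<^sup>2 / (6 * (t n)\<^sup>2))))
        - of_real (u\<^sup>2 / 2 * (t n ^ 3 * log_moment 2 (t n)))))
       \<longlonglongrightarrow> exp (0 + \<i> * of_real (u * 0) - of_real (u\<^sup>2 / 2 * (pi\<^sup>2 / 3)))"
      by (intro tendsto_intros E M1 M2)
    also have "exp (0 + \<i> * of_real (u * 0) - of_real (u\<^sup>2 / 2 * (pi\<^sup>2 / 3))) = (of_real (exp (- (pi\<^sup>2 / 6 * u\<^sup>2))) :: complex)"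
      by (simp add: exp_of_real[symmetric] mult.commute)
    finally show ?thesis
    proof (rule Lim_transform_eventually)
      show "eventually (\<lambda>n. exp (char_exponent (t n) (\<theta> n) - (\<i> * of_real (\<theta> n * log_moment 1 (t n)) - of_real ((\<theta> n)\<^sup>2 * log_moment 2 (t n) / 2))
        + \<i> * of_real (u * (t n powr (3/2) * (log_moment 1 (t n) - pi\<^sup>2 / (6 * (t n)\<^sup>2))))
        - of_real (u\<^sup>2 / 2 * (t n ^ 3 * log_moment 2 (t n)))) = G n u) sequentially"
        using eventually_ge_at_top[of N] ind
      proof eventually_elim
        case (elim n)
        have t: "t n > 0" "n > 0" using N elim by blast+
        have "(\<theta> n)\<^sup>2 = u\<^sup>2 * t n ^ 3"
          using t by (simp add: \<theta>_def power_mult_distrib powr_power powr_numeral)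
        hence 2: "(\<theta> n)\<^sup>2 * log_moment 2 (t n) / 2 = u\<^sup>2 / 2 * (t n ^ 3 * log_moment 2 (t n))" by simp
        have 1: "u * (t n powr (3/2) * (log_moment 1 (t n) - pi\<^sup>2 / (6 * (t n)\<^sup>2))) = \<theta> n * log_moment 1 (t n) - real n * \<theta> n"
          unfolding n_eq[OF t(2), symmetric] by (simp add: \<theta>_def algebra_simps)
        have G: "G n u = indicator {-pi..pi} (\<theta> n) *\<^sub>R exp (char_exponent (t n) (\<theta> n) - \<i> * of_real (real n * \<theta> n))"
          by (simp add: G_def \<theta>_def)
        show ?case
          unfolding G elim(2) 1 2 by (simp add: algebra_simps)
      qed
    qed
  qed

  have bound: "norm (G n u) \<le> (1 + 1728 * pi\<^sup>2) * (1 / (1 + u\<^sup>2))" if "n \<ge> N" for n u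
  proof (cases "\<bar>t n powr (3/2) * u\<bar> \<le> pi")
    case True
    have "norm (G n u) = exp (Re (char_exponent (t n) (t n powr (3/2) * u)))"
      using True by (simp add: G_def indicator_def abs_le_iff)
    thus ?thesis
      using norm_exp_char_exponent_le[OF _ _ True] N[OF that] by simp
  next
    case False
    hence "G n u = 0" by (auto simp: G_def indicator_def abs_le_iff)
    thus ?thesis by simp
  qed
  \<comment> \<open>The shift by \<open>N\<close> is there because dominated convergence asks for
    the majorant at every index.\<close>
  have "(\<lambda>n. \<integral>u. G (n + N) u \<partial>lborel) \<longlonglongrightarrow> (\<integral>u. of_real (exp (- (pi\<^sup>2 / 6 * u\<^sup>2))) \<partial>lborel)"
  proof (rule integral_dominated_convergence)
    show "integrable lborel (\<lambda>u. (1 + 1728 * pi\<^sup>2) * (1 / (1 + u\<^sup>2)))"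
      by (intro integrable_mult_right integrable_cauchy_density)
    show "AE u in lborel. (\<lambda>n. G (n + N) u) \<longlonglongrightarrow> of_real (exp (- (pi\<^sup>2 / 6 * u\<^sup>2)))"
      using LIMSEQ_ignore_initial_segment[OF pointwise] by simp
    show "AE u in lborel. norm (G (n + N) u) \<le> (1 + 1728 * pi\<^sup>2) * (1 / (1 + u\<^sup>2))" for n
      using bound[of "n + N"] by simp
    show "G (n + N) \<in> borel_measurable lborel" for n
      unfolding G_def by measurable
  qed simp
  moreover have "has_bochner_integral lborel (\<lambda>u. exp (- (pi\<^sup>2 / 6 * u\<^sup>2))) (2 *\<^sub>R (sqrt (pi / (pi\<^sup>2 / 6)) / 2))"
    by (rule has_bochner_integral_even_function[OF gaussian_half_line]) auto
  hence "has_bochner_integral lborel (\<lambda>u. exp (- (pi\<^sup>2 / 6 * u\<^sup>2))) (sqrt (6 / pi))"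
    by (simp add: power2_eq_square)
  hence "(\<integral>u. of_real (exp (- (pi\<^sup>2 / 6 * u\<^sup>2))) \<partial>lborel) = (of_real (sqrt (6 / pi)) :: complex)"
    by (simp only: integral_complex_of_real has_bochner_integral_integral_eq)
  ultimately have "(\<lambda>n. \<integral>u. G (n + N) u \<partial>lborel) \<longlonglongrightarrow> of_real (sqrt (6 / pi))"
    by (simp only:)
  hence G_lim: "(\<lambda>n. \<integral>u. G n u \<partial>lborel) \<longlonglongrightarrow> of_real (sqrt (6 / pi))"
    by (rule LIMSEQ_offset)
  have "(\<lambda>n. of_real (2 * pi * real (num_partitions n) * exp (- (real n * t n)) * exp (- log_moment 0 (t n)) / t n powr (3/2))) \<longlonglongrightarrow> (of_real (sqrt (6 / pi)) :: complex)"
    using G_lim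
  proof (rule Lim_transform_eventually)
    show "eventually (\<lambda>n. (\<integral>u. G n u \<partial>lborel) = of_real (2 * pi * real (num_partitions n) * exp (- (real n * t n)) * exp (- log_moment 0 (t n)) / t n powr (3/2))) sequentially"
      using eventually_ge_at_top[of N]
    proof eventually_elim
      case (elim n)
      hence "t n > 0" using N by blast
      thus ?case
        unfolding G_def by (rule num_partitions_scaled_integral[symmetric])
    qed
  qed
  hence 1: "(\<lambda>n. 2 * pi * real (num_partitions n) * exp (- (real n * t n)) * exp (- log_moment 0 (t n)) / t n powr (3/2)) \<longlonglongrightarrow> sqrt (6 / pi)"
    by (rule tendsto_of_real_iff[THEN iffD1])
  have 2: "(\<lambda>n. exp (log_moment 0 (t n) - pi\<^sup>2 / (6 * t n) - ln (t n) / 2)) \<longlonglongrightarrow> exp (- (ln (2 * pi) / 2))"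
    by (intro tendsto_exp filterlim_compose[OF log_moment_0_asymp t_lim])
  have "exp (ln (2 * pi) / 2) = sqrt (2 * pi)"
    by (simp add: powr_half_sqrt[symmetric] powr_def)
  hence c: "sqrt (6 / pi) * exp (- (ln (2 * pi) / 2)) * (pi / 12) = 1 / (4 * sqrt 3)"
  proof -
    assume *: "exp (ln (2 * pi) / 2) = sqrt (2 * pi)"
    define a b p where "a = sqrt 2" and "b = sqrt (3::real)" and "p = sqrt pi"
    have nz: "a \<noteq> 0" "b \<noteq> 0" "p \<noteq> 0" by (simp_all add: a_def b_def p_def)
    have 1: "sqrt (6 / pi) = a * b / p"
      by (simp add: a_def b_def p_def real_sqrt_divide flip: real_sqrt_mult)
    have 2: "exp (- (ln (2 * pi) / 2)) = 1 / (a * p)"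
      by (simp add: exp_minus * a_def p_def real_sqrt_mult inverse_eq_divide)
    have 3: "pi = p * p" "b * b = 3" by (simp_all add: p_def b_def)
    have "sqrt (6 / pi) * exp (- (ln (2 * pi) / 2)) * (pi / 12) = (a * b / p) * (1 / (a * p)) * (p * p / 12)"
      unfolding 1 2 using 3(1) by simp
    also have "\<dots> = b / 12" using nz by simp
    also have "\<dots> = 1 / (4 * b)" using nz 3(2) by (simp add: field_simps)
    finally show ?thesis by (simp add: b_def)
  qed
  \<comment> \<open>The second factor replaces \<open>L\<close> by its expansion. The factor
    \<open>pi / 12\<close> turns \<open>2 * pi\<close> into \<open>pi^2 / 6\<close>, which together
    with \<open>1 / (t n)^2\<close> gives \<open>n\<close>.\<close>
  have "(\<lambda>n. (2 * pi * real (num_partitions n) * exp (- (real n * t n)) * exp (- log_moment 0 (t n)) / t n powr (3/2)) *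
       exp (log_moment 0 (t n) - pi\<^sup>2 / (6 * t n) - ln (t n) / 2) * (pi / 12)) \<longlonglongrightarrow> sqrt (6 / pi) * exp (- (ln (2 * pi) / 2)) * (pi / 12)"
    by (intro tendsto_mult 1 2 tendsto_const)
  thus ?thesis
    unfolding c
  proof (rule Lim_transform_eventually)
    show "eventually (\<lambda>n. (2 * pi * real (num_partitions n) * exp (- (real n * t n)) * exp (- log_moment 0 (t n)) / t n powr (3/2)) *
       exp (log_moment 0 (t n) - pi\<^sup>2 / (6 * t n) - ln (t n) / 2) * (pi / 12) =
       real (num_partitions n) * real n * exp (- (pi * sqrt (2 * real n / 3)))) sequentially"
      using eventually_ge_at_top[of N]
    proof eventually_elim
      case (elim n)
      have t: "t n > 0" "n > 0" using N elim by blast+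
      have nt: "real n * t n = pi\<^sup>2 / (6 * t n)"
        using t(1) by (subst n_eq[OF t(2)]) (simp add: power2_eq_square)
      \<comment> \<open>One half of the exponent comes from \<open>n * t n\<close>, the other from
        the leading term of \<open>L\<close>.\<close>
      have twice: "pi\<^sup>2 / (6 * t n) + pi\<^sup>2 / (6 * t n) = pi * sqrt (2 * real n / 3)"
      proof -
        have "sqrt (2 * real n / 3) = sqrt (6 * real n) / 3"
          by (rule real_sqrt_unique) (simp_all add: power_divide)
        thus ?thesis using t by (simp add: t_def power2_eq_square field_simps)
      qed
      have "exp (- (real n * t n)) * exp (- log_moment 0 (t n)) * exp (log_moment 0 (t n) - pi\<^sup>2 / (6 * t n) - ln (t n) / 2)
           = exp (- (pi\<^sup>2 / (6 * t n) + pi\<^sup>2 / (6 * t n)) + - (ln (t n) / 2))"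
        unfolding nt mult_exp_exp by (rule arg_cong[where f = exp]) linarith
      also have "\<dots> = exp (- (pi * sqrt (2 * real n / 3))) * exp (- (ln (t n) / 2))"
        unfolding twice exp_add ..
      also have "exp (- (ln (t n) / 2)) = t n powr (- (1/2))" using t by (simp add: powr_def)
      finally have e: "exp (- (real n * t n)) * exp (- log_moment 0 (t n)) * exp (log_moment 0 (t n) - pi\<^sup>2 / (6 * t n) - ln (t n) / 2)
           = exp (- (pi * sqrt (2 * real n / 3))) * t n powr (- (1/2))" .
      have "t n powr (- (1/2)) / t n powr (3/2) = t n powr (-2)"
        by (subst powr_diff[symmetric]) simp
      hence p: "t n powr (- (1/2)) / t n powr (3/2) = 1 / (t n)\<^sup>2"
        using t by (simp add: powr_minus powr_numeral inverse_eq_divide)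
      have "(2 * pi * real (num_partitions n) * exp (- (real n * t n)) * exp (- log_moment 0 (t n)) / t n powr (3/2)) *
         exp (log_moment 0 (t n) - pi\<^sup>2 / (6 * t n) - ln (t n) / 2) * (pi / 12)
        = 2 * pi * real (num_partitions n) * (exp (- (real n * t n)) * exp (- log_moment 0 (t n)) * exp (log_moment 0 (t n) - pi\<^sup>2 / (6 * t n) - ln (t n) / 2)) / t n powr (3/2) * (pi / 12)"
        by simp
      also have "\<dots> = real (num_partitions n) * exp (- (pi * sqrt (2 * real n / 3))) * (pi\<^sup>2 / 6 * (t n powr (- (1/2)) / t n powr (3/2)))"
        unfolding e by (simp add: power2_eq_square)
      also have "pi\<^sup>2 / 6 * (t n powr (- (1/2)) / t n powr (3/2)) = real n"
        unfolding p using n_eq[OF t(2)] by simp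
      finally show ?case by simp
    qed
  qed
qed

subsection \<open>Summing over the mex\<close>

lemma num_partitions_pos: "num_partitions n > 0"
  using num_partitions_mono[of 0 n] num_partitions_0 by simp

text \<open>In the exponent \<open>sqrt (n - s) - sqrt n = - s / (sqrt n + sqrt (n - s))\<close>
  tends to \<open>- y / 2\<close>, while the factors \<open>1 / n\<close> and
  \<open>1 / (n - s)\<close> cancel in the limit, as \<open>s\<close> is of smaller order than
  \<open>n\<close>.\<close>

lemma num_partitions_ratio_limit:
  fixes s :: "nat \<Rightarrow> nat" and y :: real
  assumes s_le: "eventually (\<lambda>n. s n \<le> n) sequentially"
    and s_lim: "(\<lambda>n. real (s n) / sqrt (real n)) \<longlonglongrightarrow> y"
  shows "(\<lambda>n. real (num_partitions (n - s n)) / real (num_partitions n)) \<longlonglongrightarrow> exp (- (pi * sqrt (2 / 3) * y / 2))"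
proof -
  define f where "f = (\<lambda>n. real (num_partitions n) * real n * exp (- (pi * sqrt (2 * real n / 3))))"
  define N where "N = (\<lambda>n. n - s n)"
  have f: "f \<longlonglongrightarrow> 1 / (4 * sqrt 3)"
    unfolding f_def by (rule num_partitions_limit)
  have "(\<lambda>n. 1 - real (s n) / sqrt (real n) * (1 / sqrt (real n))) \<longlonglongrightarrow> 1 - y * 0"
    by (intro tendsto_intros s_lim) real_asymp
  hence quot: "(\<lambda>n. real (N n) / real n) \<longlonglongrightarrow> 1"
  proof (subst (asm) mult_zero_right, subst (asm) diff_zero, elim Lim_transform_eventually)
    show "eventually (\<lambda>n. 1 - real (s n) / sqrt (real n) * (1 / sqrt (real n)) = real (N n) / real n) sequentially"
      using s_le eventually_gt_at_top[of 0]
      by eventually_elim (simp add: N_def of_nat_diff field_simps)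
  qed
  have "filterlim (\<lambda>n. real (N n) / real n * real n) at_top sequentially"
    by (rule filterlim_tendsto_pos_mult_at_top[OF quot]) (auto intro: filterlim_real_sequentially)
  moreover have "eventually (\<lambda>n. real (N n) / real n * real n = real (N n)) sequentially"
    using eventually_gt_at_top[of 0] by eventually_elim simp
  ultimately have "filterlim (\<lambda>n. real (N n)) at_top sequentially"
    by (simp add: filterlim_cong)
  hence N_lim: "filterlim N at_top sequentially"
    by (subst filterlim_sequentially_iff_filterlim_real)
  have N_pos: "eventually (\<lambda>n. N n > 0) sequentially"
    using N_lim eventually_gt_at_top[of 0] by (rule filterlim_iff[THEN iffD1, rule_format])
  have "(\<lambda>n. (f (N n) / f n) * (1 / (real (N n) / real n)) *
            exp (- (pi * sqrt (2 / 3) * (real (s n) / sqrt (real n)) / (1 + sqrt (real (N n) / real n)))))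
        \<longlonglongrightarrow> (1 / (4 * sqrt 3)) / (1 / (4 * sqrt 3)) * (1 / 1) * exp (- (pi * sqrt (2 / 3) * y / (1 + sqrt 1)))"
    by (intro tendsto_intros f filterlim_compose[OF f N_lim] quot s_lim) auto
  also have "(1 / (4 * sqrt 3)) / (1 / (4 * sqrt 3)) * (1 / 1) * exp (- (pi * sqrt (2 / 3) * y / (1 + sqrt 1))) = exp (- (pi * sqrt (2 / 3) * y / 2))"
    by simp
  finally show ?thesis
  proof (rule Lim_transform_eventually)
    show "eventually (\<lambda>n. (f (N n) / f n) * (1 / (real (N n) / real n)) *
            exp (- (pi * sqrt (2 / 3) * (real (s n) / sqrt (real n)) / (1 + sqrt (real (N n) / real n)))) =
          real (num_partitions (n - s n)) / real (num_partitions n)) sequentially"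
      using s_le N_pos eventually_gt_at_top[of 0]
    proof eventually_elim
      case (elim n)
      define a b where "a = sqrt (real (N n))" and "b = sqrt (real n)"
      have ab: "a > 0" "b > 0" "a * a = real (N n)" "b * b = real n" using elim by (auto simp: a_def b_def)
      have "real (s n) = b * b - a * a" unfolding ab using elim by (simp add: N_def of_nat_diff)
      hence "real (s n) = (b - a) * (b + a)" by (simp add: algebra_simps)
      hence "real (s n) / b / (1 + a / b) = b - a"
        using ab by (simp add: field_simps)
      moreover have q: "sqrt (real (N n) / real n) = a / b" by (simp add: a_def b_def real_sqrt_divide)
      have "pi * sqrt (2 / 3) * (real (s n) / sqrt (real n)) / (1 + sqrt (real (N n) / real n)) = pi * sqrt (2 / 3) * (real (s n) / b / (1 + a / b))"
        unfolding q b_def[symmetric] by (simp only: times_divide_eq_right)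
      ultimately have "pi * sqrt (2 / 3) * (real (s n) / sqrt (real n)) / (1 + sqrt (real (N n) / real n)) = pi * sqrt (2 / 3) * (b - a)"
        by (simp only:)
      moreover have "f k = real (num_partitions k) * real k * exp (- (pi * sqrt (2 / 3) * sqrt (real k)))" for k
      proof -
        have "sqrt (2 * real k / 3) = sqrt (2 / 3) * sqrt (real k)" by (simp flip: real_sqrt_mult)
        thus ?thesis by (simp add: f_def mult.assoc)
      qed
      moreover have "exp (- (pi * sqrt (2 / 3) * (b - a))) = exp (- (pi * sqrt (2 / 3) * b)) / exp (- (pi * sqrt (2 / 3) * a))"
        unfolding exp_diff[symmetric] by (rule arg_cong[where f = exp]) (simp add: algebra_simps)
      ultimately have "(f (N n) / f n) * (1 / (real (N n) / real n)) *
            exp (- (pi * sqrt (2 / 3) * (real (s n) / sqrt (real n)) / (1 + sqrt (real (N n) / real n)))) =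
          (real (num_partitions (N n)) * real (N n) * exp (- (pi * sqrt (2 / 3) * a))) / (real (num_partitions n) * real n * exp (- (pi * sqrt (2 / 3) * b))) *
            (1 / (real (N n) / real n)) * (exp (- (pi * sqrt (2 / 3) * b)) / exp (- (pi * sqrt (2 / 3) * a)))"
        by (simp only: a_def b_def)
      also have "\<dots> = real (num_partitions (N n)) / real (num_partitions n)"
        using elim num_partitions_pos[of n] by (simp del: exp_minus)
      finally show ?case by (simp only: N_def)
    qed
  qed
qed

text \<open>Provides the majorant for summing over the mex. The exponential decay in
  \<open>\<sigma> = s / sqrt n\<close> pays for the polynomial factor lost when \<open>n - s\<close>
  is small and still leaves a factor \<open>1 / (1 + \<sigma>)\<close>.\<close>

lemma num_partitions_ratio_bound:
  "\<exists>K>0. \<forall>n>0. \<forall>s\<le>n. real (num_partitions (n - s)) / real (num_partitions n) \<le> K / (1 + real s / sqrt (real n))"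
proof -
  \<comment> \<open>With \<open>n + 1\<close> in place of \<open>n\<close> the sequence is positive
    also at 0, so that \<open>g\<close> and its inverse are bounded over all indices;
    \<open>n - s\<close> may be 0.\<close>
  define g where "g = (\<lambda>n. real (num_partitions n) * (real n + 1) * exp (- (pi * sqrt (2 * real n / 3))))"
  have g_pos: "g n > 0" for n
    using num_partitions_pos[of n] by (simp add: g_def)
  have "(\<lambda>n. real (num_partitions n) * real n * exp (- (pi * sqrt (2 * real n / 3))) * ((real n + 1) / real n)) \<longlonglongrightarrow> 1 / (4 * sqrt 3) * 1"
    by (intro tendsto_mult num_partitions_limit) real_asymp
  hence g_lim: "g \<longlonglongrightarrow> 1 / (4 * sqrt 3) * 1"
  proof (rule Lim_transform_eventually)
    show "eventually (\<lambda>n. real (num_partitions n) * real n * exp (- (pi * sqrt (2 * real n / 3))) * ((real n + 1) / real n) = g n) sequentially"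
      using eventually_gt_at_top[of 0] by eventually_elim (simp add: g_def)
  qed
  hence "Bseq g" by (blast intro: convergent_imp_Bseq convergentI)
  then obtain b where b: "b > 0" "\<And>n. g n \<le> b"
    unfolding Bseq_def using abs_le_D1 by (metis real_norm_def)
  have "(\<lambda>n. inverse (g n)) \<longlonglongrightarrow> inverse (1 / (4 * sqrt 3) * 1)"
    by (intro tendsto_inverse g_lim) simp
  hence "Bseq (\<lambda>n. inverse (g n))" by (blast intro: convergent_imp_Bseq convergentI)
  then obtain c where c: "c > 0" "\<And>n. inverse (g n) \<le> c"
    unfolding Bseq_def using abs_le_D1 by (metis real_norm_def)
  define C where "C = pi * sqrt (2 / 3)"
  \<comment> \<open>So that the root bound \<open>- \<sigma> / 2\<close>, multiplied by
    \<open>C\<close>, gives at least the decay \<open>exp (- \<sigma>)\<close>.\<close>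
  have C: "C \<ge> 2"
  proof -
    have "sqrt (2 / 3) \<ge> 2 / 3" by (rule real_le_rsqrt) (simp add: power2_eq_square)
    hence "C \<ge> 3 * (2 / 3)" unfolding C_def using pi_gt3 by (intro mult_mono) auto
    thus ?thesis by simp
  qed
  have p_eq: "real (num_partitions n) = g n / (real n + 1) * exp (C * sqrt (real n))" for n
  proof -
    have "sqrt (2 * real n / 3) = sqrt (2 / 3) * sqrt (real n)" by (simp flip: real_sqrt_mult)
    moreover have "exp (- x) * exp x = 1" for x :: real by (simp add: mult_exp_exp)
    ultimately show ?thesis by (simp add: g_def C_def mult.assoc)
  qed
  show ?thesis
  proof (intro exI[of _ "b * c * 108"] conjI allI impI)
    show "b * c * 108 > 0" using b c by simp
    fix n s :: nat assume n: "n > 0" and s: "s \<le> n"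
    define \<sigma> where "\<sigma> = real s / sqrt (real n)"
    have \<sigma>: "\<sigma> \<ge> 0" by (simp add: \<sigma>_def)
    have s_eq: "real s = \<sigma> * sqrt (real n)" using n by (simp add: \<sigma>_def)
    have root: "sqrt (real (n - s)) - sqrt (real n) \<le> - (\<sigma> / 2)"
    proof -
      have "sqrt (real (n - s)) \<le> sqrt (real n) - \<sigma> / 2"
      proof (rule real_le_lsqrt)
        have "\<sigma> \<le> sqrt (real n)"
          using s n by (simp add: \<sigma>_def divide_le_eq)
        thus "0 \<le> sqrt (real n) - \<sigma> / 2" using \<sigma> by linarith
        have "real (n - s) = sqrt (real n) ^ 2 - \<sigma> * sqrt (real n)"
          using s s_eq by (simp add: of_nat_diff)
        also have "\<dots> \<le> (sqrt (real n) - \<sigma> / 2)\<^sup>2"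
          by (simp add: power2_diff power_divide field_simps)
        finally show "real (n - s) \<le> (sqrt (real n) - \<sigma> / 2)\<^sup>2" .
      qed
      thus ?thesis by simp
    qed
    \<comment> \<open>Two powers absorb the polynomial factor below, the third is the decay claimed;
      \<open>108 = 4 * 27\<close>.\<close>
    have cube: "(1 + \<sigma>) ^ 3 \<le> 27 * exp \<sigma>"
    proof -
      have "1 + \<sigma> / 3 \<le> exp (\<sigma> / 3)" by (rule exp_ge_add_one_self)
      hence "(1 + \<sigma>) / 3 \<le> exp (\<sigma> / 3)" unfolding add_divide_distrib by linarith
      hence "((1 + \<sigma>) / 3) ^ 3 \<le> exp (\<sigma> / 3) ^ 3" using \<sigma> by (intro power_mono) auto
      also have "exp (\<sigma> / 3) ^ 3 = exp \<sigma>" by (simp add: exp_of_nat_mult[symmetric])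
      finally show ?thesis by (simp add: power_divide)
    qed
    \<comment> \<open>The quotient is large only if \<open>s\<close> exceeds \<open>n / 2\<close>,
      and then \<open>sqrt n \<le> 2 * \<sigma>\<close>.\<close>
    have poly: "(real n + 1) / (real (n - s) + 1) \<le> 4 * (1 + \<sigma>) ^ 2"
    proof (cases "2 * s \<le> n")
      case True
      have "(real n + 1) / (real (n - s) + 1) \<le> 2"
        using True by (simp add: divide_le_eq of_nat_diff)
      also have "\<dots> \<le> 4 * (1 + \<sigma>) ^ 2" using \<sigma> one_le_power[of "1 + \<sigma>" 2] by linarith
      finally show ?thesis .
    next
      case False
      have "sqrt (real n) * sqrt (real n) = real n" by simp
      hence "sqrt (real n) * sqrt (real n) \<le> 2 * \<sigma> * sqrt (real n)" using False s_eq by linarith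
      hence "sqrt (real n) \<le> 2 * \<sigma>" by (rule mult_right_le_imp_le) (use n in simp)
      hence "sqrt (real n) ^ 2 \<le> (2 * \<sigma>) ^ 2" by (intro power_mono) auto
      hence "real n \<le> 4 * \<sigma> ^ 2" by (simp add: power_mult_distrib)
      moreover have "(real n + 1) / (real (n - s) + 1) \<le> real n + 1"
        by (simp add: divide_le_eq mult_left_mono)
      ultimately show ?thesis using \<sigma> by (simp add: power2_sum algebra_simps)
    qed
    have "real (num_partitions (n - s)) / real (num_partitions n) =
       g (n - s) * inverse (g n) * ((real n + 1) / (real (n - s) + 1)) * exp (C * (sqrt (real (n - s)) - sqrt (real n)))"
      unfolding p_eq by (simp add: right_diff_distrib exp_diff field_simps)
    also have "\<dots> \<le> b * c * (4 * (1 + \<sigma>) ^ 2) * exp (- \<sigma>)"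
    proof (intro mult_mono b c poly)
      have "C * (sqrt (real (n - s)) - sqrt (real n)) \<le> C * (- (\<sigma> / 2))"
        using C by (intro mult_left_mono root) auto
      also have "\<dots> \<le> - \<sigma>" using C \<sigma> mult_right_mono[of 2 C "\<sigma> / 2"] by simp
      finally show "exp (C * (sqrt (real (n - s)) - sqrt (real n))) \<le> exp (- \<sigma>)" by simp
    qed (use g_pos[THEN less_imp_le] b c in auto)
    also have "\<dots> \<le> b * c * 108 / (1 + \<sigma>)"
    proof -
      have "4 * (1 + \<sigma>) ^ 2 * (1 + \<sigma>) = 4 * (1 + \<sigma>) ^ 3" by (simp add: power2_eq_square power3_eq_cube)
      also have "\<dots> \<le> 108 * exp \<sigma>" using cube by simp
      finally have "4 * (1 + \<sigma>) ^ 2 * exp (- \<sigma>) \<le> 108 / (1 + \<sigma>)"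
        using \<sigma> by (simp add: exp_minus field_simps)
      hence "b * c * (4 * (1 + \<sigma>) ^ 2 * exp (- \<sigma>)) \<le> b * c * (108 / (1 + \<sigma>))"
        using b c by (intro mult_left_mono) auto
      thus ?thesis by (simp add: mult.assoc)
    qed
    finally show "real (num_partitions (n - s)) / real (num_partitions n) \<le> b * c * 108 / (1 + real s / sqrt (real n))"
      by (simp only: \<sigma>_def)
  qed
qed

section \<open>From the sum over the mex to a Gaussian integral\<close>

lemma real_sum_upto: "real (\<Sum>{1..j}) = real j * (real j + 1) / 2"
  by (induction j) (auto simp: field_simps)

text \<open>As the integral of a step function in \<open>x = j / n powr (1/4)\<close>, the sum
  becomes accessible to dominated convergence. The exponent \<open>1/4\<close> makes the triangular
  number of \<open>j\<close> comparable to \<open>sqrt n\<close>, the scale on which the partition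
  ratios vary.\<close>

lemma sum_mex_tail_integral:
  assumes "r \<ge> 1" "n > 0"
  shows "has_bochner_integral lborel (\<lambda>x. indicator {0..} x * real (mex_tail r n (nat \<lfloor>x * real n powr (1/4)\<rfloor>)))
           ((\<Sum>j\<le>n. real (mex_tail r n j)) / real n powr (1/4))"
proof -
  define m where "m = real n powr (1/4)"
  have m: "m > 0" using assms by (simp add: m_def)
  have "has_bochner_integral lborel (\<lambda>x. \<Sum>j\<le>n. real (mex_tail r n j) * indicator {real j / m..<(real j + 1) / m} x)
          (\<Sum>j\<le>n. real (mex_tail r n j) * ((real j + 1) / m - real j / m))"
  proof (intro has_bochner_integral_sum has_bochner_integral_mult_right)
    fix j :: nat
    have "real j / m \<le> (real j + 1) / m" using m by (simp add: divide_right_mono)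
    hence "measure lborel {real j / m..<(real j + 1) / m} = (real j + 1) / m - real j / m"
      "emeasure lborel {real j / m..<(real j + 1) / m} < \<infinity>"
      by (simp_all add: measure_def)
    thus "has_bochner_integral lborel (indicator {real j / m..<(real j + 1) / m}) ((real j + 1) / m - real j / m)"
      using has_bochner_integral_real_indicator[of "{real j / m..<(real j + 1) / m}" lborel] by simp
  qed
  also have "(\<Sum>j\<le>n. real (mex_tail r n j) * ((real j + 1) / m - real j / m)) = (\<Sum>j\<le>n. real (mex_tail r n j)) / m"
    by (simp add: sum_divide_distrib diff_divide_distrib[symmetric])
  also have "(\<lambda>x. \<Sum>j\<le>n. real (mex_tail r n j) * indicator {real j / m..<(real j + 1) / m} x) =
             (\<lambda>x. indicator {0..} x * real (mex_tail r n (nat \<lfloor>x * m\<rfloor>)))"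
  proof
    fix x :: real
    have iff: "x \<in> {real j / m..<(real j + 1) / m} \<longleftrightarrow> x \<ge> 0 \<and> j = nat \<lfloor>x * m\<rfloor>" for j
    proof -
      have "x \<in> {real j / m..<(real j + 1) / m} \<longleftrightarrow> real j \<le> x * m \<and> x * m < real j + 1"
        using m by (simp add: divide_le_eq less_divide_eq)
      also have "\<dots> \<longleftrightarrow> \<lfloor>x * m\<rfloor> = int j" by (auto simp: floor_eq_iff)
      also have "\<dots> \<longleftrightarrow> x \<ge> 0 \<and> j = nat \<lfloor>x * m\<rfloor>"
      proof
        assume *: "\<lfloor>x * m\<rfloor> = int j"
        hence "0 \<le> x * m" by (metis of_nat_0_le_iff zero_le_floor)
        thus "x \<ge> 0 \<and> j = nat \<lfloor>x * m\<rfloor>" using m * by (simp add: zero_le_mult_iff)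
      qed (use m in auto)
      finally show ?thesis .
    qed
    have "(\<Sum>j\<le>n. real (mex_tail r n j) * indicator {real j / m..<(real j + 1) / m} x) =
          (\<Sum>j\<le>n. if nat \<lfloor>x * m\<rfloor> = j then indicator {0..} x * real (mex_tail r n j) else 0)"
      unfolding indicator_def iff by (intro sum.cong refl) auto
    also have "\<dots> = indicator {0..} x * real (mex_tail r n (nat \<lfloor>x * m\<rfloor>))"
      using mex_tail_eq_0[OF assms(1), of n "nat \<lfloor>x * m\<rfloor>"] by (auto simp: not_le)
    finally show "(\<Sum>j\<le>n. real (mex_tail r n j) * indicator {real j / m..<(real j + 1) / m} x) =
          indicator {0..} x * real (mex_tail r n (nat \<lfloor>x * m\<rfloor>))" .
  qed
  finally show ?thesis by (simp only: m_def)
qed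

theorem sum_mex_tail_limit:
  assumes r: "r \<ge> 1"
  shows "(\<lambda>n. (\<Sum>j\<le>n. real (mex_tail r n j)) / (real n powr (1/4) * real (num_partitions n))) \<longlonglongrightarrow> sqrt (2 * sqrt 6 / real r) / 2"
proof -
  define h where "h = (\<lambda>n x. indicator {0..} x * real (mex_tail r n (nat \<lfloor>x * real n powr (1/4)\<rfloor>)) / real (num_partitions n))"
  \<comment> \<open>With \<open>j\<close> close to \<open>x * n powr (1/4)\<close>, the removed size
    over \<open>sqrt n\<close> tends to \<open>r * x^2 / 2\<close>; inserted for \<open>y\<close> in
    \<open>num_partitions_ratio_limit\<close> this gives the exponent
    \<open>- a * x^2\<close>.\<close>
  define a where "a = pi * sqrt (2 / 3) * real r / 4"
  have a: "a > 0" using r by (simp add: a_def)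
  obtain K where K: "K > 0" "\<And>n s. n > 0 \<Longrightarrow> s \<le> n \<Longrightarrow> real (num_partitions (n - s)) / real (num_partitions n) \<le> K / (1 + real s / sqrt (real n))"
    using num_partitions_ratio_bound by blast
  have int: "has_bochner_integral lborel (h n) ((\<Sum>j\<le>n. real (mex_tail r n j)) / (real n powr (1/4) * real (num_partitions n)))" if "n > 0" for n
    unfolding h_def using has_bochner_integral_divide_zero[OF sum_mex_tail_integral[OF r that], of "real (num_partitions n)"]
    by simp

  have pointwise: "(\<lambda>n. h n x) \<longlonglongrightarrow> indicator {0..} x *\<^sub>R exp (- (a * x\<^sup>2))" for x
  proof (cases "x \<ge> 0")
    case True
    define j where "j = (\<lambda>n. nat \<lfloor>x * real n powr (1/4)\<rfloor>)"
    define s where "s = (\<lambda>n. r * \<Sum>{1..j n})"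
    have j_lim: "(\<lambda>n. real (j n) / real n powr (1/4)) \<longlonglongrightarrow> x"
    proof (rule tendsto_sandwich)
      have j: "x * real n powr (1/4) - 1 \<le> real (j n)" "real (j n) \<le> x * real n powr (1/4)" for n
        using True unfolding j_def by (linarith, simp)
      show "eventually (\<lambda>n. x - 1 / real n powr (1/4) \<le> real (j n) / real n powr (1/4)) sequentially"
        using eventually_gt_at_top[of 0]
      proof eventually_elim
        case (elim n)
        have "(x * real n powr (1/4) - 1) / real n powr (1/4) \<le> real (j n) / real n powr (1/4)"
          by (intro divide_right_mono j) auto
        thus ?case using elim by (simp add: diff_divide_distrib)
      qed
      show "eventually (\<lambda>n. real (j n) / real n powr (1/4) \<le> x) sequentially"
        using eventually_gt_at_top[of 0]
        by eventually_elim (use j(2) in \<open>simp add: field_simps\<close>)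
      show "(\<lambda>n. x - 1 / real n powr (1/4)) \<longlonglongrightarrow> x" by real_asymp
    qed simp
    have "(\<lambda>n. real r * (real (j n) / real n powr (1/4)) * (real (j n) / real n powr (1/4) + 1 / real n powr (1/4)) / 2) \<longlonglongrightarrow> real r * x * (x + 0) / 2"
      by (intro tendsto_intros j_lim) (real_asymp | simp)+
    hence s_lim: "(\<lambda>n. real (s n) / sqrt (real n)) \<longlonglongrightarrow> real r * x * (x + 0) / 2"
    proof (rule Lim_transform_eventually)
      show "eventually (\<lambda>n. real r * (real (j n) / real n powr (1/4)) * (real (j n) / real n powr (1/4) + 1 / real n powr (1/4)) / 2 = real (s n) / sqrt (real n)) sequentially"
        using eventually_gt_at_top[of 0]
      proof eventually_elim
        case (elim n)
        have root: "real n powr (1/4) * real n powr (1/4) = sqrt (real n)"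
          using elim by (simp add: powr_add[symmetric] powr_half_sqrt)
        have s: "real (s n) = real r * (real (j n) * (real (j n) + 1) / 2)"
          unfolding s_def of_nat_mult real_sum_upto ..
        show ?case
          unfolding s root[symmetric] by (simp add: add_divide_distrib[symmetric])
      qed
    qed
    have "(\<lambda>n. real (s n) / sqrt (real n) * (1 / sqrt (real n))) \<longlonglongrightarrow> real r * x * (x + 0) / 2 * 0"
      by (intro tendsto_mult s_lim) real_asymp
    hence "eventually (\<lambda>n. real (s n) / sqrt (real n) * (1 / sqrt (real n)) < 1) sequentially"
      by (rule order_tendstoD) simp
    hence s_le: "eventually (\<lambda>n. s n \<le> n) sequentially"
      using eventually_gt_at_top[of 0] by eventually_elim simp
    have "(\<lambda>n. real (num_partitions (n - s n)) / real (num_partitions n)) \<longlonglongrightarrow> exp (- (pi * sqrt (2 / 3) * (real r * x * (x + 0) / 2) / 2))"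
      by (rule num_partitions_ratio_limit[OF s_le s_lim])
    also have "exp (- (pi * sqrt (2 / 3) * (real r * x * (x + 0) / 2) / 2)) = indicator {0..} x *\<^sub>R exp (- (a * x\<^sup>2))"
      using True by (simp add: a_def power2_eq_square)
    finally show ?thesis
    proof (rule Lim_transform_eventually)
      show "eventually (\<lambda>n. real (num_partitions (n - s n)) / real (num_partitions n) = h n x) sequentially"
        using s_le by eventually_elim (use True in \<open>simp add: h_def mex_tail_def s_def j_def\<close>)
    qed
  qed (simp add: h_def)

  have bound: "norm (h n x) \<le> 4 * K * (1 / (1 + x\<^sup>2))" if n: "n > 0" for n x
  proof (cases "x \<ge> 0 \<and> r * \<Sum>{1..nat \<lfloor>x * real n powr (1/4)\<rfloor>} \<le> n")
    case False
    hence "h n x = 0" by (auto simp: h_def mex_tail_def)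
    thus ?thesis using K(1) by simp
  next
    case True
    define m where "m = real n powr (1/4)"
    define j where "j = nat \<lfloor>x * m\<rfloor>"
    define s where "s = r * \<Sum>{1..j}"
    have m: "m \<ge> 1" using n by (simp add: m_def ge_one_powr_ge_zero)
    have m_sq: "m * m = sqrt (real n)" using n by (simp add: m_def powr_add[symmetric] powr_half_sqrt)
    have j: "x * m \<le> real j + 1" using True m unfolding j_def by linarith
    have s: "s \<le> n" using True by (simp add: s_def j_def m_def)
    have "norm (h n x) = real (num_partitions (n - s)) / real (num_partitions n)"
      using True s by (simp add: h_def mex_tail_def s_def j_def m_def)
    also have "\<dots> \<le> K / (1 + real s / sqrt (real n))" by (rule K(2)[OF n s])
    also have "\<dots> \<le> K / ((1 + x\<^sup>2) / 4)"
    proof (rule divide_left_mono)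
      \<comment> \<open>Rounding down loses a constant factor only: for \<open>j = 0\<close> one has
        \<open>x \<le> 1\<close>, and for \<open>j \<ge> 1\<close> the bound
        \<open>(j + 1)^2 \<le> 2 * j * (j + 1)\<close> gives four times the triangular
        number.\<close>
      show "(1 + x\<^sup>2) / 4 \<le> 1 + real s / sqrt (real n)"
      proof (cases "j = 0")
        case True
        hence "x * m \<le> 1" using j by simp
        moreover have "x * 1 \<le> x * m" using \<open>x \<ge> 0 \<and> _\<close> m by (intro mult_left_mono) auto
        ultimately have "x\<^sup>2 \<le> 1" using \<open>x \<ge> 0 \<and> _\<close> by (simp add: power_le_one)
        hence "(1 + x\<^sup>2) / 4 \<le> 1 + 0" by simp
        also have "\<dots> \<le> 1 + real s / sqrt (real n)" by (intro add_left_mono) simp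
        finally show ?thesis .
      next
        case False
        have "(x * m) * (x * m) \<le> (real j + 1) * (real j + 1)"
          using j \<open>x \<ge> 0 \<and> _\<close> m by (intro mult_mono) auto
        also have "\<dots> \<le> 2 * real j * (real j + 1)"
          using False by (intro mult_right_mono) auto
        also have "\<dots> = 2 * (real j * (real j + 1))" by simp
        also have "\<dots> = 4 * (1 * real (\<Sum>{1..j}))" unfolding real_sum_upto by simp
        also have "\<dots> \<le> 4 * (real r * real (\<Sum>{1..j}))"
          using r by (intro mult_left_mono mult_right_mono of_nat_0_le_iff) auto
        finally have "x\<^sup>2 * (m * m) \<le> 4 * real s" by (simp add: s_def power2_eq_square mult_ac)
        hence "x\<^sup>2 / 4 \<le> real s / sqrt (real n)"
          unfolding m_sq using n by (simp add: field_simps)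
        thus ?thesis by simp
      qed
      show "0 < (1 + real s / sqrt (real n)) * ((1 + x\<^sup>2) / 4)"
        by (intro mult_pos_pos add_pos_nonneg divide_pos_pos) auto
    qed (use K in simp)
    finally show ?thesis by (simp add: mult.commute)
  qed
  have "(\<lambda>n. \<integral>x. h (Suc n) x \<partial>lborel) \<longlonglongrightarrow> (\<integral>x. indicator {0..} x *\<^sub>R exp (- (a * x\<^sup>2)) \<partial>lborel)"
  proof (rule integral_dominated_convergence)
    show "integrable lborel (\<lambda>x. 4 * K * (1 / (1 + x\<^sup>2)))"
      by (intro integrable_mult_right integrable_cauchy_density)
    show "AE x in lborel. (\<lambda>n. h (Suc n) x) \<longlonglongrightarrow> indicator {0..} x *\<^sub>R exp (- (a * x\<^sup>2))"
      using LIMSEQ_Suc[OF pointwise] by simp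
    show "AE x in lborel. norm (h (Suc n) x) \<le> 4 * K * (1 / (1 + x\<^sup>2))" for n
      using bound[of "Suc n"] by simp
    show "h (Suc n) \<in> borel_measurable lborel" for n
      using int[of "Suc n"] by (auto simp: has_bochner_integral_iff)
  qed simp
  also have "(\<integral>x. indicator {0..} x *\<^sub>R exp (- (a * x\<^sup>2)) \<partial>lborel) = sqrt (pi / a) / 2"
    by (rule has_bochner_integral_integral_eq[OF gaussian_half_line[OF a]])
  also have "pi / a = 2 * sqrt 6 / real r"
  proof -
    have "sqrt 6 * sqrt (2 / 3) = 2" unfolding real_sqrt_mult[symmetric] by simp
    hence "4 = 2 * sqrt 6 * sqrt (2 / 3)" by simp
    hence "4 / sqrt (2 / 3) = 2 * sqrt 6" by (subst divide_eq_eq) simp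
    moreover have "pi / a = 4 / sqrt (2 / 3) / real r" by (simp add: a_def)
    ultimately show ?thesis by (simp only:)
  qed
  also have "(\<lambda>n. \<integral>x. h (Suc n) x \<partial>lborel) = (\<lambda>n. (\<Sum>j\<le>Suc n. real (mex_tail r (Suc n) j)) / (real (Suc n) powr (1/4) * real (num_partitions (Suc n))))"
    using has_bochner_integral_integral_eq[OF int[of "Suc _"]] by blast
  finally show ?thesis by (rule LIMSEQ_imp_Suc)
qed

section \<open>Sum, difference and the constant\<close>

theorem theorem1p7:
  fixes r :: nat
  assumes "r > 1"
  shows "(\<lambda>n. real (sigma_o_mex r n)) \<sim>[sequentially] (\<lambda>n. real (sigma_e_mex r n))
       \<and> (\<lambda>n. real (sigma_e_mex r n)) \<sim>[sequentially]
           (\<lambda>n. 1 / 8 * (6 * real n ^ 3 * real r ^ 2) powr (- 1 / 4)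
                  * exp (pi * sqrt (2 * real n / 3)))"
proof -
  have r: "r \<ge> 1" using assms by simp
  define w where "w = (\<lambda>n. real n powr (1/4) * real (num_partitions n))"
  define c where "c = sqrt (2 * sqrt 6 / real r) / 2"
  define T where "T = (\<lambda>n. 1 / 8 * (6 * real n ^ 3 * real r ^ 2) powr (- 1 / 4) * exp (pi * sqrt (2 * real n / 3)))"
  have c: "c > 0" using r by (simp add: c_def)
  have w_pos: "w n > 0" if "n > 0" for n
    using num_partitions_pos[of n] that by (simp add: w_def)
  have total: "(\<lambda>n. (real (sigma_o_mex r n) + real (sigma_e_mex r n)) / w n) \<longlonglongrightarrow> c"
    using sum_mex_tail_limit[OF r] unfolding c_def w_def
    by (simp only: of_nat_add[symmetric] sigma_mex_sum[OF r] of_nat_sum)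

  \<comment> \<open>The error bound of \<open>sigma_mex_diff\<close> over \<open>w n\<close>,
    arranged so that in the polynomial summand p(n) occurs only through the expression of
    \<open>num_partitions_limit\<close>; the exponential makes that summand vanish.\<close>
  have "(\<lambda>n. 4 / real n powr (1/4) + 4 * (real n + 1)\<^sup>2 * exp (- (pi * sqrt (2 * real n / 3))) * real n powr (3/4) *
         (1 / (real (num_partitions n) * real n * exp (- (pi * sqrt (2 * real n / 3)))))) \<longlonglongrightarrow> 0 + 0 * (1 / (1 / (4 * sqrt 3)))"
    by (intro tendsto_add tendsto_mult tendsto_divide tendsto_const num_partitions_limit) (real_asymp | simp)+
  hence error: "(\<lambda>n. (4 * real (num_partitions n) + 4 * (real n + 1)\<^sup>2) / w n) \<longlonglongrightarrow> 0 + 0 * (1 / (1 / (4 * sqrt 3)))"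
  proof (rule Lim_transform_eventually)
    show "eventually (\<lambda>n. 4 / real n powr (1/4) + 4 * (real n + 1)\<^sup>2 * exp (- (pi * sqrt (2 * real n / 3))) * real n powr (3/4) *
         (1 / (real (num_partitions n) * real n * exp (- (pi * sqrt (2 * real n / 3))))) = (4 * real (num_partitions n) + 4 * (real n + 1)\<^sup>2) / w n) sequentially"
      using eventually_gt_at_top[of 0]
    proof eventually_elim
      case (elim n)
      have "real n powr (3/4) * real n powr (1/4) = real n"
        using elim by (simp add: powr_add[symmetric])
      hence "real n powr (3/4) / real n = 1 / real n powr (1/4)"
        using elim by (simp add: field_simps)
      moreover have "4 * (real n + 1)\<^sup>2 * exp (- (pi * sqrt (2 * real n / 3))) * real n powr (3/4) *
         (1 / (real (num_partitions n) * real n * exp (- (pi * sqrt (2 * real n / 3))))) =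
         4 * (real n + 1)\<^sup>2 / real (num_partitions n) * (real n powr (3/4) / real n)"
        by simp
      ultimately show ?case
        using num_partitions_pos[of n] elim by (simp add: w_def add_divide_distrib)
    qed
  qed
  have diff: "(\<lambda>n. (real (sigma_o_mex r n) - real (sigma_e_mex r n)) / w n) \<longlonglongrightarrow> 0"
  proof (rule Lim_null_comparison)
    show "eventually (\<lambda>n. norm ((real (sigma_o_mex r n) - real (sigma_e_mex r n)) / w n) \<le> (4 * real (num_partitions n) + 4 * (real n + 1)\<^sup>2) / w n) sequentially"
      using eventually_gt_at_top[of 0]
      by eventually_elim (use w_pos sigma_mex_diff[OF r] in \<open>simp add: divide_right_mono less_imp_le\<close>)
    show "(\<lambda>n. (4 * real (num_partitions n) + 4 * (real n + 1)\<^sup>2) / w n) \<longlonglongrightarrow> 0"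
      using error by simp
  qed
  have "(\<lambda>n. ((real (sigma_o_mex r n) + real (sigma_e_mex r n)) / w n + (real (sigma_o_mex r n) - real (sigma_e_mex r n)) / w n) / 2) \<longlonglongrightarrow> (c + 0) / 2"
    by (intro tendsto_intros total diff) simp
  hence lim_o: "(\<lambda>n. real (sigma_o_mex r n) / w n) \<longlonglongrightarrow> c / 2"
    by (simp add: add_divide_distrib[symmetric])
  have "(\<lambda>n. ((real (sigma_o_mex r n) + real (sigma_e_mex r n)) / w n - (real (sigma_o_mex r n) - real (sigma_e_mex r n)) / w n) / 2) \<longlonglongrightarrow> (c - 0) / 2"
    by (intro tendsto_intros total diff) simp
  hence lim_e: "(\<lambda>n. real (sigma_e_mex r n) / w n) \<longlonglongrightarrow> c / 2"
    by (simp add: diff_divide_distrib[symmetric])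

  have "(\<lambda>n. (real (sigma_o_mex r n) / w n) / (real (sigma_e_mex r n) / w n)) \<longlonglongrightarrow> (c / 2) / (c / 2)"
    by (intro tendsto_divide lim_o lim_e) (use c in simp)
  hence "(\<lambda>n. real (sigma_o_mex r n) / real (sigma_e_mex r n)) \<longlonglongrightarrow> (c / 2) / (c / 2)"
  proof (rule Lim_transform_eventually)
    show "eventually (\<lambda>n. (real (sigma_o_mex r n) / w n) / (real (sigma_e_mex r n) / w n) = real (sigma_o_mex r n) / real (sigma_e_mex r n)) sequentially"
      using eventually_gt_at_top[of 0] by eventually_elim (simp add: less_imp_neq[OF w_pos, symmetric])
  qed
  hence first: "(\<lambda>n. real (sigma_o_mex r n)) \<sim>[sequentially] (\<lambda>n. real (sigma_e_mex r n))"
    using c by (intro asymp_equivI') simp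

  \<comment> \<open>Chosen so that \<open>T n\<close> is the exponential divided by
    \<open>d * real n powr (3/4)\<close>.\<close>
  define d where "d = 8 * 6 powr (1/4) * sqrt (real r)"
  have "(\<lambda>n. real (sigma_e_mex r n) / w n * (real (num_partitions n) * real n * exp (- (pi * sqrt (2 * real n / 3)))) * d) \<longlonglongrightarrow> c / 2 * (1 / (4 * sqrt 3)) * d"
    by (intro tendsto_mult lim_e num_partitions_limit tendsto_const)
  hence "(\<lambda>n. real (sigma_e_mex r n) / T n) \<longlonglongrightarrow> c / 2 * (1 / (4 * sqrt 3)) * d"
  proof (rule Lim_transform_eventually)
    show "eventually (\<lambda>n. real (sigma_e_mex r n) / w n * (real (num_partitions n) * real n * exp (- (pi * sqrt (2 * real n / 3)))) * d = real (sigma_e_mex r n) / T n) sequentially"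
      using eventually_gt_at_top[of 0]
    proof eventually_elim
      case (elim n)
      have "(6 * real n ^ 3 * real r ^ 2) powr (- 1 / 4) = 1 / (6 powr (1/4) * real n powr (3/4) * sqrt (real r))"
      proof -
        have "real n ^ 3 = real n powr 3" "real r ^ 2 = real r powr 2"
          using elim r by (simp_all add: powr_numeral)
        hence "(6 * real n ^ 3 * real r ^ 2) powr (- 1 / 4) = 6 powr (- (1/4)) * real n powr (- (3/4)) * real r powr (- (1/2))"
          by (simp add: powr_mult powr_powr del: powr_numeral)
        thus ?thesis by (simp add: powr_minus_divide powr_half_sqrt)
      qed
      hence T: "T n = exp (pi * sqrt (2 * real n / 3)) / (d * real n powr (3/4))"
        by (simp add: T_def d_def)
      have "real n powr (3/4) * real n powr (1/4) = real n"
        using elim by (simp add: powr_add[symmetric])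
      hence "real n / real n powr (1/4) = real n powr (3/4)"
        using elim by (simp add: field_simps)
      moreover have "real (sigma_e_mex r n) / w n * (real (num_partitions n) * real n * exp (- (pi * sqrt (2 * real n / 3)))) * d
          = real (sigma_e_mex r n) * (real n / real n powr (1/4)) * exp (- (pi * sqrt (2 * real n / 3))) * d"
        using num_partitions_pos[of n] by (simp add: w_def)
      ultimately show ?case
        unfolding T by (simp add: exp_minus field_simps)
    qed
  qed
  \<comment> \<open>\<open>c\<close> and \<open>d\<close> each contain a fourth root of 6, whose
    product \<open>sqrt 6\<close> cancels against \<open>sqrt 3\<close>; the roots of
    \<open>r\<close> cancel as well.\<close>
  also have "c / 2 * (1 / (4 * sqrt 3)) * d = 1"
  proof -
    define q where "q = sqrt (sqrt 6)"
    have "6 powr (1/4) = ((6::real) powr (1/2)) powr (1/2)" by (simp only: powr_powr) simp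
    hence q: "6 powr (1/4) = q" by (simp add: q_def powr_half_sqrt)
    define R where "R = sqrt (real r)"
    have R: "R \<noteq> 0" using r by (simp add: R_def)
    have q_sq: "q * q = sqrt 2 * sqrt 3" by (simp add: q_def flip: real_sqrt_mult)
    have c_eq: "c = sqrt 2 * q / R / 2"
      by (simp add: c_def q_def R_def real_sqrt_mult real_sqrt_divide)
    have "c / 2 * (1 / (4 * sqrt 3)) * d = sqrt 2 * (q * q) / (2 * sqrt 3)"
      unfolding c_eq d_def q R_def[symmetric] using R by (simp add: field_simps)
    also have "\<dots> = sqrt 2 * sqrt 2 / 2"
      unfolding q_sq by simp
    also have "\<dots> = 1" by simp
    finally show ?thesis .
  qed
  finally have "(\<lambda>n. real (sigma_e_mex r n)) \<sim>[sequentially] T"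
    by (rule asymp_equivI')
  with first show ?thesis unfolding T_def by simp
qed

end
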